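(* Let $M$ be an $m$-dimensional Riemannian manifold with inner products $\langle\cdot,\cdot\rangle_x$ and norms $\|\cdot\|_x$ on $T_xM$ ($x\in M$), equipped with a $C^2$ retraction $R:TM\to M$. Let $\Omega$ be a probability space with probability measure $\mu$. Let $f:M\times\Omega\to\mathbb{R}$ be a random function on $M$ such that (i) $f$ is first-order differentiable in the $M$-direction, (ii) $f$ and $\|\nabla_M f\|$ are locally bounded on $M$, (iii) $f$ has locally $R$-Lipschitz gradient in the $M$-direction. Let $F:M\to\mathbb{R}$ be the expectation $F(x)=E(f(x,\omega))=\int_\Omega f(x,\omega)\,d\mu$ for all $x\in M$. Fix $\kappa>0$ and let $\rho:M\to\mathbb{R}$ be a ($C^2$) $\kappa$-confinement of $f$; fix $\rho_0<\rho_1$ as in the definition of a $\kappa$-confinement, and set $K_1:=\{x\in M \mid \rho(x)\le\rho_1\}$. Let $\{\omega_t\}_{t=0}^\infty$ be a sequence of independent random variables taking values in $\Omega$ with identical probability distribution $\mu$. Let $x_0\in K_1$ be a fixed point. Fix positive constants $\varepsilon,\alpha,\beta$ with $0<\varepsilon\le\frac12$ and $\frac{\alpha}{\beta^{\frac12+\varepsilon}}\le\kappa$. Define a sequence $\{x_t\}_{t=0}^\infty$ of random elements of $M$ and a sequence $\{\eta_t\}_{t=0}^\infty$ of random positive numbers by $$x_{t+1}=R_{x_t}\bigl(-\eta_t\nabla_M f(x_t,\omega_t)\bigr),\qquad \eta_t=\frac{\alpha}{\bigl(\beta+\sum_{s=0}^{t-1}\|\nabla_M f(x_s,\omega_s)\|_{x_s}^2\bigr)^{\frac12+\varepsilon}}\qquad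 (t\ge 0).$$ Then: 1. $\{x_t\}_{t=0}^\infty$ is contained in the compact subset $K_1$ of $M$; in particular, it has convergent subsequences. 2. $\{\|\nabla F(x_t)\|_{x_t}\}_{t=0}^\infty$ converges almost surely to $0$. 3. Any limit point of $\{x_t\}_{t=0}^\infty$ is almost surely a stationary point of $F$.
   Context: Random function: a function $f:M\times\Omega\to\mathbb{R}$, with $M$ a differentiable manifold and $\Omega$ a probability space. It is first-order differentiable in the $M$-direction if $f(\cdot,\omega):M\to\mathbb{R}$ is first-order differentiable for every $\omega\in\Omega$. $\nabla_M f(x,\omega)\in T_xM$ denotes the Riemannian gradient of $f(\cdot,\omega)$ at $x$. A function $h$ on $M\times\Omega$ is locally bounded on $M$ if for every compact $K\subset M$ there is $C_K>0$ with $|h(x,\omega)|\le C_K$ for all $(x,\omega)\in K\times\Omega$. Retraction: a $C^1$ map $R:TM\to M$ such that for every $x\in M$ the restriction $R_x=R|_{T_xM}$ satisfies $R_x(\mathbf{0}_x)=x$ and $dR_x(\mathbf{0}_x)=\mathrm{id}_{T_xM}$ (under $T_{\mathbf{0}_x}T_xM\cong T_xM$). Locally $R$-Lipschitz gradient: put $f_{x,\omega}:=f(R_x(\cdot),\omega):T_xM\to\mathbb{R}$, with gradient $\nabla f_{x,\omega}$ taken with respect to $\langle\cdot,\cdot\rangle_x$. $f$ has locally $R$-Lipschitz gradient in the $M$-direction if for every compact $K\subset M$ and every $r>0$ there is $C_{K,r}>0$ such that $\|\nabla f_{x,\omega}(\mathbf{v})-\nabla f_{x,\omega}(\mathbf{0}_x)\|_x\le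 C_{K,r}\|\mathbf{v}\|_x$ for every $x\in K$, every $\mathbf{v}\in T_xM$ with $\|\mathbf{v}\|_x\le r$ and every $\omega\in\Omega$. $\kappa$-confinement (for $\kappa>0$): a $C^2$ function $\rho:M\to\mathbb{R}$ such that $\{x\in M\mid\rho(x)\le c\}$ is compact for every $c\in\mathbb{R}$, and there exist real $\rho_0<\rho_1$ with: (a) $\rho(R_x(-s\nabla_M f(x,\omega)))\le\rho_1$ for every $s\in[0,\kappa]$, $\omega\in\Omega$ and $x\in M$ with $\rho(x)\le\rho_0$; (b) $\langle\nabla\rho(x),\nabla_M f(x,\omega)\rangle_x\ge\frac{\kappa}{2}\bigl|\mathrm{Hess}(\rho\circ R_x)|_{-s\nabla_M f(x,\omega)}(\nabla_M f(x,\omega),\nabla_M f(x,\omega))\bigr|$ for every $s\in[0,\kappa]$, $\omega\in\Omega$ and $x\in M$ with $\rho_0\le\rho(x)\le\rho_1$, where $\mathrm{Hess}(\rho\circ R_x)$ is the Hessian of $\rho\circ R_x$ on the inner product space $T_xM$. *)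

theory Defs
  imports "HOL-Probability.Probability"
begin

section \<open>Differentiability classes on open subsets of Euclidean spaces\<close>

text \<open>
  In finite dimension, and for open S, this is the usual notion of k times continuously
  differentiable: all iterated directional derivatives up to order k exist and are continuous.
\<close>

fun Ck_on :: "nat \<Rightarrow> 'a::euclidean_space set \<Rightarrow> ('a \<Rightarrow> 'b::real_normed_vector) \<Rightarrow> bool" where
  "Ck_on 0 S h \<longleftrightarrow> continuous_on S h"
| "Ck_on (Suc k) S h \<longleftrightarrow>
     (\<forall>x\<in>S. h differentiable (at x)) \<and> (\<forall>v. Ck_on k S (\<lambda>x. frechet_derivative h (at x) v))"

definition smooth_on :: "'a::euclidean_space set \<Rightarrow> ('a \<Rightarrow> 'b::real_normed_vector) \<Rightarrow> bool" where
  "smooth_on S h \<longleftrightarrow> (\<forall>k. Ck_on k S h)"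

definition hessian :: "('e::euclidean_space \<Rightarrow> real) \<Rightarrow> 'e \<Rightarrow> 'e \<Rightarrow> 'e \<Rightarrow> real" where
  "hessian h w u v = frechet_derivative (\<lambda>y. frechet_derivative h (at y) u) (at w) v"

text \<open>The gradient at w with respect to an inner product b that need not be the standard one.\<close>

definition gradient_wrt ::
  "('e::euclidean_space \<Rightarrow> 'e \<Rightarrow> real) \<Rightarrow> ('e \<Rightarrow> real) \<Rightarrow> 'e \<Rightarrow> 'e" where
  "gradient_wrt b h w = (THE G. \<forall>v. b G v = frechet_derivative h (at w) v)"


section \<open>Smooth manifolds and tangent vectors\<close>

text \<open>
  A manifold is a whole type 'a (Hausdorff, second countable) with a smooth, not necessarily
  maximal, atlas A modelled on the Euclidean space 'e; its dimension is DIM('e).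
\<close>

type_synonym ('a, 'e) chart = "'a set \<times> ('a \<Rightarrow> 'e)"

definition chart_inv :: "('a, 'e) chart \<Rightarrow> 'e \<Rightarrow> 'a" where
  "chart_inv c = inv_into (fst c) (snd c)"

definition chart_image :: "('a, 'e) chart \<Rightarrow> 'e set" where
  "chart_image c = snd c ` fst c"

definition smooth_atlas ::
  "('a::{t2_space, second_countable_topology}, 'e::euclidean_space) chart set \<Rightarrow> bool" where
  "smooth_atlas A \<longleftrightarrow>
     (\<Union>c\<in>A. fst c) = UNIV \<and>
     (\<forall>c\<in>A. open (fst c) \<and> open (chart_image c) \<and>
        homeomorphism (fst c) (chart_image c) (snd c) (chart_inv c)) \<and>
     (\<forall>c\<in>A. \<forall>d\<in>A. smooth_on (snd c ` (fst c \<inter> fst d)) (snd d \<circ> chart_inv c))"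

text \<open>
  Tangent spaces: every point x gets one preferred chart of the atlas around it, and the tangent
  space at x is the vector space 'e, a vector standing for its components in the preferred chart.
  The components in another chart c are obtained with the differential of the transition map.
  The preferred charts at different points are unrelated, so statements relating the tangent spaces
  at different points (smoothness of a metric, maps on the tangent bundle) are made in the
  components with respect to one chart of the atlas.
\<close>

definition chart_at :: "('a, 'e) chart set \<Rightarrow> 'a \<Rightarrow> ('a, 'e) chart" where
  "chart_at A x = (SOME c. c \<in> A \<and> x \<in> fst c)"

text \<open>The tangent vector at x whose components in the chart c are v.\<close>

definition tangent_vector ::
  "('a, 'e::euclidean_space) chart set \<Rightarrow> ('a, 'e) chart \<Rightarrow> 'a \<Rightarrow> 'e \<Rightarrow> 'e" where
  "tangent_vector A c x v =
     frechet_derivative (snd (chart_at A x) \<circ> chart_inv c) (at (snd c x)) v"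

definition manifold_differentiable_at ::
  "('a, 'e::euclidean_space) chart set \<Rightarrow> ('a \<Rightarrow> real) \<Rightarrow> 'a \<Rightarrow> bool" where
  "manifold_differentiable_at A h x \<longleftrightarrow>
     (\<forall>c\<in>A. x \<in> fst c \<longrightarrow> (h \<circ> chart_inv c) differentiable (at (snd c x)))"

definition manifold_Ck ::
  "('a, 'e::euclidean_space) chart set \<Rightarrow> nat \<Rightarrow> ('a \<Rightarrow> real) \<Rightarrow> bool" where
  "manifold_Ck A k h \<longleftrightarrow> (\<forall>c\<in>A. Ck_on k (chart_image c) (h \<circ> chart_inv c))"


section \<open>Riemannian metrics and gradients\<close>

definition inner_product_form :: "('e::euclidean_space \<Rightarrow> 'e \<Rightarrow> real) \<Rightarrow> bool" where
  "inner_product_form b \<longleftrightarrow>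
     (\<forall>v. linear (\<lambda>u. b u v)) \<and> (\<forall>u v. b u v = b v u) \<and> (\<forall>v. v \<noteq> 0 \<longrightarrow> 0 < b v v)"

definition riemannian_manifold ::
  "('a::{t2_space, second_countable_topology}, 'e::euclidean_space) chart set \<Rightarrow>
   ('a \<Rightarrow> 'e \<Rightarrow> 'e \<Rightarrow> real) \<Rightarrow> bool" where
  "riemannian_manifold A g \<longleftrightarrow>
     smooth_atlas A \<and>
     (\<forall>x. inner_product_form (g x)) \<and>
     (\<forall>c\<in>A. \<forall>u v. smooth_on (chart_image c)
        (\<lambda>y. let x = chart_inv c y in g x (tangent_vector A c x u) (tangent_vector A c x v)))"

definition tangent_norm :: "('a \<Rightarrow> 'e \<Rightarrow> 'e \<Rightarrow> real) \<Rightarrow> 'a \<Rightarrow> 'e \<Rightarrow> real" where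
  "tangent_norm g x v = sqrt (g x v v)"

definition riemannian_gradient ::
  "('a, 'e::euclidean_space) chart set \<Rightarrow> ('a \<Rightarrow> 'e \<Rightarrow> 'e \<Rightarrow> real) \<Rightarrow> ('a \<Rightarrow> real) \<Rightarrow> 'a \<Rightarrow> 'e" where
  "riemannian_gradient A g h x =
     gradient_wrt (g x) (h \<circ> chart_inv (chart_at A x)) (snd (chart_at A x) x)"

definition stationary_point ::
  "('a, 'e::euclidean_space) chart set \<Rightarrow> ('a \<Rightarrow> 'e \<Rightarrow> 'e \<Rightarrow> real) \<Rightarrow> ('a \<Rightarrow> real) \<Rightarrow> 'a \<Rightarrow> bool" where
  "stationary_point A g h x \<longleftrightarrow>
     manifold_differentiable_at A h x \<and> riemannian_gradient A g h x = 0"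


section \<open>Retractions\<close>

text \<open>
  A map R from the tangent bundle to the manifold is given in curried form; \<open>R x\<close> is its
  restriction to the tangent space at x. The chart c gives the bundle chart with image
  \<open>chart_image c \<times> UNIV\<close>, in which R is the map \<open>bundle_expression A c R\<close>.
\<close>

definition bundle_expression ::
  "('a, 'e::euclidean_space) chart set \<Rightarrow> ('a, 'e) chart \<Rightarrow> ('a \<Rightarrow> 'e \<Rightarrow> 'b) \<Rightarrow> 'e \<times> 'e \<Rightarrow> 'b" where
  "bundle_expression A c R =
     (\<lambda>(y, w). let x = chart_inv c y in R x (tangent_vector A c x w))"

definition Ck_bundle_map ::
  "('a::topological_space, 'e::euclidean_space) chart set \<Rightarrow> nat \<Rightarrow> ('a \<Rightarrow> 'e \<Rightarrow> 'a) \<Rightarrow> bool" where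
  "Ck_bundle_map A k R \<longleftrightarrow>
     (\<forall>c\<in>A. continuous_on (chart_image c \<times> UNIV) (bundle_expression A c R) \<and>
        (\<forall>d\<in>A. Ck_on k {p \<in> chart_image c \<times> UNIV. bundle_expression A c R p \<in> fst d}
           (snd d \<circ> bundle_expression A c R)))"

text \<open>
  The differential of \<open>R x\<close> at the origin is taken in the preferred chart at x, since this is the
  chart that identifies the tangent space at \<open>x = R x 0\<close> with 'e.
\<close>

definition Ck_retraction ::
  "('a::topological_space, 'e::euclidean_space) chart set \<Rightarrow> nat \<Rightarrow> ('a \<Rightarrow> 'e \<Rightarrow> 'a) \<Rightarrow> bool" where
  "Ck_retraction A k R \<longleftrightarrow>
     1 \<le> k \<and> Ck_bundle_map A k R \<and>
     (\<forall>x. R x 0 = x \<and> ((snd (chart_at A x) \<circ> R x) has_derivative (\<lambda>v. v)) (at 0))"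


section \<open>Random functions\<close>

text \<open>
  Below, \<open>\<Omega>\<close> is the sample space and \<open>f x \<omega>\<close> a random function.
\<close>

definition locally_bounded :: "'w set \<Rightarrow> ('a::topological_space \<Rightarrow> 'w \<Rightarrow> real) \<Rightarrow> bool" where
  "locally_bounded \<Omega> h \<longleftrightarrow>
     (\<forall>K. compact K \<longrightarrow> (\<exists>C>0. \<forall>x\<in>K. \<forall>\<omega>\<in>\<Omega>. \<bar>h x \<omega>\<bar> \<le> C))"

definition locally_R_Lipschitz_gradient ::
  "('a::topological_space \<Rightarrow> 'e::euclidean_space \<Rightarrow> 'e \<Rightarrow> real) \<Rightarrow> ('a \<Rightarrow> 'e \<Rightarrow> 'a) \<Rightarrow>
   'w set \<Rightarrow> ('a \<Rightarrow> 'w \<Rightarrow> real) \<Rightarrow> bool" where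
  "locally_R_Lipschitz_gradient g R \<Omega> f \<longleftrightarrow>
     (\<forall>K r. compact K \<longrightarrow> r > 0 \<longrightarrow>
        (\<exists>C>0. \<forall>x\<in>K. \<forall>v. tangent_norm g x v \<le> r \<longrightarrow>
           (\<forall>\<omega>\<in>\<Omega>.
              tangent_norm g x
                (gradient_wrt (g x) (\<lambda>u. f (R x u) \<omega>) v - gradient_wrt (g x) (\<lambda>u. f (R x u) \<omega>) 0)
              \<le> C * tangent_norm g x v)))"

definition confinement_levels ::
  "('a, 'e::euclidean_space) chart set \<Rightarrow> ('a \<Rightarrow> 'e \<Rightarrow> 'e \<Rightarrow> real) \<Rightarrow> ('a \<Rightarrow> 'e \<Rightarrow> 'a) \<Rightarrow>
   'w set \<Rightarrow> ('a \<Rightarrow> 'w \<Rightarrow> real) \<Rightarrow> real \<Rightarrow> ('a \<Rightarrow> real) \<Rightarrow> real \<Rightarrow> real \<Rightarrow> bool" where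
  "confinement_levels A g R \<Omega> f \<kappa> \<rho> \<rho>0 \<rho>1 \<longleftrightarrow>
     \<rho>0 < \<rho>1 \<and>
     (\<forall>s\<in>{0..\<kappa>}. \<forall>\<omega>\<in>\<Omega>. \<forall>x. \<rho> x \<le> \<rho>0 \<longrightarrow>
        \<rho> (R x (- s *\<^sub>R riemannian_gradient A g (\<lambda>y. f y \<omega>) x)) \<le> \<rho>1) \<and>
     (\<forall>s\<in>{0..\<kappa>}. \<forall>\<omega>\<in>\<Omega>. \<forall>x. \<rho>0 \<le> \<rho> x \<longrightarrow> \<rho> x \<le> \<rho>1 \<longrightarrow>
        (let G = riemannian_gradient A g (\<lambda>y. f y \<omega>) x in
           g x (riemannian_gradient A g \<rho> x) G
             \<ge> \<kappa> / 2 * \<bar>hessian (\<rho> \<circ> R x) (- s *\<^sub>R G) G G\<bar>))"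

definition confinement ::
  "('a::topological_space, 'e::euclidean_space) chart set \<Rightarrow> ('a \<Rightarrow> 'e \<Rightarrow> 'e \<Rightarrow> real) \<Rightarrow>
   ('a \<Rightarrow> 'e \<Rightarrow> 'a) \<Rightarrow> 'w set \<Rightarrow> ('a \<Rightarrow> 'w \<Rightarrow> real) \<Rightarrow> real \<Rightarrow> ('a \<Rightarrow> real) \<Rightarrow> bool" where
  "confinement A g R \<Omega> f \<kappa> \<rho> \<longleftrightarrow>
     manifold_Ck A 2 \<rho> \<and>
     (\<forall>c. compact {x. \<rho> x \<le> c}) \<and>
     (\<exists>\<rho>0 \<rho>1. confinement_levels A g R \<Omega> f \<kappa> \<rho> \<rho>0 \<rho>1)"

definition limit_point_of_seq :: "(nat \<Rightarrow> 'a::topological_space) \<Rightarrow> 'a \<Rightarrow> bool" where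
  "limit_point_of_seq X l \<longleftrightarrow> (\<exists>r. strict_mono r \<and> (X \<circ> r) \<longlonglongrightarrow> l)"

end

theory Submission
  imports Defs
begin

text \<open>
  Along a step \<open>v = - \<eta> \<nabla>f\<close> the function \<open>\<rho> \<circ> R\<^sub>x\<close> does not increase, by its second order Taylor
  expansion and the confinement inequality, so the iterates stay in the compact set \<open>K1\<close>. The
  Lipschitz condition gives \<open>F (R\<^sub>x v) \<le> F x + \<langle>\<nabla>F x, v\<rangle> + C \<parallel>v\<parallel>\<^sup>2\<close> on \<open>K1\<close>. The step size depends on
  past samples only, so taking expectations replaces \<open>\<langle>\<nabla>F, \<nabla>f\<rangle>\<close> by \<open>\<parallel>\<nabla>F\<parallel>\<^sup>2\<close>, and since
  \<open>\<Sum> \<eta>\<^sub>t\<^sup>2 \<parallel>\<nabla>f\<parallel>\<^sup>2\<close> is bounded by a constant, \<open>\<Sum> \<eta>\<^sub>t \<parallel>\<nabla>F x\<^sub>t\<parallel>\<^sup>2 < \<infinity>\<close> almost surely, whereas \<open>\<Sum> \<eta>\<^sub>t = \<infinity>\<close>.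
  If \<open>\<parallel>\<nabla>F x\<^sub>t\<parallel>\<close> did not tend to \<open>0\<close>, it would infinitely often rise from below \<open>e\<close> to above \<open>2e\<close> along
  paths whose lengths tend to \<open>0\<close>, against the continuity of \<open>\<parallel>\<nabla>F\<parallel>\<close> on the compact set \<open>K1\<close>.
\<close>

section \<open>Inner products and gradients\<close>

text \<open>No distance on the manifold enters: closeness of iterates is measured by the summed
  norms of the retraction steps, and estimates in charts turn small sums into small changes of
  continuous functions. Tangent vectors are stored in preferred charts chosen independently at each
  point, so a vector field such as the gradient of \<open>F\<close> need not be continuous or
  measurable as an \<open>'e\<close>-valued map; such claims are made only for scalars, for points
  of the manifold, or for components in one fixed chart. That \<open>F\<close> is continuously
  differentiable comes from the Lipschitz condition: its Taylor remainder is uniform in the sample,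
  so difference quotients along the retraction converge uniformly. Likewise measurability is given
  only for each \<open>f x\<close>; joint measurability in point and sample, without which the
  \<open>X t\<close> would not be random elements, is obtained from continuity in \<open>x\<close>.
  The exponent \<open>q = 1/2 + \<epsilon>\<close> acts from two sides: \<open>1 < 2 * q\<close>
  bounds the sum of the squared step lengths on every path, and \<open>q \<le> 1\<close> keeps the
  sum of the step sizes infinite.\<close>

lemma inner_product_form_bilinear:
  assumes "inner_product_form b"
  shows "bilinear b"
proof -
  have "b u = (\<lambda>v. b v u)" for u
    using assms unfolding inner_product_form_def by blast
  then show ?thesis
    using assms unfolding inner_product_form_def bilinear_def by metis
qed

lemma inner_product_form_sym: "inner_product_form b \<Longrightarrow> b u v = b v u"
  unfolding inner_product_form_def by blast

lemma inner_product_form_nonneg: "inner_product_form b \<Longrightarrow> 0 \<le> b v v"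
  using inner_product_form_bilinear[of b] bilinear_lzero[of b]
  unfolding inner_product_form_def by (metis dual_order.refl less_imp_le)

lemma inner_product_form_eq_0: "inner_product_form b \<Longrightarrow> b v v = 0 \<longleftrightarrow> v = 0"
  using inner_product_form_bilinear[of b] bilinear_lzero[of b]
  unfolding inner_product_form_def by (metis less_irrefl)

lemma inner_product_form_Cauchy_Schwarz:
  assumes "inner_product_form b"
  shows "\<bar>b u v\<bar> \<le> sqrt (b u u) * sqrt (b v v)"
proof -
  note bl = inner_product_form_bilinear[OF assms]
  have q: "0 \<le> b u u + 2 * (t * b u v) + t\<^sup>2 * b v v" for t
  proof -
    have "b (u + t *\<^sub>R v) (u + t *\<^sub>R v) = b u u + 2 * (t * b u v) + t\<^sup>2 * b v v"
      by (simp add: bilinear_ladd[OF bl] bilinear_radd[OF bl] bilinear_lmul[OF bl]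
          bilinear_rmul[OF bl] inner_product_form_sym[OF assms, of v u] power2_eq_square algebra_simps)
    then show ?thesis
      using inner_product_form_nonneg[OF assms, of "u + t *\<^sub>R v"] by simp
  qed
  have "(b u v)\<^sup>2 \<le> b u u * b v v"
  proof (cases "v = 0")
    case True
    then show ?thesis by (simp add: bilinear_rzero[OF bl])
  next
    case False
    then have pos: "b v v > 0" using assms unfolding inner_product_form_def by blast
    \<comment> \<open>The chosen \<open>t\<close> is the minimiser of the quadratic.\<close>
    have "0 \<le> b u u + 2 * (- (b u v / b v v) * b u v) + (- (b u v / b v v))\<^sup>2 * b v v" by (rule q)
    also have "\<dots> = b u u - (b u v)\<^sup>2 / b v v"
      using pos by (simp add: field_simps power2_eq_square)
    finally show ?thesis using pos by (simp add: field_simps)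
  qed
  then show ?thesis
    by (metis real_sqrt_abs real_sqrt_le_mono real_sqrt_mult)
qed

text \<open>The map \<open>L\<close> represents \<open>b\<close> through the standard inner product.
  Definiteness makes it injective, hence surjective in finite dimension. This gives the
  \<open>THE\<close> in \<open>gradient_wrt\<close> and in \<open>riesz\<close> a value.\<close>

lemma inner_product_form_Riesz:
  fixes b :: "'e::euclidean_space \<Rightarrow> 'e \<Rightarrow> real"
  assumes "inner_product_form b" "linear \<phi>"
  shows "\<exists>!G. \<forall>v. b G v = \<phi> v"
proof -
  note bl = inner_product_form_bilinear[OF assms(1)]
  define L where "L = (\<lambda>G. \<Sum>i\<in>Basis. b G i *\<^sub>R i)"
  have lin: "linear L"
    unfolding L_def by (rule linearI)
      (simp_all add: bilinear_ladd[OF bl] bilinear_lmul[OF bl] algebra_simps sum.distrib scaleR_sum_right)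
  have L_inner: "L G \<bullet> v = b G v" for G v
  proof -
    have "b G v = b G (\<Sum>i\<in>Basis. (v \<bullet> i) *\<^sub>R i)" by (simp add: euclidean_representation)
    also have "\<dots> = (\<Sum>i\<in>Basis. (v \<bullet> i) * b G i)"
      using bl unfolding bilinear_def by (simp add: linear_sum linear_cmul)
    finally show ?thesis by (simp add: L_def inner_sum_left inner_commute[of v] mult.commute)
  qed
  have inj: "inj L"
    unfolding linear_injective_0[OF lin]
    by (metis L_inner assms(1) inner_product_form_eq_0 inner_zero_left)
  have "surj L" by (rule linear_injective_imp_surjective[OF lin inj]) simp
  then obtain G where G: "L G = (\<Sum>i\<in>Basis. \<phi> i *\<^sub>R i)" by (metis surjD)
  have phi: "\<phi> v = (\<Sum>i\<in>Basis. \<phi> i *\<^sub>R i) \<bullet> v" for v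
  proof -
    have "\<phi> v = \<phi> (\<Sum>i\<in>Basis. (v \<bullet> i) *\<^sub>R i)" by (simp add: euclidean_representation)
    also have "\<dots> = (\<Sum>i\<in>Basis. (v \<bullet> i) * \<phi> i)"
      using assms(2) by (simp add: linear_sum linear_cmul)
    finally show ?thesis by (simp add: inner_sum_left inner_commute[of v] mult.commute)
  qed
  show ?thesis
  proof
    show "\<forall>v. b G v = \<phi> v" using L_inner G phi by metis
    fix G' assume "\<forall>v. b G' v = \<phi> v"
    then have "L G' = L G" using L_inner \<open>\<forall>v. b G v = \<phi> v\<close> by (metis vector_eq_rdot)
    then show "G' = G" using inj by (simp add: inj_eq)
  qed
qed

lemma gradient_wrt:
  fixes b :: "'e::euclidean_space \<Rightarrow> 'e \<Rightarrow> real"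
  assumes "inner_product_form b" "h differentiable (at w)"
  shows "b (gradient_wrt b h w) v = frechet_derivative h (at w) v"
  using theI'[OF inner_product_form_Riesz[OF assms(1) linear_frechet_derivative[OF assms(2)]]]
  unfolding gradient_wrt_def by blast

lemma gradient_wrt_unique:
  fixes b :: "'e::euclidean_space \<Rightarrow> 'e \<Rightarrow> real"
  assumes "inner_product_form b" "h differentiable (at w)"
    and "\<And>v. b G v = frechet_derivative h (at w) v"
  shows "gradient_wrt b h w = G"
  using inner_product_form_Riesz[OF assms(1) linear_frechet_derivative[OF assms(2)]]
    gradient_wrt[OF assms(1,2)] assms(3) by blast

text \<open>Raising an index: the inverse Gram matrix of \<open>b\<close> applied to the covector
  \<open>d\<close>. In a chart it turns the Euclidean gradient of the local expression into the
  components of the Riemannian gradient.\<close>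

definition riesz :: "('e::euclidean_space \<Rightarrow> 'e \<Rightarrow> real) \<Rightarrow> 'e \<Rightarrow> 'e" where
  "riesz b d = (THE G. \<forall>v. b G v = d \<bullet> v)"

lemma riesz:
  assumes "inner_product_form b"
  shows "b (riesz b d) v = d \<bullet> v"
  using theI'[OF inner_product_form_Riesz[OF assms, of "\<lambda>v. d \<bullet> v"]]
  unfolding riesz_def by (simp add: bounded_linear_inner_right bounded_linear.linear)

subsection \<open>Continuous families of inner products\<close>

lemma bilinear_expand:
  fixes b :: "'e::euclidean_space \<Rightarrow> 'e \<Rightarrow> real"
  assumes "bilinear b"
  shows "b u v = (\<Sum>i\<in>Basis. \<Sum>j\<in>Basis. (u \<bullet> i) * (v \<bullet> j) * b i j)"
proof -
  have "b u v = b (\<Sum>i\<in>Basis. (u \<bullet> i) *\<^sub>R i) (\<Sum>j\<in>Basis. (v \<bullet> j) *\<^sub>R j)"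
    by (simp add: euclidean_representation)
  also have "\<dots> = (\<Sum>i\<in>Basis. \<Sum>j\<in>Basis. b ((u \<bullet> i) *\<^sub>R i) ((v \<bullet> j) *\<^sub>R j))"
    by (simp add: bilinear_sum[OF assms] sum.cartesian_product)
  finally show ?thesis
    by (simp add: bilinear_lmul[OF assms] bilinear_rmul[OF assms] mult_ac)
qed

lemma linear_expand:
  fixes \<phi> :: "'e::euclidean_space \<Rightarrow> real"
  assumes "linear \<phi>"
  shows "\<phi> v = (\<Sum>i\<in>Basis. (v \<bullet> i) * \<phi> i)"
proof -
  have "\<phi> v = \<phi> (\<Sum>i\<in>Basis. (v \<bullet> i) *\<^sub>R i)" by (simp add: euclidean_representation)
  also have "\<dots> = (\<Sum>i\<in>Basis. (v \<bullet> i) * \<phi> i)"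
    using assms by (simp add: linear_sum linear_cmul)
  finally show ?thesis .
qed

text \<open>Continuity is asked for fixed vectors only, which is the form in which smoothness of a
  metric is stated; finite dimension upgrades it to joint continuity.\<close>

locale inner_product_family =
  fixes S :: "'x::topological_space set" and B :: "'x \<Rightarrow> 'e::euclidean_space \<Rightarrow> 'e \<Rightarrow> real"
  assumes form: "y \<in> S \<Longrightarrow> inner_product_form (B y)"
    and cont: "continuous_on S (\<lambda>y. B y u v)"
begin

lemma bilin: "y \<in> S \<Longrightarrow> bilinear (B y)"
  using form inner_product_form_bilinear by blast

lemma continuous_joint:
  "continuous_on (S \<times> UNIV) (\<lambda>(y, u, v). B y u v)"
proof -
  have "continuous_on (S \<times> UNIV)
      (\<lambda>p. \<Sum>i\<in>Basis. \<Sum>j\<in>Basis. (fst (snd p) \<bullet> i) * (snd (snd p) \<bullet> j) * B (fst p) i j)"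
    by (intro continuous_intros continuous_on_compose2[OF cont]) auto
  then show ?thesis
    by (rule continuous_on_eq) (auto simp: bilinear_expand[OF bilin])
qed

lemma continuous_diag: "continuous_on (S \<times> UNIV) (\<lambda>(y, u). B y u u)"
proof -
  have "continuous_on (S \<times> UNIV) (\<lambda>p. (fst p, snd p, snd p))"
    by (intro continuous_intros)
  from continuous_on_compose2[OF continuous_joint this] show ?thesis
    by (simp add: case_prod_unfold image_subset_iff)
qed

text \<open>The form attains positive extrema on the compact product of \<open>K\<close> with the
  unit sphere, and homogeneity carries the bounds to all vectors. This compares the two norms
  uniformly over \<open>K\<close>.\<close>

lemma sphere_bounds:
  assumes K: "compact K" "K \<subseteq> S"
  obtains l C where "0 < l" "0 < C"
    "\<And>y u. y \<in> K \<Longrightarrow> l * norm u \<le> sqrt (B y u u)"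
    "\<And>y u. y \<in> K \<Longrightarrow> sqrt (B y u u) \<le> C * norm u"
proof -
  let ?Q = "K \<times> sphere (0::'e) 1"
  have cQ: "compact ?Q" by (intro compact_Times K compact_sphere)
  have cont: "continuous_on ?Q (\<lambda>(y, u). B y u u)"
    by (rule continuous_on_subset[OF continuous_diag]) (use K in auto)
  define Q where "Q q = B (fst q) (snd q) (snd q)" for q
  have Qcont: "continuous_on ?Q Q"
    using cont by (simp add: Q_def[abs_def] case_prod_unfold)
  have Qpos: "Q q > 0" if "q \<in> ?Q" for q
  proof -
    have "snd q \<noteq> 0" "fst q \<in> S" using K that by (auto simp: mem_Times_iff)
    then show ?thesis using form[of "fst q"] unfolding Q_def inner_product_form_def by auto
  qed
  have "\<exists>l>0. \<exists>C>0. \<forall>q\<in>?Q. l \<le> Q q \<and> Q q \<le> C"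
  proof (cases "?Q = {}")
    \<comment> \<open>This case is \<open>K\<close> empty: there are no extrema to take, and any
      constants serve.\<close>
    case True
    then show ?thesis by (auto intro!: exI[of _ 1])
  next
    case False
    obtain q0 where q0: "q0 \<in> ?Q" "\<forall>q\<in>?Q. Q q0 \<le> Q q"
      using continuous_attains_inf[OF cQ False Qcont] by blast
    obtain q1 where q1: "q1 \<in> ?Q" "\<forall>q\<in>?Q. Q q \<le> Q q1"
      using continuous_attains_sup[OF cQ False Qcont] by blast
    show ?thesis
    proof (intro exI conjI ballI)
      show "0 < Q q0" "0 < Q q1" using Qpos q0(1) q1(1) by simp_all
    qed (use q0(2) q1(2) in blast)+
  qed
  then obtain l C where lC: "0 < l" "0 < C" and lCb: "\<forall>q\<in>?Q. l \<le> Q q \<and> Q q \<le> C"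
    by (elim exE conjE)
  have b: "l \<le> B y u u \<and> B y u u \<le> C" if "y \<in> K" "norm u = 1" for y u
    using bspec[OF lCb, of "(y, u)"] that by (simp add: Q_def)
  have main: "sqrt l * norm u \<le> sqrt (B y u u) \<and> sqrt (B y u u) \<le> sqrt C * norm u"
    if y: "y \<in> K" for y u
  proof (cases "u = 0")
    case True
    then show ?thesis using bilin[of y] y K(2) by (auto simp: bilinear_lzero)
  next
    case False
    define w where "w = u /\<^sub>R norm u"
    have u: "u = norm u *\<^sub>R w" using False by (simp add: w_def)
    have "norm w = 1" using False by (simp add: w_def)
    then have bw: "l \<le> B y w w" "B y w w \<le> C" using b[OF y] by simp_all
    have "bilinear (B y)" using bilin y K(2) by auto
    then have "B y (norm u *\<^sub>R w) (norm u *\<^sub>R w) = (norm u)\<^sup>2 * B y w w"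
      by (simp add: bilinear_lmul bilinear_rmul power2_eq_square)
    then have "B y u u = (norm u)\<^sup>2 * B y w w" using u by metis
    then have "sqrt (B y u u) = sqrt (B y w w) * norm u"
      by (simp add: real_sqrt_mult)
    then show ?thesis using bw by (simp add: mult_right_mono)
  qed
  show thesis
  proof (rule that)
    show "0 < sqrt l" "0 < sqrt C" using lC by simp_all
    show "sqrt l * norm u \<le> sqrt (B y u u)" if "y \<in> K" for y u
      using main[OF that] by (rule conjunct1)
    show "sqrt (B y u u) \<le> sqrt C * norm u" if "y \<in> K" for y u
      using main[OF that] by (rule conjunct2)
  qed
qed

end

text \<open>Openness puts a compact ball inside \<open>S\<close> around each point, on which
  \<open>sphere_bounds\<close> gives uniform constants.\<close>

locale inner_product_family_euclidean = inner_product_family S B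
  for S :: "'x::euclidean_space set" and B :: "'x \<Rightarrow> 'e::euclidean_space \<Rightarrow> 'e \<Rightarrow> real" +
  assumes open_S: "open S"
begin

text \<open>Replaces continuity of matrix inversion. The difference \<open>u\<close> between the
  solution for index \<open>n\<close> and the limit solution \<open>G\<close> solves the equation
  for \<open>B (Y n)\<close> with the residual of \<open>G\<close> on the right. Coercivity, uniform
  near \<open>y\<close>, bounds \<open>norm u\<close> by that residual, which tends to 0.\<close>

lemma continuous_on_riesz: "continuous_on (S \<times> UNIV) (\<lambda>(y, d). riesz (B y) d)"
  unfolding continuous_on_sequentially
proof (intro allI ballI impI, elim conjE)
  fix q :: "nat \<Rightarrow> 'x \<times> 'e" and p :: "'x \<times> 'e"
  assume p: "p \<in> S \<times> UNIV" and q: "\<forall>n. q n \<in> S \<times> UNIV" and lim: "q \<longlonglongrightarrow> p"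
  define y d where "y = fst p" and "d = snd p"
  define Y D where "Y n = fst (q n)" and "D n = snd (q n)" for n
  have y: "y \<in> S" using p by (auto simp: y_def)
  have Y: "Y n \<in> S" for n using q by (auto simp: Y_def mem_Times_iff)
  have Ylim: "Y \<longlonglongrightarrow> y" and Dlim: "D \<longlonglongrightarrow> d"
    using tendsto_fst[OF lim] tendsto_snd[OF lim] by (simp_all add: Y_def[abs_def] D_def[abs_def] y_def d_def)
  obtain r where r: "r > 0" "cball y r \<subseteq> S" using open_S y open_contains_cball by blast
  obtain l where l: "0 < l" "\<And>z u. z \<in> cball y r \<Longrightarrow> l * norm u \<le> sqrt (B z u u)"
    using sphere_bounds[OF compact_cball r(2)] by metis
  define G where "G = riesz (B y) d"
  \<comment> \<open>The residual of \<open>G\<close> in the equation for index \<open>n\<close>,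
    summed over the coordinates.\<close>
  define e where "e n = (\<Sum>i\<in>Basis. \<bar>D n \<bullet> i - B (Y n) G i\<bar>)" for n
  have e: "e \<longlonglongrightarrow> 0"
  proof -
    have "(\<lambda>n. B (Y n) G i) \<longlonglongrightarrow> B y G i" for i
      using continuous_on_tendsto_compose[OF cont Ylim y] Y by simp
    then have "e \<longlonglongrightarrow> (\<Sum>i\<in>Basis. \<bar>d \<bullet> i - B y G i\<bar>)"
      unfolding e_def by (intro tendsto_intros Dlim)
    also have "(\<Sum>i\<in>Basis. \<bar>d \<bullet> i - B y G i\<bar>) = 0"
      by (simp add: G_def riesz[OF form[OF y]])
    finally show ?thesis .
  qed
  have est: "norm (riesz (B (Y n)) (D n) - G) \<le> e n / l\<^sup>2" if yn: "Y n \<in> cball y r" for n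
  proof -
    define u where "u = riesz (B (Y n)) (D n) - G"
    note bl = bilin[OF Y[of n]]
    have "l * norm u \<le> sqrt (B (Y n) u u)" using l(2)[OF yn] .
    then have "(l * norm u)\<^sup>2 \<le> B (Y n) u u"
      using l(1) by (intro sqrt_ge_absD) simp
    also have "B (Y n) u u = (\<Sum>i\<in>Basis. (u \<bullet> i) * B (Y n) u i)"
      using bl unfolding bilinear_def by (intro linear_expand) blast
    also have "\<dots> = (\<Sum>i\<in>Basis. (u \<bullet> i) * (D n \<bullet> i - B (Y n) G i))"
      unfolding u_def by (simp add: bilinear_lsub[OF bl] riesz[OF form[OF Y[of n]]])
    also have "\<dots> \<le> (\<Sum>i\<in>Basis. norm u * \<bar>D n \<bullet> i - B (Y n) G i\<bar>)"
    proof (rule sum_mono)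
      fix i :: 'e assume i: "i \<in> Basis"
      have "(u \<bullet> i) * (D n \<bullet> i - B (Y n) G i) \<le> \<bar>u \<bullet> i\<bar> * \<bar>D n \<bullet> i - B (Y n) G i\<bar>"
        using abs_ge_self[of "(u \<bullet> i) * (D n \<bullet> i - B (Y n) G i)"] by (simp add: abs_mult)
      also have "\<dots> \<le> norm u * \<bar>D n \<bullet> i - B (Y n) G i\<bar>"
        by (rule mult_right_mono) (simp_all add: Basis_le_norm i)
      finally show "(u \<bullet> i) * (D n \<bullet> i - B (Y n) G i) \<le> norm u * \<bar>D n \<bullet> i - B (Y n) G i\<bar>" .
    qed
    also have "\<dots> = norm u * e n" by (simp add: e_def sum_distrib_left)
    finally have *: "l\<^sup>2 * (norm u * norm u) \<le> norm u * e n"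
      by (simp add: power2_eq_square mult_ac)
    have "e n \<ge> 0" by (auto simp: e_def intro!: sum_nonneg)
    have "l\<^sup>2 * norm u \<le> e n"
    proof (cases "u = 0")
      case False
      then have "norm u * (l\<^sup>2 * norm u) \<le> norm u * e n" using * by (simp add: mult_ac)
      then show ?thesis using False by simp
    qed (use \<open>e n \<ge> 0\<close> in simp)
    then show ?thesis using l(1) by (simp add: u_def field_simps)
  qed
  have ev: "\<forall>\<^sub>F n in sequentially. Y n \<in> cball y r"
    using tendstoD[OF Ylim r(1)] by eventually_elim (simp add: dist_commute)
  have "(\<lambda>n. riesz (B (Y n)) (D n) - G) \<longlonglongrightarrow> 0"
    by (rule Lim_null_comparison[where g="\<lambda>n. e n / l\<^sup>2"])
       (use ev est tendsto_divide_zero[OF e] in \<open>auto elim: eventually_mono\<close>)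
  then have "(\<lambda>n. riesz (B (Y n)) (D n)) \<longlonglongrightarrow> G" by (simp add: LIM_zero_iff)
  then show "((\<lambda>(y, d). riesz (B y) d) \<circ> q) \<longlonglongrightarrow> (\<lambda>(y, d). riesz (B y) d) p"
    by (simp add: comp_def case_prod_unfold Y_def D_def G_def y_def d_def)
qed

end

section \<open>Differentials in charts\<close>

definition differential ::
  "('a, 'e::euclidean_space) chart set \<Rightarrow> ('a \<Rightarrow> real) \<Rightarrow> 'a \<Rightarrow> 'e \<Rightarrow> real" where
  "differential A h x =
     frechet_derivative (h \<circ> chart_inv (chart_at A x)) (at (snd (chart_at A x) x))"

text \<open>The differential as a covector in the components of one chart \<open>c\<close>. Unlike
  vectors in preferred charts, it can vary continuously with the point over the whole domain of
  \<open>c\<close>.\<close>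

definition chart_gradient :: "('a, 'e::euclidean_space) chart \<Rightarrow> ('a \<Rightarrow> real) \<Rightarrow> 'a \<Rightarrow> 'e" where
  "chart_gradient c h x =
     (\<Sum>i\<in>Basis. frechet_derivative (h \<circ> chart_inv c) (at (snd c x)) i *\<^sub>R i)"

lemma chart_gradient_inner:
  assumes "(h \<circ> chart_inv c) differentiable (at (snd c x))"
  shows "chart_gradient c h x \<bullet> v = frechet_derivative (h \<circ> chart_inv c) (at (snd c x)) v"
  using linear_expand[OF linear_frechet_derivative[OF assms], of v]
  by (simp add: chart_gradient_def inner_sum_left inner_commute[of v] mult.commute)

locale smooth_manifold =
  fixes A :: "('a::{t2_space, second_countable_topology}, 'e::euclidean_space) chart set"
  assumes atlas: "smooth_atlas A"
begin

lemma open_domain: "c \<in> A \<Longrightarrow> open (fst c)"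
  and open_chart_image: "c \<in> A \<Longrightarrow> open (chart_image c)"
  and chart_homeomorphism:
    "c \<in> A \<Longrightarrow> homeomorphism (fst c) (chart_image c) (snd c) (chart_inv c)"
  using atlas unfolding smooth_atlas_def by auto

lemma chart_inv_chart [simp]: "c \<in> A \<Longrightarrow> x \<in> fst c \<Longrightarrow> chart_inv c (snd c x) = x"
  using chart_homeomorphism homeomorphism_apply1 by blast

lemma chart_chart_inv [simp]: "c \<in> A \<Longrightarrow> y \<in> chart_image c \<Longrightarrow> snd c (chart_inv c y) = y"
  using chart_homeomorphism homeomorphism_apply2 by blast

lemma chart_inv_in [simp]: "c \<in> A \<Longrightarrow> y \<in> chart_image c \<Longrightarrow> chart_inv c y \<in> fst c"
  using chart_homeomorphism homeomorphism_image2 by blast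

lemma chart_in_image [simp]: "x \<in> fst c \<Longrightarrow> snd c x \<in> chart_image c"
  by (simp add: chart_image_def)

lemma continuous_on_chart: "c \<in> A \<Longrightarrow> continuous_on (fst c) (snd c)"
  and continuous_on_chart_inv: "c \<in> A \<Longrightarrow> continuous_on (chart_image c) (chart_inv c)"
  using chart_homeomorphism unfolding homeomorphism_def by auto

lemma chart_at [simp]: "chart_at A x \<in> A" "x \<in> fst (chart_at A x)"
proof -
  have "\<exists>c. c \<in> A \<and> x \<in> fst c" using atlas unfolding smooth_atlas_def by blast
  from someI_ex[OF this] show "chart_at A x \<in> A" "x \<in> fst (chart_at A x)"
    unfolding chart_at_def by auto
qed

lemma open_overlap:
  assumes "c \<in> A" "open U"
  shows "open {y \<in> chart_image c. chart_inv c y \<in> U}"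
  using continuous_open_preimage[OF continuous_on_chart_inv[OF assms(1)] open_chart_image[OF assms(1)] assms(2)]
  by (simp add: vimage_def Int_def)

lemma transition_differentiable:
  assumes "c \<in> A" "d \<in> A" "x \<in> fst c" "x \<in> fst d"
  shows "(snd d \<circ> chart_inv c) differentiable (at (snd c x))"
proof -
  have "smooth_on (snd c ` (fst c \<inter> fst d)) (snd d \<circ> chart_inv c)"
    using atlas assms unfolding smooth_atlas_def by blast
  then have "Ck_on (Suc 0) (snd c ` (fst c \<inter> fst d)) (snd d \<circ> chart_inv c)"
    unfolding smooth_on_def by blast
  then show ?thesis using assms by auto
qed

lemma has_derivative_change_of_chart:
  fixes h :: "'a \<Rightarrow> 'b::real_normed_vector"
  assumes "c \<in> A" "d \<in> A" "x \<in> fst c" "x \<in> fst d"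
    and "(h \<circ> chart_inv d) differentiable (at (snd d x))"
  shows "((h \<circ> chart_inv c) has_derivative
    (\<lambda>w. frechet_derivative (h \<circ> chart_inv d) (at (snd d x))
       (frechet_derivative (snd d \<circ> chart_inv c) (at (snd c x)) w))) (at (snd c x))"
proof -
  let ?t = "snd d \<circ> chart_inv c"
  have t: "(?t has_derivative frechet_derivative ?t (at (snd c x))) (at (snd c x))"
    using transition_differentiable[OF assms(1-4)] frechet_derivative_works by blast
  have "((h \<circ> chart_inv d) has_derivative frechet_derivative (h \<circ> chart_inv d) (at (snd d x)))
      (at (?t (snd c x)))"
    using assms frechet_derivative_works by auto
  from diff_chain_at[OF t this]
  have *: "(((h \<circ> chart_inv d) \<circ> ?t) has_derivative
    (\<lambda>w. frechet_derivative (h \<circ> chart_inv d) (at (snd d x))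
       (frechet_derivative ?t (at (snd c x)) w))) (at (snd c x))"
    by (simp add: comp_def)
  show ?thesis
    by (rule has_derivative_transform_within_open[OF * open_overlap[OF assms(1) open_domain[OF assms(2)]]])
       (use assms in auto)
qed

lemma manifold_differentiable_atI:
  assumes "d \<in> A" "x \<in> fst d" "(h \<circ> chart_inv d) differentiable (at (snd d x))"
  shows "manifold_differentiable_at A h x"
  unfolding manifold_differentiable_at_def
  using has_derivative_change_of_chart[OF _ assms(1) _ assms(2) assms(3)]
  by (auto simp: differentiable_def)

lemma manifold_differentiable_atD:
  assumes "manifold_differentiable_at A h x" "c \<in> A" "x \<in> fst c"
  shows "(h \<circ> chart_inv c) differentiable (at (snd c x))"
  using assms unfolding manifold_differentiable_at_def by blast

lemma manifold_differentiable_imp_continuous: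
  assumes "\<And>x. manifold_differentiable_at A h x"
  shows "continuous_on UNIV h"
proof -
  have "isCont h x" for x
  proof -
    let ?c = "chart_at A x"
    have "isCont (h \<circ> chart_inv ?c) (snd ?c x)"
      using manifold_differentiable_atD[OF assms[of x], of ?c] differentiable_imp_continuous_within
      by auto
    moreover have "isCont (snd ?c) x"
      using continuous_on_chart[of ?c] open_domain[of ?c] by (simp add: continuous_on_eq_continuous_at)
    ultimately have "isCont ((h \<circ> chart_inv ?c) \<circ> snd ?c) x"
      by (rule continuous_at_compose[rotated])
    moreover have "\<forall>\<^sub>F y in nhds x. ((h \<circ> chart_inv ?c) \<circ> snd ?c) y = h y"
      using eventually_nhds_in_open[OF open_domain[of ?c], of x] by (auto elim: eventually_mono)
    ultimately show ?thesis using isCont_cong by blast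
  qed
  then show ?thesis by (simp add: continuous_on_eq_continuous_at)
qed

text \<open>The chain rule through \<open>c\<close> applied to
  \<open>snd d \<circ> chart_inv d\<close>, which is the identity near \<open>snd d x\<close>. It
  makes \<open>tangent_vector A c x\<close> a linear isomorphism.\<close>

lemma transition_inverse:
  assumes "c \<in> A" "d \<in> A" "x \<in> fst c" "x \<in> fst d"
  shows "frechet_derivative (snd d \<circ> chart_inv c) (at (snd c x))
     (frechet_derivative (snd c \<circ> chart_inv d) (at (snd d x)) w) = w"
proof -
  have 1: "((snd d \<circ> chart_inv d) has_derivative (\<lambda>w. w)) (at (snd d x))"
    by (rule has_derivative_transform_within_open[OF has_derivative_ident open_chart_image[OF assms(2)]])
       (use assms in auto)
  have 2: "((snd d \<circ> chart_inv d) has_derivative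
      (\<lambda>w. frechet_derivative (snd d \<circ> chart_inv c) (at (snd c x))
        (frechet_derivative (snd c \<circ> chart_inv d) (at (snd d x)) w))) (at (snd d x))"
    by (rule has_derivative_change_of_chart[OF assms(2,1,4,3)])
       (rule transition_differentiable[OF assms])
  show ?thesis using has_derivative_unique[OF 1 2] by metis
qed

lemma tangent_vector_chart_at [simp]: "tangent_vector A (chart_at A x) x w = w"
proof -
  let ?c = "chart_at A x"
  have "((snd ?c \<circ> chart_inv ?c) has_derivative (\<lambda>w. w)) (at (snd ?c x))"
    by (rule has_derivative_transform_within_open[OF has_derivative_ident open_chart_image[of ?c]])
       auto
  from frechet_derivative_at[OF this] show ?thesis unfolding tangent_vector_def by metis
qed

lemma linear_tangent_vector:
  assumes "c \<in> A" "x \<in> fst c" shows "linear (tangent_vector A c x)"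
  unfolding tangent_vector_def[abs_def]
  using linear_frechet_derivative[OF transition_differentiable[OF assms(1) _ assms(2), of "chart_at A x"]]
  by simp

lemma tangent_vector_surj:
  assumes "c \<in> A" "x \<in> fst c" obtains w where "v = tangent_vector A c x w"
  using transition_inverse[OF assms(1) _ assms(2), of "chart_at A x"] unfolding tangent_vector_def
  by (metis chart_at)

lemma tangent_vector_eq_0:
  assumes "c \<in> A" "x \<in> fst c" shows "tangent_vector A c x w = 0 \<longleftrightarrow> w = 0"
proof -
  have "frechet_derivative (snd c \<circ> chart_inv (chart_at A x)) (at (snd (chart_at A x) x))
      (tangent_vector A c x w) = w"
    unfolding tangent_vector_def by (rule transition_inverse) (use assms in auto)
  moreover have "linear (frechet_derivative (snd c \<circ> chart_inv (chart_at A x)) (at (snd (chart_at A x) x)))"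
    by (rule linear_frechet_derivative, rule transition_differentiable) (use assms in auto)
  ultimately show ?thesis using linear_0 linear_tangent_vector[OF assms] by metis
qed

text \<open>The chain rule for the transition to the preferred chart. It moves
  \<open>differential\<close>, tied to a chart chosen separately at every point, into one chart that
  serves a whole neighbourhood.\<close>

lemma differential_tangent_vector:
  assumes "c \<in> A" "x \<in> fst c" "manifold_differentiable_at A h x"
  shows "differential A h x (tangent_vector A c x w) =
    frechet_derivative (h \<circ> chart_inv c) (at (snd c x)) w"
  using frechet_derivative_at[OF has_derivative_change_of_chart[OF assms(1) chart_at(1) assms(2) chart_at(2)
    manifold_differentiable_atD[OF assms(3) chart_at]]]
  unfolding differential_def tangent_vector_def by metis

lemma linear_differential: "manifold_differentiable_at A h x \<Longrightarrow> linear (differential A h x)"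
  unfolding differential_def
  by (intro linear_frechet_derivative manifold_differentiable_atD) auto

end

text \<open>The metric in the components of the chart \<open>c\<close>. Smoothness is assumed in
  this form; \<open>g\<close> itself refers to preferred charts and need not depend continuously on
  the point.\<close>

definition chart_metric where
  "chart_metric A g c y u v =
     (let x = chart_inv c y in g x (tangent_vector A c x u) (tangent_vector A c x v))"

section \<open>Tangent norms and gradients in chart components\<close>

locale riemannian = smooth_manifold A
  for A :: "('a::{t2_space, second_countable_topology}, 'e::euclidean_space) chart set" +
  fixes g :: "'a \<Rightarrow> 'e \<Rightarrow> 'e \<Rightarrow> real"
  assumes riemannian: "riemannian_manifold A g"
begin

lemma inner_product_form: "inner_product_form (g x)"
  using riemannian unfolding riemannian_manifold_def by blast

lemma tangent_norm_nonneg [simp]: "0 \<le> tangent_norm g x v"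
  by (simp add: tangent_norm_def inner_product_form_nonneg[OF inner_product_form])

lemma tangent_norm_square: "(tangent_norm g x v)\<^sup>2 = g x v v"
  by (simp add: tangent_norm_def inner_product_form_nonneg[OF inner_product_form])

lemma tangent_norm_eq_0: "tangent_norm g x v = 0 \<longleftrightarrow> v = 0"
  by (simp add: tangent_norm_def inner_product_form_eq_0[OF inner_product_form])

lemma Cauchy_Schwarz: "\<bar>g x u v\<bar> \<le> tangent_norm g x u * tangent_norm g x v"
  unfolding tangent_norm_def by (rule inner_product_form_Cauchy_Schwarz[OF inner_product_form])

lemma tangent_norm_scaleR: "tangent_norm g x (s *\<^sub>R v) = \<bar>s\<bar> * tangent_norm g x v"
proof -
  note bl = inner_product_form_bilinear[OF inner_product_form[of x]]
  have "g x (s *\<^sub>R v) (s *\<^sub>R v) = s\<^sup>2 * g x v v"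
    by (simp add: bilinear_lmul[OF bl] bilinear_rmul[OF bl] power2_eq_square)
  then show ?thesis by (simp add: tangent_norm_def real_sqrt_mult)
qed

lemma riemannian_gradient:
  assumes "manifold_differentiable_at A h x"
  shows "g x (riemannian_gradient A g h x) v = differential A h x v"
  unfolding riemannian_gradient_def differential_def
  by (intro gradient_wrt inner_product_form manifold_differentiable_atD[OF assms] chart_at)

lemma chart_metric_chart:
  assumes "c \<in> A" "x \<in> fst c"
  shows "chart_metric A g c (snd c x) u v = g x (tangent_vector A c x u) (tangent_vector A c x v)"
  using assms by (simp add: chart_metric_def Let_def)

lemma chart_metric_family:
  assumes "c \<in> A"
  shows "inner_product_family_euclidean (chart_image c) (chart_metric A g c)"
proof
  fix y assume y: "y \<in> chart_image c"
  define x where "x = chart_inv c y"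
  have x: "x \<in> fst c" and yx: "y = snd c x" using assms y by (simp_all add: x_def)
  note lin = linear_tangent_vector[OF assms x]
  note form = inner_product_form[of x]
  have "linear (\<lambda>u. g x (tangent_vector A c x u) (tangent_vector A c x v))" for v
    using linear_compose[OF lin, of "\<lambda>u. g x u (tangent_vector A c x v)"] form
    unfolding inner_product_form_def comp_def by blast
  moreover have "chart_metric A g c y u v = g x (tangent_vector A c x u) (tangent_vector A c x v)" for u v
    unfolding yx by (rule chart_metric_chart[OF assms x])
  ultimately show "inner_product_form (chart_metric A g c y)"
    using form tangent_vector_eq_0[OF assms x] unfolding inner_product_form_def by simp
next
  fix u v
  have "smooth_on (chart_image c) (\<lambda>y. chart_metric A g c y u v)"
    using riemannian assms unfolding riemannian_manifold_def chart_metric_def by blast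
  then have "Ck_on 0 (chart_image c) (\<lambda>y. chart_metric A g c y u v)"
    unfolding smooth_on_def by blast
  then show "continuous_on (chart_image c) (\<lambda>y. chart_metric A g c y u v)" by simp
qed (rule open_chart_image[OF assms])

lemma tangent_norm_chart_bounds:
  assumes c: "c \<in> A" and K: "compact K" "K \<subseteq> chart_image c"
  obtains l C where "0 < l" "0 < C"
    "\<And>x w. x \<in> fst c \<Longrightarrow> snd c x \<in> K \<Longrightarrow> l * norm w \<le> tangent_norm g x (tangent_vector A c x w)"
    "\<And>x w. x \<in> fst c \<Longrightarrow> snd c x \<in> K \<Longrightarrow> tangent_norm g x (tangent_vector A c x w) \<le> C * norm w"
proof -
  interpret inner_product_family_euclidean "chart_image c" "chart_metric A g c"
    by (rule chart_metric_family[OF c])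
  obtain l C where lC: "0 < l" "0 < C"
    "\<And>y u. y \<in> K \<Longrightarrow> l * norm u \<le> sqrt (chart_metric A g c y u u)"
    "\<And>y u. y \<in> K \<Longrightarrow> sqrt (chart_metric A g c y u u) \<le> C * norm u"
    using sphere_bounds[OF K] by metis
  show thesis
  proof (rule that[OF lC(1,2)])
    fix x w assume x: "x \<in> fst c" "snd c x \<in> K"
    show "l * norm w \<le> tangent_norm g x (tangent_vector A c x w)"
      using lC(3)[OF x(2), of w] by (simp add: chart_metric_chart[OF c x(1)] tangent_norm_def)
    show "tangent_norm g x (tangent_vector A c x w) \<le> C * norm w"
      using lC(4)[OF x(2), of w] by (simp add: chart_metric_chart[OF c x(1)] tangent_norm_def)
  qed
qed

text \<open>Both sides represent \<open>differential A h x\<close> with respect to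
  \<open>g x\<close>. The right-hand side works in the single chart \<open>c\<close> until its last
  operation, which is what arguments about continuity and measurability can use.\<close>

lemma riemannian_gradient_chart:
  assumes c: "c \<in> A" "x \<in> fst c" and h: "manifold_differentiable_at A h x"
  shows "riemannian_gradient A g h x =
    tangent_vector A c x (riesz (chart_metric A g c (snd c x)) (chart_gradient c h x))"
proof -
  interpret inner_product_family_euclidean "chart_image c" "chart_metric A g c"
    by (rule chart_metric_family[OF c(1)])
  let ?G = "tangent_vector A c x (riesz (chart_metric A g c (snd c x)) (chart_gradient c h x))"
  have "g x ?G v = differential A h x v" for v
  proof -
    obtain w where v: "v = tangent_vector A c x w" using tangent_vector_surj[OF c] .
    have "g x ?G v = chart_gradient c h x \<bullet> w"
      unfolding v chart_metric_chart[OF c, symmetric] by (rule riesz[OF form]) (use c in simp)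
    also have "\<dots> = differential A h x v"
      unfolding v differential_tangent_vector[OF c h]
      by (rule chart_gradient_inner[OF manifold_differentiable_atD[OF h c]])
    finally show ?thesis .
  qed
  then show ?thesis
    unfolding riemannian_gradient_def differential_def
    by (intro gradient_wrt_unique inner_product_form manifold_differentiable_atD[OF h] chart_at) auto
qed

lemma inner_gradients_chart:
  assumes c: "c \<in> A" "x \<in> fst c"
    and h: "manifold_differentiable_at A h x" "manifold_differentiable_at A k x"
  shows "g x (riemannian_gradient A g h x) (riemannian_gradient A g k x) =
    chart_gradient c h x \<bullet> riesz (chart_metric A g c (snd c x)) (chart_gradient c k x)"
  unfolding riemannian_gradient[OF h(1)] riemannian_gradient_chart[OF c h(2)]
    differential_tangent_vector[OF c h(1)]
  by (rule chart_gradient_inner[symmetric, OF manifold_differentiable_atD[OF h(1) c]])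

end

section \<open>Retractions\<close>

lemma differentiable_transform_at_open:
  assumes "f differentiable (at x)" "open S" "x \<in> S" "\<And>y. y \<in> S \<Longrightarrow> f y = h y"
  shows "h differentiable (at x)"
proof -
  obtain D where "(f has_derivative D) (at x)" using assms(1) by (auto simp: differentiable_def)
  from has_derivative_transform_within_open[OF this assms(2-4)] show ?thesis
    by (rule differentiableI)
qed

text \<open>The chain rule gives the derivative of \<open>h\<close> at \<open>k z\<close> applied to
  a vector that also varies with \<open>z\<close>. Expanding this vector over \<open>Basis\<close>
  separates the two dependences into products of differentiable scalar functions.\<close>

lemma second_derivative_compose_differentiable:
  fixes h :: "'b::euclidean_space \<Rightarrow> real" and k :: "'a::euclidean_space \<Rightarrow> 'b"
  assumes S: "open S" "x \<in> S" and kS: "k ` S \<subseteq> T"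
    and k: "\<And>z. z \<in> S \<Longrightarrow> k differentiable (at z)"
      "(\<lambda>z. frechet_derivative k (at z) u) differentiable (at x)"
    and h: "\<And>z. z \<in> T \<Longrightarrow> h differentiable (at z)"
      "\<And>v. (\<lambda>z. frechet_derivative h (at z) v) differentiable (at (k x))"
  shows "(\<lambda>z. frechet_derivative (h \<circ> k) (at z) u) differentiable (at x)"
proof -
  let ?e = "\<lambda>z. \<Sum>i\<in>Basis. (frechet_derivative k (at z) u \<bullet> i) * frechet_derivative h (at (k z)) i"
  have eq: "frechet_derivative (h \<circ> k) (at z) u = ?e z" if z: "z \<in> S" for z
  proof -
    have hz: "h differentiable (at (k z))" using h(1) kS z by blast
    have "frechet_derivative (h \<circ> k) (at z) u =
        frechet_derivative h (at (k z)) (frechet_derivative k (at z) u)"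
      by (simp add: frechet_derivative_compose[OF k(1)[OF z] hz])
    also have "\<dots> = ?e z"
      by (rule linear_expand) (rule linear_frechet_derivative[OF hz])
    finally show ?thesis .
  qed
  have "(\<lambda>z. frechet_derivative h (at (k z)) i) differentiable (at x)" for i
    using differentiable_chain_at[OF k(1)[OF S(2)] h(2)[of i]] by (simp add: comp_def)
  moreover have "(\<lambda>z. frechet_derivative k (at z) u \<bullet> i) differentiable (at x)" for i
    using k(2) by (auto simp: differentiable_def intro!: derivative_eq_intros)
  ultimately have "?e differentiable (at x)"
    by (intro differentiable_sum differentiable_mult) auto
  then show ?thesis
    by (rule differentiable_transform_at_open[OF _ S]) (simp add: eq)
qed

text \<open>Derivatives along a fibre are derivatives of the full map in directions
  \<open>(0, u)\<close>. It transfers regularity of a bundle map to its restriction to one tangent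
  space.\<close>

lemma second_derivative_const_Pair:
  fixes H :: "'a::euclidean_space \<times> 'b::euclidean_space \<Rightarrow> 'c::real_normed_vector"
  assumes S: "open S" "v \<in> S" and H: "\<And>w. w \<in> S \<Longrightarrow> H differentiable (at (y, w))"
    and HH: "\<And>p. (\<lambda>q. frechet_derivative H (at q) p) differentiable (at (y, v))"
  shows "(\<lambda>w. frechet_derivative (\<lambda>w. H (y, w)) (at w) u) differentiable (at v)"
proof -
  have P: "(Pair y has_derivative Pair 0) (at w)" for w :: 'b
    by (auto intro!: derivative_eq_intros)
  have eq: "frechet_derivative (\<lambda>w. H (y, w)) (at w) u = frechet_derivative H (at (y, w)) (0, u)"
    if "w \<in> S" for w
  proof -
    have "((H \<circ> Pair y) has_derivative (frechet_derivative H (at (y, w)) \<circ> Pair 0)) (at w)"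
      by (rule diff_chain_at[OF P]) (use H[OF that] frechet_derivative_works in blast)
    from frechet_derivative_at[OF this, symmetric] show ?thesis by (simp add: comp_def)
  qed
  have "(\<lambda>w. frechet_derivative H (at (y, w)) (0, u)) differentiable (at v)"
    using differentiable_chain_at[OF differentiableI[OF P] HH] by (simp add: comp_def)
  then show ?thesis
    by (rule differentiable_transform_at_open[OF _ S]) (simp add: eq)
qed

section \<open>Regularity of the retraction on single tangent spaces\<close>

locale riemannian_retraction = riemannian A g
  for A :: "('a::{t2_space, second_countable_topology}, 'e::euclidean_space) chart set"
    and g :: "'a \<Rightarrow> 'e \<Rightarrow> 'e \<Rightarrow> real" +
  fixes R :: "'a \<Rightarrow> 'e \<Rightarrow> 'a"
  assumes retraction: "Ck_retraction A 2 R"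
begin

abbreviation "bundle_retraction c \<equiv> bundle_expression A c R"

lemma bundle_retraction_chart:
  "c \<in> A \<Longrightarrow> x \<in> fst c \<Longrightarrow> bundle_retraction c (snd c x, w) = R x (tangent_vector A c x w)"
  by (simp add: bundle_expression_def Let_def)

lemma continuous_on_bundle_retraction:
  "c \<in> A \<Longrightarrow> continuous_on (chart_image c \<times> UNIV) (bundle_retraction c)"
  using retraction unfolding Ck_retraction_def Ck_bundle_map_def by blast

lemma R_zero [simp]: "R x 0 = x"
  using retraction unfolding Ck_retraction_def by blast

lemma R_eq_bundle_retraction:
  "R x = (\<lambda>w. bundle_retraction (chart_at A x) (snd (chart_at A x) x, w))"
  by (simp add: bundle_retraction_chart)

lemma open_bundle_retraction_preimage:
  assumes "c \<in> A" "open U"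
  shows "open {p \<in> chart_image c \<times> UNIV. bundle_retraction c p \<in> U}"
  using continuous_open_preimage[OF continuous_on_bundle_retraction[OF assms(1)] _ assms(2)]
    open_Times[OF open_chart_image[OF assms(1)] open_UNIV]
  by (simp add: vimage_def Int_def)

lemma continuous_on_R: "continuous_on UNIV (R x)"
  unfolding R_eq_bundle_retraction[of x]
  by (rule continuous_on_compose2[OF continuous_on_bundle_retraction[OF chart_at(1)[of x]]])
     (auto intro!: continuous_intros)

lemma open_R_preimage: "open U \<Longrightarrow> open {v. R x v \<in> U}"
  using open_vimage[OF _ continuous_on_R, of U x] by (simp add: vimage_def)

lemma bundle_retraction_C2:
  assumes "c \<in> A" "d \<in> A" "p \<in> chart_image c \<times> UNIV" "bundle_retraction c p \<in> fst d"
  shows "(snd d \<circ> bundle_retraction c) differentiable (at p)"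
    and "(\<lambda>q. frechet_derivative (snd d \<circ> bundle_retraction c) (at q) v) differentiable (at p)"
proof -
  have "Ck_on (Suc (Suc 0)) {p \<in> chart_image c \<times> UNIV. bundle_retraction c p \<in> fst d}
      (snd d \<circ> bundle_retraction c)"
    using retraction assms(1,2) unfolding Ck_retraction_def Ck_bundle_map_def numeral_2_eq_2 by blast
  then have "\<forall>p\<in>{p \<in> chart_image c \<times> UNIV. bundle_retraction c p \<in> fst d}.
        (snd d \<circ> bundle_retraction c) differentiable (at p) \<and>
        (\<forall>v. (\<lambda>q. frechet_derivative (snd d \<circ> bundle_retraction c) (at q) v) differentiable (at p))"
    unfolding Ck_on.simps by blast
  then show "(snd d \<circ> bundle_retraction c) differentiable (at p)"
    and "(\<lambda>q. frechet_derivative (snd d \<circ> bundle_retraction c) (at q) v) differentiable (at p)"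
    using assms(3,4) by blast+
qed

lemma chart_R_differentiable:
  assumes "d \<in> A" "R x v \<in> fst d"
  shows "(snd d \<circ> R x) differentiable (at v)"
proof -
  let ?c = "chart_at A x"
  have P: "Pair (snd ?c x) differentiable (at v)"
    by (auto simp: differentiable_def intro!: derivative_eq_intros exI)
  have "(snd d \<circ> bundle_retraction ?c) differentiable (at (snd ?c x, v))"
    by (rule bundle_retraction_C2) (use assms in \<open>auto simp: R_eq_bundle_retraction[of x]\<close>)
  from differentiable_chain_at[OF P this] show ?thesis
    by (simp add: R_eq_bundle_retraction[of x] comp_def)
qed

lemma chart_R_twice_differentiable:
  assumes "d \<in> A" "R x v \<in> fst d"
  shows "(\<lambda>w. frechet_derivative (snd d \<circ> R x) (at w) u) differentiable (at v)"
proof -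
  let ?c = "chart_at A x" and ?S = "{w. R x w \<in> fst d}"
  have "(\<lambda>w. frechet_derivative (\<lambda>w. (snd d \<circ> bundle_retraction ?c) (snd ?c x, w)) (at w) u)
      differentiable (at v)"
  proof (rule second_derivative_const_Pair[of ?S])
    show "open ?S" by (rule open_R_preimage[OF open_domain[OF assms(1)]])
    show "v \<in> ?S" using assms by simp
    show "snd d \<circ> bundle_retraction ?c differentiable at (snd ?c x, w)" if "w \<in> ?S" for w
      by (rule bundle_retraction_C2) (use that assms in \<open>auto simp: R_eq_bundle_retraction[of x]\<close>)
    show "(\<lambda>q. frechet_derivative (snd d \<circ> bundle_retraction ?c) (at q) p) differentiable at (snd ?c x, v)" for p
      by (rule bundle_retraction_C2) (use assms in \<open>auto simp: R_eq_bundle_retraction[of x]\<close>)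
  qed
  then show ?thesis by (simp add: R_eq_bundle_retraction[of x] comp_def)
qed

text \<open>The composite factors through a chart at the endpoint \<open>R x v\<close>; the
  factorisation holds near \<open>v\<close> because \<open>R x\<close> is continuous.\<close>

lemma compose_R_differentiable:
  assumes "manifold_differentiable_at A h (R x v)"
  shows "(h \<circ> R x) differentiable (at v)"
proof -
  let ?d = "chart_at A (R x v)"
  have "((h \<circ> chart_inv ?d) \<circ> (snd ?d \<circ> R x)) differentiable (at v)"
    by (intro differentiable_chain_at chart_R_differentiable)
       (use manifold_differentiable_atD[OF assms chart_at] in auto)
  then obtain D where D: "(((h \<circ> chart_inv ?d) \<circ> (snd ?d \<circ> R x)) has_derivative D) (at v)"
    by (auto simp: differentiable_def)
  have "((h \<circ> R x) has_derivative D) (at v)"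
    by (rule has_derivative_transform_within_open[OF D open_R_preimage[OF open_domain[of ?d], of x]]) auto
  then show ?thesis by (rule differentiableI)
qed

text \<open>Since \<open>R x\<close> has the identity as differential at 0, pulling back to the
  tangent space keeps the differential. This links the Lipschitz condition and the Hessian
  condition, both stated on tangent spaces, with \<open>riemannian_gradient\<close>.\<close>

lemma compose_R_derivative_0:
  assumes "manifold_differentiable_at A h x"
  shows "((h \<circ> R x) has_derivative differential A h x) (at 0)"
proof -
  let ?d = "chart_at A x"
  have "((snd ?d \<circ> R x) has_derivative (\<lambda>v. v)) (at 0)"
    using retraction unfolding Ck_retraction_def by blast
  moreover have "((h \<circ> chart_inv ?d) has_derivative differential A h x) (at ((snd ?d \<circ> R x) 0))"
    using manifold_differentiable_atD[OF assms chart_at] frechet_derivative_works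
    unfolding differential_def by auto
  ultimately have D: "(((h \<circ> chart_inv ?d) \<circ> (snd ?d \<circ> R x)) has_derivative
      (differential A h x \<circ> (\<lambda>v. v))) (at 0)"
    by (rule diff_chain_at)
  have "((h \<circ> R x) has_derivative (differential A h x \<circ> (\<lambda>v. v))) (at 0)"
    by (rule has_derivative_transform_within_open[OF D open_R_preimage[OF open_domain[of ?d], of x]]) auto
  then show ?thesis by (simp add: comp_def)
qed

text \<open>Reading \<open>h\<close> and \<open>R x\<close> through a chart at the endpoint reduces
  the claim to twice differentiable maps between Euclidean spaces. It makes
  \<open>hessian (h \<circ> R x)\<close> an actual derivative.\<close>

lemma C2_compose_R_twice_differentiable:
  assumes "manifold_Ck A 2 h"
  shows "manifold_differentiable_at A h x"
    and "(\<lambda>w. frechet_derivative (h \<circ> R x) (at w) u) differentiable (at v)"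
proof -
  have C2: "Ck_on (Suc (Suc 0)) (chart_image c) (h \<circ> chart_inv c)" if "c \<in> A" for c
    using assms that unfolding manifold_Ck_def numeral_2_eq_2 by blast
  show "manifold_differentiable_at A h x"
    using C2[of "chart_at A x"] by (intro manifold_differentiable_atI[of "chart_at A x"]) auto
  let ?d = "chart_at A (R x v)" and ?S = "{w. R x w \<in> fst (chart_at A (R x v))}"
  let ?k = "(h \<circ> chart_inv ?d) \<circ> (snd ?d \<circ> R x)"
  have S: "open ?S" "v \<in> ?S" using open_R_preimage[OF open_domain[of ?d]] by auto
  have k: "(\<lambda>w. frechet_derivative ?k (at w) u) differentiable (at v)"
  proof (rule second_derivative_compose_differentiable[OF S, where T="chart_image ?d"])
    show "(snd ?d \<circ> R x) ` ?S \<subseteq> chart_image ?d" by auto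
  qed (use C2[of ?d] chart_R_differentiable[of ?d x] chart_R_twice_differentiable[of ?d x v] in auto)
  have eq: "frechet_derivative (h \<circ> R x) (at w) u = frechet_derivative ?k (at w) u" if "w \<in> ?S" for w
  proof -
    have "(h \<circ> R x) differentiable (at w)"
      using C2 by (intro compose_R_differentiable manifold_differentiable_atI[of "chart_at A (R x w)"]) auto
    from frechet_derivative_transform_within_open[OF this S(1) that, of ?k] show ?thesis by simp
  qed
  show "(\<lambda>w. frechet_derivative (h \<circ> R x) (at w) u) differentiable (at v)"
    by (rule differentiable_transform_at_open[OF k S]) (simp add: eq)
qed

text \<open>The Lagrange remainder sits at some \<open>t\<close> between 0 and \<open>s\<close>,
  where the hypothesis applies. As \<open>s \<le> \<kappa>\<close>, the quadratic term is at most
  \<open>s * (\<kappa> / 2)\<close> times the absolute Hessian value, and the linear term absorbs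
  it.\<close>

lemma descent_of_Hessian_bound:
  assumes h: "manifold_Ck A 2 h" and \<kappa>: "0 \<le> s" "s \<le> \<kappa>"
    and H: "\<And>s. 0 \<le> s \<Longrightarrow> s \<le> \<kappa> \<Longrightarrow>
      g x (riemannian_gradient A g h x) G \<ge> \<kappa> / 2 * \<bar>hessian (h \<circ> R x) (- s *\<^sub>R G) G G\<bar>"
  shows "h (R x (- s *\<^sub>R G)) \<le> h x"
proof (cases "s = 0")
  case False
  then have s: "0 < s" using \<kappa> by simp
  \<comment> \<open>\<open>h\<close> along the line and its first two derivatives;
    \<open>\<psi>\<close> packs them into the sequence that \<open>Maclaurin\<close> expects. The
    direction \<open>- G\<close> gives the sign of \<open>\<psi>1\<close> and cancels in
    \<open>\<psi>2\<close>.\<close>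
  define \<psi>0 \<psi>1 \<psi>2 where "\<psi>0 = (\<lambda>t. h (R x (- t *\<^sub>R G)))"
    and "\<psi>1 = (\<lambda>t. - frechet_derivative (h \<circ> R x) (at (- t *\<^sub>R G)) G)"
    and "\<psi>2 = (\<lambda>t. hessian (h \<circ> R x) (- t *\<^sub>R G) G G)"
  define \<psi> where "\<psi> m = (if m = 0 then \<psi>0 else if m = 1 then \<psi>1 else \<psi>2)" for m :: nat
  note md = C2_compose_R_twice_differentiable(1)[OF h]
  have line: "((\<lambda>t. - t *\<^sub>R G) has_derivative (\<lambda>t. - t *\<^sub>R G)) (at t)" for t
    by (auto intro!: derivative_eq_intros)
  have line_deriv: "((\<lambda>t. k (- t *\<^sub>R G)) has_real_derivative - frechet_derivative k (at (- t *\<^sub>R G)) G) (at t)"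
    if k: "k differentiable (at (- t *\<^sub>R G))" for k :: "'e \<Rightarrow> real" and t
  proof -
    note lin = linear_frechet_derivative[OF k]
    have "(k \<circ> (\<lambda>t. - t *\<^sub>R G) has_derivative frechet_derivative k (at (- t *\<^sub>R G)) \<circ> (\<lambda>t. - t *\<^sub>R G)) (at t)"
      by (rule diff_chain_at[OF line]) (use k frechet_derivative_works in blast)
    moreover have "frechet_derivative k (at (- t *\<^sub>R G)) (- u *\<^sub>R G) =
        u * - frechet_derivative k (at (- t *\<^sub>R G)) G" for u
      using linear_cmul[OF lin, of "-u" G] by simp
    ultimately have "((\<lambda>t. k (- t *\<^sub>R G)) has_derivative
        (\<lambda>u. u * - frechet_derivative k (at (- t *\<^sub>R G)) G)) (at t)"
      by (simp only: comp_def)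
    then show ?thesis
      by (simp only: has_field_derivative_def mult_commute_abs)
  qed
  have D0: "(\<psi>0 has_real_derivative \<psi>1 t) (at t)" for t
    using line_deriv[OF compose_R_differentiable[OF md], of x t]
    unfolding \<psi>0_def \<psi>1_def comp_def .
  have D1: "(\<psi>1 has_real_derivative \<psi>2 t) (at t)" for t
    using DERIV_minus[OF line_deriv[OF C2_compose_R_twice_differentiable(2)[OF h], of x G t]]
    unfolding hessian_def \<psi>1_def \<psi>2_def minus_minus .
  have "\<exists>t>0. t < s \<and> \<psi>0 s = (\<Sum>m<2. \<psi> m 0 / fact m * s ^ m) + \<psi> 2 t / fact 2 * s ^ 2"
  proof (rule Maclaurin[OF s])
    show "\<forall>m t. m < 2 \<and> 0 \<le> t \<and> t \<le> s \<longrightarrow> DERIV (\<psi> m) t :> \<psi> (Suc m) t"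
    proof (intro allI impI, elim conjE)
      fix m :: nat and t assume "m < 2"
      then consider "m = 0" | "m = 1" by linarith
      then show "DERIV (\<psi> m) t :> \<psi> (Suc m) t"
        by cases (simp_all add: \<psi>_def D0 D1)
    qed
  qed (simp_all add: \<psi>_def)
  then obtain t where t: "0 < t" "t < s"
    and "\<psi>0 s = (\<Sum>m<2. \<psi> m 0 / fact m * s ^ m) + \<psi> 2 t / fact 2 * s ^ 2"
    by (elim exE conjE)
  then have eq: "\<psi>0 s = \<psi>0 0 + \<psi>1 0 * s + \<psi>2 t / 2 * s\<^sup>2"
    by (simp add: \<psi>_def lessThan_nat_numeral lessThan_Suc)
  let ?H = "hessian (h \<circ> R x) (- t *\<^sub>R G) G G" and ?d = "g x (riemannian_gradient A g h x) G"
  have d: "frechet_derivative (h \<circ> R x) (at 0) G = ?d"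
    unfolding riemannian_gradient[OF md] frechet_derivative_at[OF compose_R_derivative_0[OF md], symmetric] ..
  have "h (R x (- s *\<^sub>R G)) = h x - ?d * s + ?H / 2 * s\<^sup>2"
    using eq by (simp add: \<psi>0_def \<psi>1_def \<psi>2_def d)
  moreover have "?H / 2 * s\<^sup>2 \<le> ?d * s"
  proof -
    have "?H / 2 * s\<^sup>2 \<le> (\<kappa> / 2 * \<bar>?H\<bar>) * s"
    proof -
      have "?H * s \<le> \<bar>?H\<bar> * \<kappa>"
        by (rule mult_mono) (use \<kappa> in simp_all)
      then have "?H * s / 2 * s \<le> \<bar>?H\<bar> * \<kappa> / 2 * s"
        by (intro mult_right_mono) (use \<kappa> in simp_all)
      then show ?thesis by (simp add: power2_eq_square mult_ac)
    qed
    also have "\<dots> \<le> ?d * s"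
    proof (rule mult_right_mono)
      show "\<kappa> / 2 * \<bar>?H\<bar> \<le> ?d" by (rule H) (use t \<kappa> in linarith)+
    qed (rule \<kappa>(1))
    finally show ?thesis .
  qed
  ultimately show ?thesis by simp
qed simp

text \<open>In the chart \<open>c\<close> the retraction fixes the base point at the zero vector,
  and its derivative along the fibre is bounded on a compact box around \<open>(snd c p, 0)\<close>.
  The mean value inequality in the fibre then bounds the coordinate displacement, uniformly in the
  base point. The set \<open>U\<close> lets the neighbourhood be shrunk.\<close>

lemma local_retraction_bound:
  assumes c: "c \<in> A" "p \<in> fst c" and U: "open U" "snd c p \<in> U"
  obtains \<delta> C r where "0 < \<delta>" "0 < C" "0 < r" "cball (snd c p) \<delta> \<subseteq> chart_image c \<inter> U"
    "\<And>x v. x \<in> fst c \<Longrightarrow> snd c x \<in> cball (snd c p) \<delta> \<Longrightarrow> tangent_norm g x v \<le> r \<Longrightarrow>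
       R x v \<in> fst c \<and> norm (snd c (R x v) - snd c x) \<le> C * tangent_norm g x v"
proof -
  let ?E = "bundle_retraction c" and ?H = "snd c \<circ> bundle_retraction c"
  let ?y = "snd c p"
  have E0: "?E (y, 0) = chart_inv c y" if "y \<in> chart_image c" for y
    using linear_0[OF linear_tangent_vector[OF c(1), of "chart_inv c y"]] that c
    by (simp add: bundle_expression_def Let_def)
  define W where "W = {q \<in> chart_image c \<times> UNIV. ?E q \<in> fst c} \<inter> U \<times> UNIV"
  have "open W"
    unfolding W_def using open_bundle_retraction_preimage[OF c(1) open_domain[OF c(1)]] U
    by (intro open_Int open_Times) auto
  moreover have "(?y, 0) \<in> W" using c U by (auto simp: W_def E0)
  ultimately obtain a b where "open a" "open b" "(?y, 0) \<in> a \<times> b" "a \<times> b \<subseteq> W"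
    by (rule open_prod_elim)
  then have ab: "open a" "open b" "?y \<in> a" "0 \<in> b" "a \<times> b \<subseteq> W" by simp_all
  obtain \<delta>1 where \<delta>1: "\<delta>1 > 0" "cball ?y \<delta>1 \<subseteq> a" using ab open_contains_cball by blast
  obtain \<delta>2 where \<delta>2: "\<delta>2 > 0" "cball 0 \<delta>2 \<subseteq> b" using ab open_contains_cball by blast
  let ?Q = "cball ?y \<delta>1 \<times> cball (0::'e) \<delta>2"
  have QW: "?Q \<subseteq> W" using ab \<delta>1 \<delta>2 by blast
  have sub: "cball ?y \<delta>1 \<subseteq> chart_image c \<inter> U"
  proof
    fix y assume "y \<in> cball ?y \<delta>1"
    then have "(y, 0) \<in> W" using QW \<delta>2 by auto
    then show "y \<in> chart_image c \<inter> U" by (simp add: W_def)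
  qed
  have diff: "?H differentiable (at q)" if "q \<in> ?Q" for q
    using bundle_retraction_C2(1)[OF c(1) c(1), of q] that QW by (auto simp: W_def)
  have "\<exists>B>0. \<forall>q\<in>?Q. norm (frechet_derivative ?H (at q) (0, i)) \<le> B" for i
  proof -
    have "isCont (\<lambda>q. frechet_derivative ?H (at q) (0, i)) q" if "q \<in> ?Q" for q
      using bundle_retraction_C2(2)[OF c(1) c(1), of q] that QW
      by (intro differentiable_imp_continuous_within) (auto simp: W_def)
    then have "continuous_on ?Q (\<lambda>q. frechet_derivative ?H (at q) (0, i))"
      by (simp add: continuous_at_imp_continuous_on)
    then have "compact ((\<lambda>q. frechet_derivative ?H (at q) (0, i)) ` ?Q)"
      by (intro compact_continuous_image compact_Times compact_cball)
    from compact_imp_bounded[OF this] show ?thesis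
      unfolding bounded_pos by blast
  qed
  then obtain B where B: "\<And>i. 0 < B i" "\<And>i q. q \<in> ?Q \<Longrightarrow> norm (frechet_derivative ?H (at q) (0, i)) \<le> B i"
    by metis
  define C0 where "C0 = (\<Sum>i\<in>Basis. B i)"
  have C0: "C0 > 0" unfolding C0_def by (intro sum_pos B) auto
  have HB: "norm (frechet_derivative ?H (at q) (0, w)) \<le> C0 * norm w" if q: "q \<in> ?Q" for q w
  proof -
    note lin = linear_frechet_derivative[OF diff[OF q]]
    have "(0, w) = (\<Sum>i\<in>Basis. (w \<bullet> i) *\<^sub>R (0::'e, i))"
      by (rule prod_eqI) (simp_all add: fst_sum snd_sum euclidean_representation)
    then have "frechet_derivative ?H (at q) (0, w) = (\<Sum>i\<in>Basis. (w \<bullet> i) *\<^sub>R frechet_derivative ?H (at q) (0, i))"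
      by (simp add: linear_sum[OF lin] linear_cmul[OF lin] del: scaleR_Pair)
    also have "norm \<dots> \<le> (\<Sum>i\<in>Basis. norm w * B i)"
    proof (rule sum_norm_le)
      fix i :: 'e assume "i \<in> Basis"
      then show "norm ((w \<bullet> i) *\<^sub>R frechet_derivative ?H (at q) (0, i)) \<le> norm w * B i"
        unfolding norm_scaleR
        by (intro mult_mono B(2)[OF q]) (simp_all add: Basis_le_norm)
    qed
    finally show ?thesis by (simp add: C0_def sum_distrib_left mult.commute)
  qed
  have lip: "norm (?H (y, w) - y) \<le> C0 * norm w" if y: "y \<in> cball ?y \<delta>1" and w: "w \<in> cball 0 \<delta>2" for y w
  proof -
    have "norm (?H (y, w) - ?H (y, 0)) \<le> C0 * norm (w - 0)"
    proof (rule differentiable_bound[where S="cball 0 \<delta>2"])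
      fix z assume z: "z \<in> cball (0::'e) \<delta>2"
      then have q: "(y, z) \<in> ?Q" using y by simp
      have P: "(Pair y has_derivative Pair 0) (at z within cball 0 \<delta>2)"
        by (auto intro!: derivative_eq_intros)
      have "(?H has_derivative frechet_derivative ?H (at (y, z))) (at (y, z))"
        using diff[OF q] frechet_derivative_works by blast
      then have "(?H has_derivative frechet_derivative ?H (at (y, z))) (at (y, z) within Pair y ` cball 0 \<delta>2)"
        by (rule has_derivative_at_withinI)
      from diff_chain_within[OF P this]
      show "((\<lambda>w. ?H (y, w)) has_derivative (\<lambda>w. frechet_derivative ?H (at (y, z)) (0, w))) (at z within cball 0 \<delta>2)"
        by (simp add: comp_def)
      show "onorm (\<lambda>w. frechet_derivative ?H (at (y, z)) (0, w)) \<le> C0"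
        by (rule onorm_le) (rule HB[OF q])
    qed (use w \<delta>2 in auto)
    moreover have "?H (y, 0) = y" using sub y c by (auto simp: E0)
    ultimately show ?thesis by simp
  qed
  obtain l where l: "0 < l"
    "\<And>x w. x \<in> fst c \<Longrightarrow> snd c x \<in> cball ?y \<delta>1 \<Longrightarrow> l * norm w \<le> tangent_norm g x (tangent_vector A c x w)"
    using tangent_norm_chart_bounds[OF c(1) compact_cball, of ?y \<delta>1] sub by (metis le_inf_iff)
  show thesis
  \<comment> \<open>A tangent norm of at most \<open>l * \<delta>2\<close> forces the components
    into the ball of radius \<open>\<delta>2\<close>; dividing \<open>C0\<close> by \<open>l\<close>
    passes from the Euclidean norm of the components to the tangent norm.\<close>
  proof (rule that[of \<delta>1 "C0 / l" "l * \<delta>2"])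
    fix x v assume x: "x \<in> fst c" "snd c x \<in> cball ?y \<delta>1" and v: "tangent_norm g x v \<le> l * \<delta>2"
    obtain w where w: "v = tangent_vector A c x w" using tangent_vector_surj[OF c(1) x(1)] .
    have lw: "l * norm w \<le> tangent_norm g x v" using l(2)[OF x] w by simp
    then have "l * norm w \<le> l * \<delta>2" using v by linarith
    then have wb: "w \<in> cball 0 \<delta>2" using l(1) by simp
    have E: "?E (snd c x, w) = R x v" using bundle_retraction_chart[OF c(1) x(1)] w by simp
    have "(snd c x, w) \<in> W" using QW x wb by blast
    then have "R x v \<in> fst c" using E by (simp add: W_def)
    moreover have "norm (snd c (R x v) - snd c x) \<le> C0 * norm w"
      using lip[OF x(2) wb] E by simp
    moreover have "C0 * norm w \<le> C0 / l * tangent_norm g x v"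
      using mult_left_mono[OF lw, of "C0 / l"] C0 l(1) by simp
    ultimately show "R x v \<in> fst c \<and> norm (snd c (R x v) - snd c x) \<le> C0 / l * tangent_norm g x v"
      by linarith
  qed (use \<delta>1 \<delta>2 C0 l sub in auto)
qed

end

section \<open>Differentiation under the expectation\<close>

text \<open>A directional derivative as the limit of a sequence, so that measurability passes to
  it.\<close>

lemma frechet_derivative_LIMSEQ:
  fixes h :: "'a::real_normed_vector \<Rightarrow> real"
  assumes "h differentiable (at y)"
  shows "(\<lambda>n. (h (y + (1 / Suc n) *\<^sub>R v) - h y) * Suc n) \<longlonglongrightarrow> frechet_derivative h (at y) v"
proof -
  let ?D = "frechet_derivative h (at y)"
  have D: "(h has_derivative ?D) (at (y + 0 *\<^sub>R v))"
    using assms frechet_derivative_works by auto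
  have "((\<lambda>t. y + t *\<^sub>R v) has_derivative (\<lambda>t. t *\<^sub>R v)) (at 0)"
    by (auto intro!: derivative_eq_intros)
  from diff_chain_at[OF this D]
  have "((\<lambda>t. h (y + t *\<^sub>R v)) has_derivative (\<lambda>t. ?D (t *\<^sub>R v))) (at 0)"
    by (simp add: comp_def)
  then have "((\<lambda>t. h (y + t *\<^sub>R v)) has_real_derivative ?D v) (at 0)"
    by (simp add: has_field_derivative_def linear_cmul[OF linear_frechet_derivative[OF assms]] mult_commute_abs)
  then have "((\<lambda>t. (h (y + t *\<^sub>R v) - h y) / t) \<longlongrightarrow> ?D v) (at 0)"
    by (simp add: DERIV_def)
  moreover have "filterlim (\<lambda>n. 1 / real (Suc n)) (at 0) sequentially"
    unfolding filterlim_at using LIMSEQ_inverse_real_of_nat by (simp add: inverse_eq_divide)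
  ultimately have "(\<lambda>n. (h (y + (1 / real (Suc n)) *\<^sub>R v) - h y) / (1 / real (Suc n))) \<longlonglongrightarrow> ?D v"
    by (rule filterlim_compose)
  then show ?thesis by simp
qed

text \<open>Dominated convergence for the normalised Taylor remainders: the uniform derivative bound
  controls both the increment and the linear term. The limit at \<open>y\<close> is tested along
  sequences because dominated convergence is a statement about sequences.\<close>

lemma has_derivative_expectation:
  fixes h :: "'a::euclidean_space \<Rightarrow> 'w \<Rightarrow> real"
  assumes "prob_space \<mu>" and \<delta>: "0 < \<delta>"
    and int: "\<And>z. integrable \<mu> (h z)"
    and diff: "\<And>w z. w \<in> space \<mu> \<Longrightarrow> z \<in> ball y \<delta> \<Longrightarrow> (\<lambda>z. h z w) differentiable (at z)"
    and bound: "\<And>w z v. w \<in> space \<mu> \<Longrightarrow> z \<in> ball y \<delta> \<Longrightarrow>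
      \<bar>frechet_derivative (\<lambda>z. h z w) (at z) v\<bar> \<le> C * norm v"
  shows "integrable \<mu> (\<lambda>w. frechet_derivative (\<lambda>z. h z w) (at y) v)"
    and "((\<lambda>z. \<integral>w. h z w \<partial>\<mu>) has_derivative
      (\<lambda>v. \<integral>w. frechet_derivative (\<lambda>z. h z w) (at y) v \<partial>\<mu>)) (at y)"
proof -
  interpret prob_space \<mu> by fact
  define D where "D w = frechet_derivative (\<lambda>z. h z w) (at y)" for w
  have y: "y \<in> ball y \<delta>" using \<delta> by simp
  have meas: "(\<lambda>w. D w v) \<in> borel_measurable \<mu>" for v
  proof (rule borel_measurable_LIMSEQ_real)
    show "(\<lambda>n. (h (y + (1 / Suc n) *\<^sub>R v) w - h y w) * Suc n) \<longlonglongrightarrow> D w v" if "w \<in> space \<mu>" for w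
      unfolding D_def by (rule frechet_derivative_LIMSEQ[OF diff[OF that y]])
    show "(\<lambda>w. (h (y + (1 / Suc n) *\<^sub>R v) w - h y w) * Suc n) \<in> borel_measurable \<mu>" for n
      by (intro borel_measurable_times borel_measurable_diff borel_measurable_const
          borel_measurable_integrable[OF int])
  qed
  have intD: "integrable \<mu> (\<lambda>w. D w v)" for v
  proof (rule integrable_const_bound[where B="C * norm v"])
    show "AE w in \<mu>. norm (D w v) \<le> C * norm v"
      by (rule AE_I2) (simp add: D_def bound[OF _ y])
  qed (rule meas)
  then show "integrable \<mu> (\<lambda>w. frechet_derivative (\<lambda>z. h z w) (at y) v)"
    by (simp add: D_def)
  have linD: "linear (D w)" if "w \<in> space \<mu>" for w
    unfolding D_def by (rule linear_frechet_derivative[OF diff[OF that y]])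
  have "linear (\<lambda>v. \<integral>w. D w v \<partial>\<mu>)"
  proof (rule linearI)
    fix u v
    have "(\<integral>w. D w (u + v) \<partial>\<mu>) = (\<integral>w. D w u + D w v \<partial>\<mu>)"
      by (rule Bochner_Integration.integral_cong) (auto simp: linear_add[OF linD])
    then show "(\<integral>w. D w (u + v) \<partial>\<mu>) = (\<integral>w. D w u \<partial>\<mu>) + (\<integral>w. D w v \<partial>\<mu>)"
      by (simp add: intD)
  next
    fix r :: real and v
    have "(\<integral>w. D w (r *\<^sub>R v) \<partial>\<mu>) = (\<integral>w. r * D w v \<partial>\<mu>)"
      by (rule Bochner_Integration.integral_cong) (auto simp: linear_cmul[OF linD])
    then show "(\<integral>w. D w (r *\<^sub>R v) \<partial>\<mu>) = r *\<^sub>R (\<integral>w. D w v \<partial>\<mu>)" by simp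
  qed
  then have lin: "bounded_linear (\<lambda>v. \<integral>w. D w v \<partial>\<mu>)"
    by (simp add: linear_conv_bounded_linear)
  have lip: "\<bar>h z w - h y w\<bar> \<le> C * norm (z - y)" if w: "w \<in> space \<mu>" and z: "z \<in> ball y \<delta>" for z w
  proof -
    have "norm (h z w - h y w) \<le> C * norm (z - y)"
    proof (rule differentiable_bound[OF convex_ball])
      fix z assume z: "z \<in> ball y \<delta>"
      show "((\<lambda>z. h z w) has_derivative frechet_derivative (\<lambda>z. h z w) (at z)) (at z within ball y \<delta>)"
        by (rule has_derivative_at_withinI) (unfold frechet_derivative_works[symmetric], rule diff[OF w z])
      show "onorm (frechet_derivative (\<lambda>z. h z w) (at z)) \<le> C"
        by (rule onorm_le) (simp only: real_norm_def, rule bound[OF w z])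
    qed (use z y in auto)
    then show ?thesis by simp
  qed
  have "((\<lambda>z. norm ((\<integral>w. h z w \<partial>\<mu>) - (\<integral>w. h y w \<partial>\<mu>) - (\<integral>w. D w (z - y) \<partial>\<mu>)) / norm (z - y)) \<longlongrightarrow> 0) (at y)"
    unfolding tendsto_at_iff_sequentially
  proof (intro allI impI)
    fix Z :: "nat \<Rightarrow> 'a" assume "\<forall>i. Z i \<in> UNIV - {y}" and Z: "Z \<longlonglongrightarrow> y"
    then have ne: "Z i \<noteq> y" for i by auto
    obtain N where N: "\<And>n. n \<ge> N \<Longrightarrow> Z n \<in> ball y \<delta>"
      using topological_tendstoD[OF Z open_ball y] unfolding eventually_sequentially by blast
    \<comment> \<open>The shift by \<open>N\<close> keeps all points in the ball, where the
      dominating bound holds.\<close>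
    define q where "q n w = (h (Z (n + N)) w - h y w - D w (Z (n + N) - y)) / norm (Z (n + N) - y)" for n w
    have qint: "integrable \<mu> (q n)" for n
      unfolding q_def[abs_def]
      by (intro integrable_divide_zero Bochner_Integration.integrable_diff int intD)
    have "(\<lambda>n. \<integral>w. q n w \<partial>\<mu>) \<longlonglongrightarrow> (\<integral>w. 0 \<partial>\<mu>)"
    proof (rule integral_dominated_convergence[where w="\<lambda>_. 2 * C"])
      show "q n \<in> borel_measurable \<mu>" for n using qint by (rule borel_measurable_integrable)
      show "AE w in \<mu>. (\<lambda>n. q n w) \<longlonglongrightarrow> 0"
      proof (rule AE_I2)
        fix w assume w: "w \<in> space \<mu>"
        have "((\<lambda>z. h z w) has_derivative D w) (at y)"
          unfolding D_def frechet_derivative_works[symmetric] by (rule diff[OF w y])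
        then have "((\<lambda>z. (h z w - h y w - D w (z - y)) /\<^sub>R norm (z - y)) \<longlongrightarrow> 0) (at y)"
          unfolding has_derivative_at_within by (rule conjunct2)
        then have *: "\<forall>X. (\<forall>i. X i \<in> UNIV - {y}) \<longrightarrow> X \<longlonglongrightarrow> y \<longrightarrow>
            ((\<lambda>z. (h z w - h y w - D w (z - y)) /\<^sub>R norm (z - y)) \<circ> X) \<longlonglongrightarrow> 0"
          unfolding tendsto_at_iff_sequentially .
        have "\<forall>i. Z (i + N) \<in> UNIV - {y}" by (simp add: ne)
        from *[rule_format, OF this[rule_format] LIMSEQ_ignore_initial_segment[OF Z]]
        have "((\<lambda>z. (h z w - h y w - D w (z - y)) /\<^sub>R norm (z - y)) \<circ> (\<lambda>n. Z (n + N))) \<longlonglongrightarrow> 0" .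
        then show "(\<lambda>n. q n w) \<longlonglongrightarrow> 0" by (simp add: q_def comp_def divide_inverse_commute)
      qed
      show "AE w in \<mu>. norm (q n w) \<le> 2 * C" for n
      proof (rule AE_I2)
        fix w assume w: "w \<in> space \<mu>"
        let ?z = "Z (n + N)"
        have "\<bar>h ?z w - h y w - D w (?z - y)\<bar> \<le> C * norm (?z - y) + C * norm (?z - y)"
          using lip[OF w N[of "n + N"]] bound[OF w y, of "?z - y"] unfolding D_def by linarith
        then show "norm (q n w) \<le> 2 * C"
          using ne[of "n + N"] by (simp add: q_def divide_le_eq)
      qed
    qed simp_all
    then have *: "(\<lambda>n. \<bar>\<integral>w. q n w \<partial>\<mu>\<bar>) \<longlonglongrightarrow> 0" by (simp add: tendsto_rabs_zero)
    have eq: "\<bar>\<integral>w. q n w \<partial>\<mu>\<bar> = norm ((\<integral>w. h (Z (n + N)) w \<partial>\<mu>) - (\<integral>w. h y w \<partial>\<mu>) -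
        (\<integral>w. D w (Z (n + N) - y) \<partial>\<mu>)) / norm (Z (n + N) - y)" for n
      by (simp add: q_def int intD abs_divide)
    show "((\<lambda>z. norm ((\<integral>w. h z w \<partial>\<mu>) - (\<integral>w. h y w \<partial>\<mu>) - (\<integral>w. D w (z - y) \<partial>\<mu>)) / norm (z - y)) \<circ> Z)
        \<longlonglongrightarrow> 0"
      by (rule LIMSEQ_offset[of _ N]) (use * in \<open>simp only: comp_def eq\<close>)
  qed
  then show "((\<lambda>z. \<integral>w. h z w \<partial>\<mu>) has_derivative
      (\<lambda>v. \<integral>w. frechet_derivative (\<lambda>z. h z w) (at y) v \<partial>\<mu>)) (at y)"
    using lin unfolding has_derivative_iff_norm by (simp add: D_def)
qed

section \<open>Random functions with locally Lipschitz gradient\<close>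

lemma (in smooth_manifold) continuous_on_UNIV_charts:
  assumes "\<And>c. c \<in> A \<Longrightarrow> continuous_on (fst c) h"
  shows "continuous_on UNIV h"
proof -
  have "isCont h x" for x
    using assms[of "chart_at A x"] open_domain[of "chart_at A x"]
    by (simp add: continuous_on_eq_continuous_at)
  then show ?thesis by (simp add: continuous_on_eq_continuous_at)
qed

lemma (in smooth_manifold) compact_chart_inv_cball:
  assumes "c \<in> A" "cball y \<delta> \<subseteq> chart_image c"
  shows "compact (chart_inv c ` cball y \<delta>)"
  by (intro compact_continuous_image compact_cball continuous_on_subset[OF continuous_on_chart_inv] assms)

section \<open>Taylor bounds and the gradient of the expectation\<close>

locale random_function = riemannian_retraction A g R + prob_space \<mu>
  for A :: "('a::{t2_space, second_countable_topology}, 'e::euclidean_space) chart set"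
    and g :: "'a \<Rightarrow> 'e \<Rightarrow> 'e \<Rightarrow> real" and R :: "'a \<Rightarrow> 'e \<Rightarrow> 'a" and \<mu> :: "'w measure" +
  fixes f :: "'a \<Rightarrow> 'w \<Rightarrow> real" and F :: "'a \<Rightarrow> real"
  assumes f_measurable: "f x \<in> borel_measurable \<mu>"
    and f_differentiable: "w \<in> space \<mu> \<Longrightarrow> manifold_differentiable_at A (\<lambda>y. f y w) x"
    and f_bounded: "locally_bounded (space \<mu>) f"
    and gradient_bounded: "locally_bounded (space \<mu>)
         (\<lambda>x w. tangent_norm g x (riemannian_gradient A g (\<lambda>y. f y w) x))"
    and Lipschitz: "locally_R_Lipschitz_gradient g R (space \<mu>) f"
    and F_def: "F x = (\<integral>w. f x w \<partial>\<mu>)"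
begin

abbreviation "grad w x \<equiv> riemannian_gradient A g (\<lambda>y. f y w) x"

lemma integrable_f: "integrable \<mu> (f x)"
proof -
  obtain C where "\<forall>w\<in>space \<mu>. \<bar>f x w\<bar> \<le> C"
    using f_bounded unfolding locally_bounded_def by (metis compact_sing singletonI)
  then show ?thesis by (intro integrable_const_bound[where B=C] f_measurable) auto
qed

lemma gradient_boundE:
  assumes "compact K"
  obtains L where "0 < L" "\<And>x w. x \<in> K \<Longrightarrow> w \<in> space \<mu> \<Longrightarrow> tangent_norm g x (grad w x) \<le> L"
  using gradient_bounded assms unfolding locally_bounded_def by (metis tangent_norm_nonneg abs_of_nonneg)

text \<open>The mean value theorem on the segment from 0 to \<open>v\<close> expresses the remainder
  by the gradients at \<open>\<xi> *\<^sub>R v\<close> and at 0, whose difference the Lipschitz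
  condition bounds. The constant does not depend on the sample and therefore survives
  integration.\<close>

lemma Taylor_bound:
  assumes "compact K" "0 < r"
  obtains C where "0 < C" "\<And>x v w. x \<in> K \<Longrightarrow> tangent_norm g x v \<le> r \<Longrightarrow> w \<in> space \<mu> \<Longrightarrow>
    \<bar>f (R x v) w - f x w - differential A (\<lambda>y. f y w) x v\<bar> \<le> C * (tangent_norm g x v)\<^sup>2"
proof -
  obtain C where C: "C > 0" "\<And>x v w. x \<in> K \<Longrightarrow> tangent_norm g x v \<le> r \<Longrightarrow> w \<in> space \<mu> \<Longrightarrow>
      tangent_norm g x (gradient_wrt (g x) (\<lambda>u. f (R x u) w) v - gradient_wrt (g x) (\<lambda>u. f (R x u) w) 0)
              \<le> C * tangent_norm g x v"
    using Lipschitz assms unfolding locally_R_Lipschitz_gradient_def by metis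
  show thesis
  proof (rule that[OF C(1)])
    fix x v w assume x: "x \<in> K" and v: "tangent_norm g x v \<le> r" and w: "w \<in> space \<mu>"
    let ?h = "\<lambda>u. f (R x u) w"
    have diff: "?h differentiable (at u)" for u
      using compose_R_differentiable[OF f_differentiable[OF w], of x u] by (simp add: comp_def)
    have line: "((\<lambda>t. t *\<^sub>R v) has_derivative (\<lambda>t. t *\<^sub>R v)) (at t)" for t
      by (auto intro!: derivative_eq_intros)
    have D: "((\<lambda>t. ?h (t *\<^sub>R v)) has_real_derivative frechet_derivative ?h (at (t *\<^sub>R v)) v) (at t)" for t
    proof -
      have "(?h \<circ> (\<lambda>t. t *\<^sub>R v) has_derivative frechet_derivative ?h (at (t *\<^sub>R v)) \<circ> (\<lambda>t. t *\<^sub>R v)) (at t)"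
        by (rule diff_chain_at[OF line]) (use diff frechet_derivative_works in blast)
      then show ?thesis
        by (simp add: has_field_derivative_def comp_def mult_commute_abs
            linear_cmul[OF linear_frechet_derivative[OF diff]])
    qed
    obtain \<xi> where \<xi>: "0 < \<xi>" "\<xi> < 1"
      and eq: "?h (1 *\<^sub>R v) - ?h (0 *\<^sub>R v) = (1 - 0) * frechet_derivative ?h (at (\<xi> *\<^sub>R v)) v"
      using MVT2[of 0 1 "\<lambda>t. ?h (t *\<^sub>R v)" "\<lambda>t. frechet_derivative ?h (at (t *\<^sub>R v)) v"] D by auto
    let ?\<Delta> = "gradient_wrt (g x) ?h (\<xi> *\<^sub>R v) - gradient_wrt (g x) ?h 0"
    have d0: "frechet_derivative ?h (at 0) v = differential A (\<lambda>y. f y w) x v"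
      using frechet_derivative_at[OF compose_R_derivative_0[OF f_differentiable[OF w, of x]]]
      by (simp add: comp_def)
    have "f (R x v) w - f x w - differential A (\<lambda>y. f y w) x v =
        frechet_derivative ?h (at (\<xi> *\<^sub>R v)) v - frechet_derivative ?h (at 0) v"
      using eq d0 by simp
    also have "\<dots> = g x ?\<Delta> v"
      by (simp add: gradient_wrt[OF inner_product_form diff]
          bilinear_lsub[OF inner_product_form_bilinear[OF inner_product_form]])
    finally have "\<bar>f (R x v) w - f x w - differential A (\<lambda>y. f y w) x v\<bar> \<le>
        tangent_norm g x ?\<Delta> * tangent_norm g x v"
      using Cauchy_Schwarz[of x ?\<Delta> v] by simp
    also have "\<dots> \<le> (C * tangent_norm g x v) * tangent_norm g x v"
    proof (rule mult_right_mono)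
      have le: "tangent_norm g x (\<xi> *\<^sub>R v) \<le> tangent_norm g x v"
        using \<xi> by (simp add: tangent_norm_scaleR mult_left_le_one_le)
      then have "tangent_norm g x ?\<Delta> \<le> C * tangent_norm g x (\<xi> *\<^sub>R v)"
        using v by (intro C x w) simp
      also have "\<dots> \<le> C * tangent_norm g x v" using le C(1) by simp
      finally show "tangent_norm g x ?\<Delta> \<le> C * tangent_norm g x v" .
    qed simp
    finally show "\<bar>f (R x v) w - f x w - differential A (\<lambda>y. f y w) x v\<bar> \<le> C * (tangent_norm g x v)\<^sup>2"
      by (simp add: power2_eq_square)
  qed
qed

text \<open>The domination comes from writing the derivative in the chart as an inner product with
  \<open>grad w z\<close>: Cauchy-Schwarz, the gradient bound \<open>L\<close> and the norm
  comparison \<open>C\<close> on a compact ball give the bound \<open>L * C\<close>.\<close>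

lemma chart_F_has_derivative:
  assumes c: "c \<in> A" "x \<in> fst c"
  shows "integrable \<mu> (\<lambda>w. frechet_derivative (\<lambda>z. f (chart_inv c z) w) (at (snd c x)) v)"
    and "((F \<circ> chart_inv c) has_derivative
      (\<lambda>v. \<integral>w. frechet_derivative (\<lambda>z. f (chart_inv c z) w) (at (snd c x)) v \<partial>\<mu>)) (at (snd c x))"
proof -
  obtain \<delta> where \<delta>: "\<delta> > 0" "cball (snd c x) \<delta> \<subseteq> chart_image c"
    using open_chart_image[OF c(1)] c open_contains_cball chart_in_image by metis
  let ?K = "chart_inv c ` cball (snd c x) \<delta>"
  obtain L where L: "0 < L" "\<And>x w. x \<in> ?K \<Longrightarrow> w \<in> space \<mu> \<Longrightarrow> tangent_norm g x (grad w x) \<le> L"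
    using gradient_boundE[OF compact_chart_inv_cball[OF c(1) \<delta>(2)]] by blast
  obtain C where C: "0 < C"
    "\<And>z v. z \<in> fst c \<Longrightarrow> snd c z \<in> cball (snd c x) \<delta> \<Longrightarrow> tangent_norm g z (tangent_vector A c z v) \<le> C * norm v"
    using tangent_norm_chart_bounds[OF c(1) compact_cball \<delta>(2)] by metis
  have diff: "(\<lambda>z. f (chart_inv c z) w) differentiable (at y)"
    if "w \<in> space \<mu>" "y \<in> chart_image c" for w y
    using manifold_differentiable_atD[OF f_differentiable[OF that(1)] c(1) chart_inv_in[OF c(1) that(2)]]
    by (simp add: comp_def c that)
  have bound: "\<bar>frechet_derivative (\<lambda>z. f (chart_inv c z) w) (at y) v\<bar> \<le> (L * C) * norm v"
    if w: "w \<in> space \<mu>" and y: "y \<in> ball (snd c x) \<delta>" for w y v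
  proof -
    define z where "z = chart_inv c y"
    have yc: "y \<in> cball (snd c x) \<delta>" using y by simp
    have yi: "y \<in> chart_image c" using \<delta>(2) yc by blast
    have z: "z \<in> fst c" "snd c z = y" "z \<in> ?K" using yi yc c by (auto simp: z_def)
    let ?u = "tangent_vector A c z v"
    have "frechet_derivative (\<lambda>z. f (chart_inv c z) w) (at y) v = differential A (\<lambda>y. f y w) z ?u"
      using differential_tangent_vector[OF c(1) z(1) f_differentiable[OF w]] z(2) by (simp add: comp_def)
    also have "\<dots> = g z (grad w z) ?u" by (simp add: riemannian_gradient f_differentiable[OF w])
    finally have "\<bar>frechet_derivative (\<lambda>z. f (chart_inv c z) w) (at y) v\<bar> \<le>
        tangent_norm g z (grad w z) * tangent_norm g z ?u"
      using Cauchy_Schwarz by simp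
    also have "\<dots> \<le> L * (C * norm v)"
      by (intro mult_mono L C z w) (use z yc L in auto)
    finally show ?thesis by simp
  qed
  have diff_ball: "(\<lambda>z. f (chart_inv c z) w) differentiable (at y)"
    if "w \<in> space \<mu>" "y \<in> ball (snd c x) \<delta>" for w y
    by (rule diff[OF that(1)]) (use that(2) \<delta>(2) ball_subset_cball[of "snd c x" \<delta>] in blast)
  \<comment> \<open>Integrability holds at every point of the manifold, so the values of
    \<open>chart_inv c\<close> outside \<open>chart_image c\<close> do no harm.\<close>
  note * = has_derivative_expectation[OF prob_space_axioms \<delta>(1), of "\<lambda>z w. f (chart_inv c z) w",
    OF integrable_f diff_ball bound]
  show "integrable \<mu> (\<lambda>w. frechet_derivative (\<lambda>z. f (chart_inv c z) w) (at (snd c x)) v)"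
    by (rule *(1))
  have "((\<lambda>z. F (chart_inv c z)) has_derivative
      (\<lambda>v. \<integral>w. frechet_derivative (\<lambda>z. f (chart_inv c z) w) (at (snd c x)) v \<partial>\<mu>)) (at (snd c x))"
    unfolding F_def by (rule *(2))
  then show "((F \<circ> chart_inv c) has_derivative
      (\<lambda>v. \<integral>w. frechet_derivative (\<lambda>z. f (chart_inv c z) w) (at (snd c x)) v \<partial>\<mu>)) (at (snd c x))"
    by (simp add: comp_def)
qed

lemma F_differentiable: "manifold_differentiable_at A F x"
  by (rule manifold_differentiable_atI[of "chart_at A x"])
     (use chart_F_has_derivative(2)[OF chart_at] in \<open>auto intro: differentiableI\<close>)

lemma integrable_differential: "integrable \<mu> (\<lambda>w. differential A (\<lambda>y. f y w) x v)"
  using chart_F_has_derivative(1)[OF chart_at, of x v] by (simp add: differential_def comp_def)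

lemma differential_F: "differential A F x v = (\<integral>w. differential A (\<lambda>y. f y w) x v \<partial>\<mu>)"
  using frechet_derivative_at[OF chart_F_has_derivative(2)[OF chart_at, of x], symmetric]
  by (simp add: differential_def comp_def)

lemma continuous_on_F: "continuous_on UNIV F"
  by (rule manifold_differentiable_imp_continuous) (rule F_differentiable)

lemma Taylor_bound_F:
  assumes "compact K" "0 < r"
  obtains C where "0 < C" "\<And>x v. x \<in> K \<Longrightarrow> tangent_norm g x v \<le> r \<Longrightarrow>
    \<bar>F (R x v) - F x - differential A F x v\<bar> \<le> C * (tangent_norm g x v)\<^sup>2"
proof -
  obtain C where C: "0 < C" "\<And>x v w. x \<in> K \<Longrightarrow> tangent_norm g x v \<le> r \<Longrightarrow> w \<in> space \<mu> \<Longrightarrow>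
    \<bar>f (R x v) w - f x w - differential A (\<lambda>y. f y w) x v\<bar> \<le> C * (tangent_norm g x v)\<^sup>2"
    using Taylor_bound[OF assms] by blast
  show thesis
  proof (rule that[OF C(1)])
    fix x v assume x: "x \<in> K" "tangent_norm g x v \<le> r"
    let ?q = "\<lambda>w. f (R x v) w - f x w - differential A (\<lambda>y. f y w) x v"
    have q: "integrable \<mu> ?q" using integrable_f integrable_differential by simp
    have "F (R x v) - F x - differential A F x v = (\<integral>w. ?q w \<partial>\<mu>)"
      by (simp add: F_def differential_F integrable_f integrable_differential)
    moreover have "norm (\<integral>w. ?q w \<partial>\<mu>) \<le> (\<integral>w. C * (tangent_norm g x v)\<^sup>2 \<partial>\<mu>)"
    proof -
      have "norm (\<integral>w. ?q w \<partial>\<mu>) \<le> (\<integral>w. norm (?q w) \<partial>\<mu>)" by (rule integral_norm_bound)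
      also have "\<dots> \<le> (\<integral>w. C * (tangent_norm g x v)\<^sup>2 \<partial>\<mu>)"
        by (rule Bochner_Integration.integral_mono) (use q C(2)[OF x] in simp_all)
      finally show ?thesis .
    qed
    ultimately show "\<bar>F (R x v) - F x - differential A F x v\<bar> \<le> C * (tangent_norm g x v)\<^sup>2"
      by (simp add: prob_space)
  qed
qed

text \<open>Gradients at different points are never compared directly. The difference quotients of
  \<open>F\<close> along the retraction are continuous in the base point, and by the Taylor bound
  they converge to the derivative uniformly on a compact ball, at rate
  \<open>M / Suc n\<close>.\<close>

lemma continuous_on_derivative_F:
  assumes c: "c \<in> A"
  shows "continuous_on (chart_image c) (\<lambda>y. frechet_derivative (F \<circ> chart_inv c) (at y) u)"
    (is "continuous_on _ ?D")
proof -
  have "isCont ?D y0" if y0: "y0 \<in> chart_image c" for y0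
  proof -
    obtain \<delta> where \<delta>: "\<delta> > 0" "cball y0 \<delta> \<subseteq> chart_image c"
      using open_chart_image[OF c] y0 open_contains_cball by metis
    let ?B = "cball y0 \<delta>"
    let ?K = "chart_inv c ` ?B"
    obtain C1 where C1: "0 < C1"
      "\<And>z v. z \<in> fst c \<Longrightarrow> snd c z \<in> ?B \<Longrightarrow> tangent_norm g z (tangent_vector A c z v) \<le> C1 * norm v"
      using tangent_norm_chart_bounds[OF c compact_cball \<delta>(2)] by metis
    \<comment> \<open>The summand 1 makes the radius positive also for \<open>u = 0\<close>.\<close>
    define r where "r = C1 * norm u + 1"
    have r: "r > 0" using C1 by (simp add: r_def add_nonneg_pos)
    obtain C2 where C2: "0 < C2" "\<And>x v. x \<in> ?K \<Longrightarrow> tangent_norm g x v \<le> r \<Longrightarrow>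
      \<bar>F (R x v) - F x - differential A F x v\<bar> \<le> C2 * (tangent_norm g x v)\<^sup>2"
      using Taylor_bound_F[OF compact_chart_inv_cball[OF c \<delta>(2)] r] by blast
    define Q where "Q n y = (F (bundle_retraction c (y, (1 / Suc n) *\<^sub>R u)) - F (chart_inv c y)) * Suc n" for n y
    define M where "M = C2 * (C1 * norm u)\<^sup>2"
    have Qcont: "continuous_on ?B (Q n)" for n
    proof -
      have "continuous_on ?B (\<lambda>y. (y, (1 / Suc n) *\<^sub>R u))" by (intro continuous_intros)
      then have E: "continuous_on ?B (\<lambda>y. bundle_retraction c (y, (1 / Suc n) *\<^sub>R u))"
        by (rule continuous_on_compose2[OF continuous_on_bundle_retraction[OF c]]) (use \<delta> in auto)
      have "continuous_on ?B (\<lambda>y. F (bundle_retraction c (y, (1 / Suc n) *\<^sub>R u)))"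
        by (rule continuous_on_compose2[OF continuous_on_F E]) simp
      moreover have "continuous_on ?B (\<lambda>y. F (chart_inv c y))"
        by (rule continuous_on_compose2[OF continuous_on_F
            continuous_on_subset[OF continuous_on_chart_inv[OF c] \<delta>(2)]]) simp
      ultimately show ?thesis
        unfolding Q_def[abs_def] by (intro continuous_on_mult_right continuous_on_diff)
    qed
    have Qest: "\<bar>Q n y - ?D y\<bar> \<le> M / Suc n" if y: "y \<in> ?B" for n y
    proof -
      define x where "x = chart_inv c y"
      have x: "x \<in> fst c" "snd c x = y" "x \<in> ?K" using y \<delta> c by (auto simp: x_def)
      define s where "s = 1 / real (Suc n)"
      have s: "0 < s" "s \<le> 1" by (auto simp: s_def)
      let ?v = "tangent_vector A c x (s *\<^sub>R u)"
      have nv: "tangent_norm g x ?v \<le> s * (C1 * norm u)"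
        using C1(2)[OF x(1), of "s *\<^sub>R u"] x y s by (simp add: mult_ac)
      moreover have "s * (C1 * norm u) \<le> r"
      proof -
        have "s * (C1 * norm u) \<le> 1 * (C1 * norm u)"
          by (rule mult_right_mono) (use s C1(1) in simp_all)
        then show ?thesis unfolding r_def by linarith
      qed
      ultimately have "\<bar>F (R x ?v) - F x - differential A F x ?v\<bar> \<le> C2 * (tangent_norm g x ?v)\<^sup>2"
        by (intro C2 x) simp
      also have "\<dots> \<le> C2 * (s * (C1 * norm u))\<^sup>2"
        using C2(1) nv by (intro mult_left_mono power_mono) auto
      also have "\<dots> = s\<^sup>2 * M" by (simp add: M_def power_mult_distrib)
      finally have "\<bar>F (R x ?v) - F x - differential A F x ?v\<bar> \<le> s\<^sup>2 * M" .
      moreover have "differential A F x ?v = s * ?D y"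
        using differential_tangent_vector[OF c x(1) F_differentiable, of "s *\<^sub>R u"] x(2)
          linear_cmul[OF linear_frechet_derivative[OF manifold_differentiable_atD[OF F_differentiable c x(1)]], of s u]
        by simp
      moreover have "F (R x ?v) - F x = s * Q n y"
        using bundle_retraction_chart[OF c x(1), of "s *\<^sub>R u"] x(2) by (simp add: Q_def s_def x_def)
      ultimately have "\<bar>s * (Q n y - ?D y)\<bar> \<le> s\<^sup>2 * M" by (simp add: algebra_simps)
      then have "s * \<bar>Q n y - ?D y\<bar> \<le> s * (s * M)" using s by (simp add: abs_mult power2_eq_square mult.assoc)
      then have "\<bar>Q n y - ?D y\<bar> \<le> s * M" using s(1) by simp
      then show ?thesis by (simp add: s_def)
    qed
    have "uniform_limit ?B Q ?D sequentially"
    proof (rule uniform_limitI)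
      fix e :: real assume e: "0 < e"
      have "(\<lambda>n. M / Suc n) \<longlonglongrightarrow> 0"
        using LIMSEQ_Suc[OF lim_const_over_n[of M]] by simp
      from order_tendstoD(2)[OF this e] show "\<forall>\<^sub>F n in sequentially. \<forall>y\<in>?B. dist (Q n y) (?D y) < e"
      proof eventually_elim
        fix n assume n: "M / Suc n < e"
        show "\<forall>y\<in>?B. dist (Q n y) (?D y) < e"
        proof
          fix y assume "y \<in> ?B"
          from Qest[OF this, of n] n show "dist (Q n y) (?D y) < e"
            unfolding dist_real_def by linarith
        qed
      qed
    qed
    from uniform_limit_theorem[OF _ this sequentially_bot] have "continuous_on ?B ?D"
      by (simp add: Qcont)
    then have "continuous_on (ball y0 \<delta>) ?D" by (rule continuous_on_subset) auto
    then show ?thesis using \<delta>(1) by (simp add: continuous_on_eq_continuous_at)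
  qed
  then show ?thesis by (simp add: continuous_at_imp_continuous_on)
qed

lemma continuous_on_chart_gradient_F:
  assumes c: "c \<in> A"
  shows "continuous_on (fst c) (chart_gradient c F)"
proof -
  have "continuous_on (fst c) (\<lambda>x. frechet_derivative (F \<circ> chart_inv c) (at (snd c x)) i)" for i
    by (rule continuous_on_compose2[OF continuous_on_derivative_F[OF c] continuous_on_chart[OF c]]) auto
  then show ?thesis
    unfolding chart_gradient_def[abs_def] by (intro continuous_intros)
qed

lemma continuous_on_riesz_chart:
  assumes c: "c \<in> A" and h: "continuous_on S h" and k: "continuous_on S k" "k ` S \<subseteq> fst c"
  shows "continuous_on S (\<lambda>x. riesz (chart_metric A g c (snd c (k x))) (h x))"
proof -
  interpret inner_product_family_euclidean "chart_image c" "chart_metric A g c"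
    by (rule chart_metric_family[OF c(1)])
  have "continuous_on S (\<lambda>x. snd c (k x))"
    by (rule continuous_on_compose2[OF continuous_on_chart[OF c] k])
  then have "continuous_on S (\<lambda>x. (snd c (k x), h x))"
    by (intro continuous_on_Pair h)
  then have "continuous_on S (\<lambda>x. (\<lambda>(y, d). riesz (chart_metric A g c y) d) (snd c (k x), h x))"
    by (rule continuous_on_compose2[OF continuous_on_riesz]) (use k in auto)
  then show ?thesis by (simp only: split_conv)
qed

lemma continuous_on_norm_gradient_F:
  "continuous_on UNIV (\<lambda>x. tangent_norm g x (riemannian_gradient A g F x))"
proof (rule continuous_on_UNIV_charts)
  fix c assume c: "c \<in> A"
  have "continuous_on (fst c) (\<lambda>x. riesz (chart_metric A g c (snd c x)) (chart_gradient c F x))"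
    by (rule continuous_on_riesz_chart[OF c continuous_on_chart_gradient_F[OF c] continuous_on_id]) simp
  then have "continuous_on (fst c) (\<lambda>x. sqrt (chart_gradient c F x \<bullet>
      riesz (chart_metric A g c (snd c x)) (chart_gradient c F x)))"
    by (intro continuous_on_real_sqrt continuous_on_inner continuous_on_chart_gradient_F[OF c])
  then show "continuous_on (fst c) (\<lambda>x. tangent_norm g x (riemannian_gradient A g F x))"
  proof (rule continuous_on_eq)
    fix x assume x: "x \<in> fst c"
    show "sqrt (chart_gradient c F x \<bullet> riesz (chart_metric A g c (snd c x)) (chart_gradient c F x)) =
        tangent_norm g x (riemannian_gradient A g F x)"
      unfolding tangent_norm_def inner_gradients_chart[OF c x F_differentiable F_differentiable] ..
  qed
qed

end

section \<open>Measurability\<close>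

text \<open>
  \<open>x\<close> is approximated by points that depend only on which of the first \<open>n\<close> sets of a countable
  basis contain \<open>x\<close>, hence measurably and with finitely many values.
\<close>

lemma Caratheodory_measurable:
  fixes f :: "'a::second_countable_topology \<Rightarrow> 'w \<Rightarrow> real"
  assumes meas: "\<And>x. f x \<in> borel_measurable M"
    and cont: "\<And>w. w \<in> space M \<Longrightarrow> continuous_on UNIV (\<lambda>x. f x w)"
  shows "(\<lambda>(x, w). f x w) \<in> borel_measurable (borel \<Otimes>\<^sub>M M)"
proof -
  obtain B :: "'a set set" where B: "countable B" "topological_basis B"
    using ex_countable_basis by blast
  have "B \<noteq> {}" using topological_basisE[OF B(2) open_UNIV UNIV_I] by blast
  define U where "U = from_nat_into B"
  have U: "range U = B" unfolding U_def by (rule range_from_nat_into[OF \<open>B \<noteq> {}\<close> B(1)])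
  have [measurable]: "U i \<in> sets borel" for i
    using U topological_basis_open[OF B(2)] by (auto intro: borel_open)
  define S where "S n x = {i. i \<le> n \<and> x \<in> U i}" for n x
  \<comment> \<open>Arbitrary if the sets indexed by \<open>I\<close> have no common point; those
    indexed by \<open>S n x\<close> have one, namely \<open>x\<close>.\<close>
  define d where "d I = (SOME y. \<forall>i\<in>I. y \<in> U i)" for I
  have d: "d (S n x) \<in> U i" if "x \<in> U i" "i \<le> n" for n x i
    using someI_ex[of "\<lambda>y. \<forall>i\<in>S n x. y \<in> U i"] that unfolding d_def S_def by blast
  have lim: "(\<lambda>n. d (S n x)) \<longlonglongrightarrow> x" for x
  proof (rule topological_tendstoI)
    fix O' assume "open O'" "x \<in> O'"
    then obtain b where "b \<in> B" "x \<in> b" "b \<subseteq> O'" using topological_basisE[OF B(2)] by blast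
    then obtain i where "x \<in> U i" "U i \<subseteq> O'" using U by blast
    then show "\<forall>\<^sub>F n in sequentially. d (S n x) \<in> O'"
      using d[of x i] by (intro eventually_sequentiallyI[of i]) blast
  qed
  show ?thesis
  proof (rule borel_measurable_LIMSEQ_real)
    fix p :: "'a \<times> 'w" assume "p \<in> space (borel \<Otimes>\<^sub>M M)"
    then have "snd p \<in> space M" by (simp add: space_pair_measure mem_Times_iff)
    from continuous_on_tendsto_compose[OF cont[OF this] lim[of "fst p"]]
    show "(\<lambda>n. f (d (S n (fst p))) (snd p)) \<longlonglongrightarrow> (\<lambda>(x, w). f x w) p"
      by (simp add: case_prod_unfold)
  next
    fix n
    show "(\<lambda>p. f (d (S n (fst p))) (snd p)) \<in> borel_measurable (borel \<Otimes>\<^sub>M M)"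
    proof (rule measurable_compose_countable'[where I="Pow {..n}" and f="\<lambda>I p. f (d I) (snd p)"])
      show "(\<lambda>p. f (d I) (snd p)) \<in> borel_measurable (borel \<Otimes>\<^sub>M M)" for I
        by (rule measurable_compose[OF measurable_snd meas])
      show "(\<lambda>p. S n (fst p)) \<in> measurable (borel \<Otimes>\<^sub>M M) (count_space (Pow {..n}))"
      proof (subst measurable_count_space_eq2, simp, intro conjI ballI)
        show "(\<lambda>p. S n (fst p)) \<in> space (borel \<Otimes>\<^sub>M M) \<rightarrow> Pow {..n}" by (auto simp: S_def)
        fix I assume "I \<in> Pow {..n}"
        then have "(\<lambda>p. S n (fst p)) -` {I} \<inter> space (borel \<Otimes>\<^sub>M M) =
            {p \<in> space (borel \<Otimes>\<^sub>M M). \<forall>i\<in>{..n}. fst p \<in> U i \<longleftrightarrow> i \<in> I}"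
          by (auto simp: S_def)
        also have "\<dots> \<in> sets (borel \<Otimes>\<^sub>M M)" by measurable
        finally show "(\<lambda>p. S n (fst p)) -` {I} \<inter> space (borel \<Otimes>\<^sub>M M) \<in> sets (borel \<Otimes>\<^sub>M M)" .
      qed
    qed (simp add: countable_finite)
  qed
qed

text \<open>The atlas may be uncountable, whereas measurable pieces can be pasted countably often.
  The Lindelof property extracts countably many chart domains that still cover.\<close>

lemma (in smooth_manifold) measurable_chartwise:
  fixes Q :: "'q measure"
  assumes "\<And>c. c \<in> A \<Longrightarrow> h \<in> measurable (restrict_space (borel \<Otimes>\<^sub>M Q) (fst c \<times> UNIV)) N"
  shows "h \<in> measurable (borel \<Otimes>\<^sub>M Q) N"
proof -
  obtain D where D: "D \<subseteq> fst ` A" "countable D" "\<Union>D = \<Union>(fst ` A)"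
    using Lindelof[of "fst ` A"] open_domain by blast
  have UD: "\<Union>D = UNIV" unfolding D(3) using atlas by (simp add: smooth_atlas_def)
  show ?thesis
  proof (rule measurable_piecewise_restrict[where C="(\<lambda>V. V \<times> UNIV) ` D"])
    show "countable ((\<lambda>V. V \<times> UNIV) ` D)" using D by simp
    have "p \<in> \<Union>((\<lambda>V. V \<times> UNIV) ` D)" for p :: "'a \<times> 'q"
    proof -
      obtain V where "V \<in> D" "fst p \<in> V" using UD by blast
      then show ?thesis by (intro UnionI[of "V \<times> UNIV"] imageI) (simp_all add: mem_Times_iff)
    qed
    then show "space (borel \<Otimes>\<^sub>M Q) \<subseteq> \<Union>((\<lambda>V. V \<times> UNIV) ` D)" by (intro subsetI)
    fix \<Omega> :: "('a \<times> 'q) set" assume "\<Omega> \<in> (\<lambda>V. V \<times> UNIV) ` D"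
    then obtain c where c: "c \<in> A" "\<Omega> = fst c \<times> UNIV" using D by blast
    have "\<Omega> \<inter> space (borel \<Otimes>\<^sub>M Q) = fst c \<times> space Q" by (auto simp: c space_pair_measure)
    also have "\<dots> \<in> sets (borel \<Otimes>\<^sub>M Q)" using open_domain[OF c(1)] by (intro pair_measureI) auto
    finally show "\<Omega> \<inter> space (borel \<Otimes>\<^sub>M Q) \<in> sets (borel \<Otimes>\<^sub>M Q)" .
    show "h \<in> measurable (restrict_space (borel \<Otimes>\<^sub>M Q) \<Omega>) N" unfolding c by (rule assms[OF c(1)])
  qed
qed

section \<open>Joint measurability of gradients and steps\<close>

context random_function begin

lemma f_joint_measurable: "(\<lambda>(x, w). f x w) \<in> borel_measurable (borel \<Otimes>\<^sub>M \<mu>)"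
  by (intro Caratheodory_measurable f_measurable manifold_differentiable_imp_continuous f_differentiable)

text \<open>The parameter space \<open>Q\<close> with its sample map \<open>W\<close> covers two
  uses at once: \<open>Q = \<mu>\<close> for the scalar expressions in the gradient, and pairs of a
  step size and a sample, with \<open>W = snd\<close>, for the iteration step.\<close>

context
  fixes c Q W and N :: "('a \<times> 'q) measure"
  assumes c: "c \<in> A" and W [measurable]: "W \<in> measurable Q \<mu>"
  defines "N \<equiv> restrict_space (borel \<Otimes>\<^sub>M Q) (fst c \<times> UNIV)"
begin

lemma space_N: "p \<in> space N \<Longrightarrow> fst p \<in> fst c" "p \<in> space N \<Longrightarrow> W (snd p) \<in> space \<mu>"
  using measurable_space[OF W] by (auto simp: N_def space_restrict_space space_pair_measure)

lemma measurable_N: "h \<in> measurable (borel \<Otimes>\<^sub>M Q) N' \<Longrightarrow> h \<in> measurable N N'"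
  unfolding N_def by (rule measurable_restrict_space1)

lemma continuous_imp_measurable_N:
  assumes "continuous_on (fst c) (k :: 'a \<Rightarrow> 'b::topological_space)"
  shows "(\<lambda>p. k (fst p)) \<in> borel_measurable N"
proof (rule measurable_compose[OF _ borel_measurable_continuous_on_restrict[OF assms]])
  show "fst \<in> measurable N (restrict_space borel (fst c))"
  proof (rule measurable_restrict_space2)
    show "fst \<in> space N \<rightarrow> fst c" using space_N(1) by blast
  qed (intro measurable_N measurable_fst)
qed

lemma chart_image_continuous_imp_measurable_N:
  fixes k :: "'e \<times> 'e \<Rightarrow> 'b::topological_space"
  assumes "continuous_on (chart_image c \<times> UNIV) k" "d \<in> borel_measurable N"
  shows "(\<lambda>p. k (snd c (fst p), d p)) \<in> borel_measurable N"
proof (rule measurable_compose[OF _ borel_measurable_continuous_on_restrict[OF assms(1)]])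
  show "(\<lambda>p. (snd c (fst p), d p)) \<in> measurable N (restrict_space borel (chart_image c \<times> UNIV))"
  proof (rule measurable_restrict_space2)
    show "(\<lambda>p. (snd c (fst p), d p)) \<in> space N \<rightarrow> chart_image c \<times> UNIV"
      using space_N(1) by auto
    show "(\<lambda>p. (snd c (fst p), d p)) \<in> borel_measurable N"
      by (rule borel_measurable_Pair[OF continuous_imp_measurable_N[OF continuous_on_chart[OF c]] assms(2)])
  qed
qed

lemma f_measurable_N:
  assumes "k \<in> borel_measurable N"
  shows "(\<lambda>p. f (k p) (W (snd p))) \<in> borel_measurable N"
proof -
  have "(\<lambda>p. (k p, W (snd p))) \<in> measurable N (borel \<Otimes>\<^sub>M \<mu>)"
    by (intro measurable_Pair assms measurable_N) measurable
  from measurable_compose[OF this f_joint_measurable] show ?thesis by simp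
qed

text \<open>The difference quotients run along the retraction, since a straight line in the chart
  may leave \<open>chart_image c\<close>, while \<open>bundle_retraction c\<close> is continuous for
  vectors of any size. The limit is the same because the retraction has the identity as differential
  at the zero vector.\<close>

lemma derivative_measurable_N:
  "(\<lambda>p. frechet_derivative ((\<lambda>y. f y (W (snd p))) \<circ> chart_inv c) (at (snd c (fst p))) u) \<in> borel_measurable N"
proof (rule borel_measurable_LIMSEQ_real)
  fix n
  have "(\<lambda>p. bundle_retraction c (snd c (fst p), (1 / Suc n) *\<^sub>R u)) \<in> borel_measurable N"
    by (rule chart_image_continuous_imp_measurable_N[OF continuous_on_bundle_retraction[OF c]]) simp
  moreover have "fst \<in> borel_measurable N" by (intro measurable_N measurable_fst)
  ultimately show "(\<lambda>p. (f (bundle_retraction c (snd c (fst p), (1 / Suc n) *\<^sub>R u)) (W (snd p)) -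
      f (fst p) (W (snd p))) * Suc n) \<in> borel_measurable N"
    by (intro borel_measurable_times borel_measurable_diff borel_measurable_const f_measurable_N)
next
  fix p assume p: "p \<in> space N"
  define x w where "x = fst p" and "w = W (snd p)"
  have x: "x \<in> fst c" and w: "w \<in> space \<mu>" using space_N[OF p] by (simp_all add: x_def w_def)
  note md = f_differentiable[OF w, of x]
  let ?h = "(\<lambda>y. f y w) \<circ> R x" and ?u = "tangent_vector A c x u"
  have "frechet_derivative ?h (at 0) ?u = frechet_derivative ((\<lambda>y. f y w) \<circ> chart_inv c) (at (snd c x)) u"
    unfolding frechet_derivative_at[OF compose_R_derivative_0[OF md], symmetric]
    by (rule differential_tangent_vector[OF c x md])
  moreover have "(\<lambda>n. (?h (0 + (1 / Suc n) *\<^sub>R ?u) - ?h 0) * Suc n) \<longlonglongrightarrow> frechet_derivative ?h (at 0) ?u"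
    by (rule frechet_derivative_LIMSEQ, rule differentiableI, rule compose_R_derivative_0[OF md])
  moreover have "?h (0 + (1 / Suc n) *\<^sub>R ?u) = f (bundle_retraction c (snd c x, (1 / Suc n) *\<^sub>R u)) w" for n
    by (simp add: bundle_retraction_chart[OF c x] linear_cmul[OF linear_tangent_vector[OF c x]])
  ultimately show "(\<lambda>n. (f (bundle_retraction c (snd c (fst p), (1 / Suc n) *\<^sub>R u)) (W (snd p)) -
      f (fst p) (W (snd p))) * Suc n) \<longlonglongrightarrow>
      frechet_derivative ((\<lambda>y. f y (W (snd p))) \<circ> chart_inv c) (at (snd c (fst p))) u"
    by (simp add: x_def w_def)
qed

lemma chart_gradient_measurable_N:
  "(\<lambda>p. chart_gradient c (\<lambda>y. f y (W (snd p))) (fst p)) \<in> borel_measurable N"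
  unfolding chart_gradient_def
  by (intro borel_measurable_sum borel_measurable_scaleR derivative_measurable_N borel_measurable_const)

lemma riesz_measurable_N:
  "(\<lambda>p. riesz (chart_metric A g c (snd c (fst p))) (chart_gradient c (\<lambda>y. f y (W (snd p))) (fst p)))
    \<in> borel_measurable N"
proof -
  interpret inner_product_family_euclidean "chart_image c" "chart_metric A g c"
    by (rule chart_metric_family[OF c])
  from chart_image_continuous_imp_measurable_N[OF continuous_on_riesz chart_gradient_measurable_N]
  show ?thesis by (simp only: split_conv)
qed

text \<open>With arbitrarily chosen preferred charts, neither \<open>g\<close> nor
  \<open>grad\<close> need be measurable in the point. Their combination is a scalar that equals an
  expression in the chart \<open>c\<close>.\<close>

lemma norm_gradient_measurable_N:
  "(\<lambda>p. g (fst p) (grad (W (snd p)) (fst p)) (grad (W (snd p)) (fst p))) \<in> borel_measurable N"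
proof (subst measurable_cong)
  fix p assume p: "p \<in> space N"
  show "g (fst p) (grad (W (snd p)) (fst p)) (grad (W (snd p)) (fst p)) =
      chart_gradient c (\<lambda>y. f y (W (snd p))) (fst p) \<bullet>
      riesz (chart_metric A g c (snd c (fst p))) (chart_gradient c (\<lambda>y. f y (W (snd p))) (fst p))"
    by (intro inner_gradients_chart c f_differentiable space_N p)
qed (intro borel_measurable_inner chart_gradient_measurable_N riesz_measurable_N)

lemma inner_gradient_measurable_N:
  "(\<lambda>p. g (fst p) (riemannian_gradient A g F (fst p)) (grad (W (snd p)) (fst p))) \<in> borel_measurable N"
proof (subst measurable_cong)
  fix p assume p: "p \<in> space N"
  show "g (fst p) (riemannian_gradient A g F (fst p)) (grad (W (snd p)) (fst p)) =
      chart_gradient c F (fst p) \<bullet>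
      riesz (chart_metric A g c (snd c (fst p))) (chart_gradient c (\<lambda>y. f y (W (snd p))) (fst p))"
    by (intro inner_gradients_chart c f_differentiable F_differentiable space_N p)
qed (intro borel_measurable_inner riesz_measurable_N
    continuous_imp_measurable_N[OF continuous_on_chart_gradient_F[OF c]])

lemma step_measurable_N:
  assumes s: "s \<in> borel_measurable Q"
  shows "(\<lambda>p. R (fst p) (- s (snd p) *\<^sub>R grad (W (snd p)) (fst p))) \<in> borel_measurable N"
proof (subst measurable_cong)
  fix p assume p: "p \<in> space N"
  show "R (fst p) (- s (snd p) *\<^sub>R grad (W (snd p)) (fst p)) =
    bundle_retraction c (snd c (fst p), - s (snd p) *\<^sub>R
      riesz (chart_metric A g c (snd c (fst p))) (chart_gradient c (\<lambda>y. f y (W (snd p))) (fst p)))"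
    using space_N[OF p] by (simp only: bundle_retraction_chart[OF c] linear_cmul[OF linear_tangent_vector[OF c]]
        riemannian_gradient_chart[OF c _ f_differentiable])
next
  have "(\<lambda>p. s (snd p)) \<in> borel_measurable N"
    by (intro measurable_N measurable_compose[OF measurable_snd s])
  then show "(\<lambda>p. bundle_retraction c (snd c (fst p), - s (snd p) *\<^sub>R
      riesz (chart_metric A g c (snd c (fst p))) (chart_gradient c (\<lambda>y. f y (W (snd p))) (fst p))))
      \<in> borel_measurable N"
    by (intro chart_image_continuous_imp_measurable_N[OF continuous_on_bundle_retraction[OF c]]
        borel_measurable_scaleR borel_measurable_uminus riesz_measurable_N)
qed

end

lemma norm_gradient_measurable:
  "(\<lambda>(x, w). (tangent_norm g x (grad w x))\<^sup>2) \<in> borel_measurable (borel \<Otimes>\<^sub>M \<mu>)"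
  unfolding tangent_norm_square case_prod_unfold
  by (rule measurable_chartwise) (rule norm_gradient_measurable_N[OF _ measurable_ident, unfolded id_def])

lemma inner_gradient_measurable:
  "(\<lambda>(x, w). g x (riemannian_gradient A g F x) (grad w x)) \<in> borel_measurable (borel \<Otimes>\<^sub>M \<mu>)"
  unfolding case_prod_unfold
  by (rule measurable_chartwise) (rule inner_gradient_measurable_N[OF _ measurable_ident, unfolded id_def])

lemma step_measurable:
  "(\<lambda>(x, s, w). R x (- s *\<^sub>R grad w x)) \<in> borel_measurable (borel \<Otimes>\<^sub>M (borel \<Otimes>\<^sub>M \<mu>))"
  unfolding case_prod_unfold
  by (rule measurable_chartwise) (rule step_measurable_N[OF _ measurable_snd measurable_fst])

end

section \<open>Adaptive step sizes\<close>

text \<open>Compares the sum with the integral of \<open>x powr (- p)\<close> from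
  \<open>\<beta>\<close> on, by the mean value theorem for \<open>x powr (1 - p)\<close> between
  consecutive partial sums. The bound depends neither on \<open>T\<close> nor on the
  sequence.\<close>

lemma sum_normalized_le:
  fixes a :: "nat \<Rightarrow> real"
  assumes a: "\<And>t. 0 \<le> a t" "\<And>t. a t \<le> L" and \<beta>: "0 < \<beta>" and p: "1 < p"
  shows "(\<Sum>t<T. a t / (\<beta> + (\<Sum>s<t. a s)) powr p)
    \<le> (1 + L / \<beta>) powr p * \<beta> powr (1 - p) / (p - 1)"
proof -
  define S where "S t = \<beta> + (\<Sum>s<t. a s)" for t
  define k where "k = (1 + L / \<beta>) powr p"
  have L: "0 \<le> L" using a(1)[of 0] a(2)[of 0] by linarith
  have S_ge: "\<beta> \<le> S t" for t unfolding S_def using a(1) by (simp add: sum_nonneg)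
  then have S_pos: "0 < S t" for t using \<beta> by (meson less_le_trans)
  have S_Suc: "S (Suc t) = S t + a t" for t by (simp add: S_def)
  have k: "0 \<le> k" by (simp add: k_def)
  have step: "a t / S t powr p \<le> k / (p - 1) * (S t powr (1 - p) - S (Suc t) powr (1 - p))" for t
  \<comment> \<open>The mean value theorem needs \<open>S t < S (Suc t)\<close>.\<close>
  proof (cases "a t = 0")
    case False
    then have at: "0 < a t" using a(1)[of t] by linarith
    have "((\<lambda>x. x powr (1 - p)) has_real_derivative (1 - p) * x powr (1 - p - 1)) (at x)"
      if "S t \<le> x" for x
      using that S_pos[of t] by (intro has_real_derivative_powr) linarith
    then obtain z where z: "S t < z" "z < S (Suc t)"
      and eq: "S (Suc t) powr (1 - p) - S t powr (1 - p) = (S (Suc t) - S t) * ((1 - p) * z powr (1 - p - 1))"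
      using MVT2[of "S t" "S (Suc t)" "\<lambda>x. x powr (1 - p)" "\<lambda>x. (1 - p) * x powr (1 - p - 1)"] at S_Suc[of t]
      by auto
    \<comment> \<open>The denominator sits at the left end of the interval, where the integrand is
      largest. Since \<open>a t \<le> L\<close> and \<open>\<beta> \<le> S t\<close>, passing to the
      right end costs the factor \<open>k\<close>.\<close>
    have "1 / S t powr p \<le> k / S (Suc t) powr p"
    proof -
      have "a t \<le> L / \<beta> * S t"
      proof -
        have "L / \<beta> * \<beta> \<le> L / \<beta> * S t"
          by (rule mult_left_mono[OF S_ge]) (use L \<beta> in simp)
        then show ?thesis using a(2)[of t] \<beta> by simp
      qed
      then have "S (Suc t) \<le> (1 + L / \<beta>) * S t" using S_Suc[of t] by (simp add: algebra_simps)
      then have "S (Suc t) powr p \<le> ((1 + L / \<beta>) * S t) powr p"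
        using S_pos[of "Suc t"] p by (intro powr_mono2) auto
      also have "\<dots> = k * S t powr p"
        unfolding k_def by (rule powr_mult)
      finally show ?thesis using S_pos[of t] S_pos[of "Suc t"] by (simp add: field_simps)
    qed
    also have "\<dots> \<le> k * z powr (- p)"
    proof -
      have "S (Suc t) powr (- p) \<le> z powr (- p)"
        using z S_pos[of t] p by (intro powr_mono2') auto
      then show ?thesis
        using mult_left_mono[OF _ k] by (simp add: powr_minus divide_inverse)
    qed
    finally have "a t * (1 / S t powr p) \<le> a t * (k * z powr (- p))"
      using at by (intro mult_left_mono) auto
    also have "a t * (k * z powr (- p)) = k / (p - 1) * ((p - 1) * (a t * z powr (- p)))"
      using p by simp
    also have "(p - 1) * (a t * z powr (- p)) = S t powr (1 - p) - S (Suc t) powr (1 - p)"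
    proof -
      have "(p - 1) * (a t * z powr (- p)) = - (a t * ((1 - p) * z powr (- p)))"
        by (simp add: algebra_simps)
      then show ?thesis using eq S_Suc[of t] by simp
    qed
    finally show ?thesis by simp
  qed (simp add: S_Suc)
  have "(\<Sum>t<T. a t / S t powr p) \<le> (\<Sum>t<T. k / (p - 1) * (S t powr (1 - p) - S (Suc t) powr (1 - p)))"
    by (rule sum_mono) (rule step)
  also have "\<dots> = k / (p - 1) * (S 0 powr (1 - p) - S T powr (1 - p))"
    unfolding sum_distrib_left[symmetric] sum_lessThan_telescope'[of "\<lambda>t. S t powr (1 - p)"] ..
  also have "\<dots> \<le> k / (p - 1) * \<beta> powr (1 - p)"
    using p k by (intro mult_left_mono) (auto simp: S_def)
  finally show ?thesis by (simp add: S_def k_def)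
qed

text \<open>For \<open>q \<le> 1\<close> the denominators grow at most linearly, so the harmonic
  series is a minorant up to a factor.\<close>

lemma not_summable_step_sizes:
  fixes \<eta> :: "nat \<Rightarrow> real"
  assumes "0 < \<alpha>" "0 < \<beta>" "0 \<le> L" "0 < q" "q \<le> 1"
    and \<eta>: "\<And>t. \<alpha> / (\<beta> + t * L) powr q \<le> \<eta> t"
  shows "\<not> summable \<eta>"
proof
  assume sum: "summable \<eta>"
  \<comment> \<open>The summand 1 gives \<open>1 \<le> D\<close>, so that the base
    \<open>D * Suc t\<close> is at least 1 and raising the exponent from \<open>q\<close> to 1
    enlarges the power.\<close>
  define D where "D = \<beta> + L + 1"
  have D: "1 \<le> D" "0 < D" using assms by (auto simp: D_def)
  have le: "\<alpha> / D * inverse (real (Suc t)) \<le> \<eta> t" for t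
  proof -
    have "t * L \<le> (\<beta> + L + 1) * t" using assms by (simp add: algebra_simps)
    then have b: "\<beta> + t * L \<le> D * Suc t" using assms by (simp add: D_def algebra_simps)
    have pos: "0 < \<beta> + t * L" using assms by (intro add_pos_nonneg) auto
    have "1 * 1 \<le> D * Suc t" using D by (intro mult_mono) auto
    have "(\<beta> + t * L) powr q \<le> (D * Suc t) powr q"
      using b pos assms by (intro powr_mono2) auto
    also have "\<dots> \<le> (D * Suc t) powr 1"
      by (rule powr_mono) (use assms \<open>1 * 1 \<le> D * Suc t\<close> in auto)
    also have "\<dots> = D * Suc t" using D by simp
    finally have "\<alpha> / (D * Suc t) \<le> \<alpha> / (\<beta> + t * L) powr q"
      using pos D assms by (intro divide_left_mono mult_pos_pos) auto
    then show ?thesis using \<eta>[of t] by (simp add: divide_inverse)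
  qed
  have "summable (\<lambda>t. \<alpha> / D * inverse (real (Suc t)))"
    by (rule summable_comparison_test'[OF sum, of 0]) (use le assms D in simp)
  then have "summable (\<lambda>t. inverse (real (Suc t)))"
    using assms D by (subst (asm) summable_cmult_iff) auto
  then show False
    using not_summable_harmonic[where 'a=real] summable_Suc_iff[of "\<lambda>n. inverse (real n)"] by blast
qed

text \<open>Here \<open>l\<close> stands for path lengths, and \<open>modulus\<close> is all that
  remains of the geometry. Between the last time \<open>m \<le> n\<close> with
  \<open>b m < e\<close> and the time \<open>n\<close>, the step sizes are at most
  \<open>\<eta> t * (b t)\<^sup>2 / e\<^sup>2\<close>, so the length of that stretch is bounded by a
  tail of the convergent series. Hence \<open>b n\<close> is below \<open>2 * e\<close>.\<close>

lemma tendsto_0_of_crossings: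
  fixes \<eta> b l :: "nat \<Rightarrow> real"
  assumes nn: "\<And>t. 0 \<le> \<eta> t" "\<And>t. 0 \<le> b t"
    and sum: "summable (\<lambda>t. \<eta> t * (b t)\<^sup>2)" "\<not> summable \<eta>"
    and l: "l \<longlonglongrightarrow> 0" "\<And>t. l t \<le> L * \<eta> t" "0 < L"
    and modulus: "\<And>e. 0 < e \<Longrightarrow> \<exists>\<delta>>0. \<forall>m n. m \<le> n \<longrightarrow> (\<Sum>t=m..<n. l t) < \<delta> \<longrightarrow> \<bar>b n - b m\<bar> < e"
  shows "b \<longlonglongrightarrow> 0"
proof (rule LIMSEQ_I)
  fix e' :: real assume "0 < e'"
  define e where "e = e' / 2"
  have e: "0 < e" using \<open>0 < e'\<close> by (simp add: e_def)
  obtain \<delta> where \<delta>: "0 < \<delta>" "\<And>m n. m \<le> n \<Longrightarrow> (\<Sum>t=m..<n. l t) < \<delta> \<Longrightarrow> \<bar>b n - b m\<bar> < e"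
    using modulus[OF e] by blast
  obtain N1 where N1: "\<And>n. N1 \<le> n \<Longrightarrow> l n < \<delta> / 2"
    using order_tendstoD(2)[OF l(1), of "\<delta> / 2"] \<delta>(1) by (auto simp: eventually_sequentially)
  \<comment> \<open>Chosen so that \<open>L / e\<^sup>2 * d = \<delta> / 2\<close>.\<close>
  define d where "d = \<delta> * e\<^sup>2 / (2 * L)"
  have d: "0 < d" using \<delta>(1) e l(3) by (simp add: d_def)
  obtain N2 where Cauchy: "\<forall>m\<ge>N2. \<forall>n. norm (\<Sum>t=m..<n. \<eta> t * (b t)\<^sup>2) < d"
    using sum(1) d unfolding summable_Cauchy by blast
  have N2: "(\<Sum>t=m..<n. \<eta> t * (b t)\<^sup>2) < d" if "N2 \<le> m" for m n
    using Cauchy[rule_format, OF that, of n] unfolding real_norm_def by linarith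
  have \<eta>_le: "\<eta> t \<le> \<eta> t * (b t)\<^sup>2 / e\<^sup>2" if "e \<le> b t" for t
  proof -
    have "\<eta> t * e\<^sup>2 \<le> \<eta> t * (b t)\<^sup>2"
      using that e nn by (intro mult_left_mono power_mono) auto
    then show ?thesis using e by (simp add: field_simps)
  qed
  have "\<exists>T\<ge>max N1 N2. b T < e"
  proof (rule ccontr)
    assume "\<not> ?thesis"
    then have *: "norm (\<eta> t) \<le> \<eta> t * (b t)\<^sup>2 / e\<^sup>2" if "max N1 N2 \<le> t" for t
      using \<eta>_le[of t] nn(1)[of t] that by (auto simp: not_less)
    have "summable (\<lambda>t. \<eta> t * (b t)\<^sup>2 / e\<^sup>2)" by (intro summable_divide sum)
    from summable_comparison_test'[OF this *] sum(2) show False by blast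
  qed
  then obtain T where T: "N1 \<le> T" "N2 \<le> T" "b T < e" by auto
  have "norm (b n - 0) < e'" if n: "T \<le> n" for n
  proof -
    let ?M = "{t \<in> {T..n}. b t < e}"
    define m where "m = Max ?M"
    have "m \<in> ?M" unfolding m_def by (rule Max_in) (use T n in auto)
    then have m: "T \<le> m" "m \<le> n" "b m < e" by auto
    have above: "e \<le> b t" if "m < t" "t \<le> n" for t
    proof (rule ccontr)
      assume "\<not> e \<le> b t"
      then have "t \<in> ?M" using that m by auto
      then have "t \<le> m" unfolding m_def by (intro Max_ge) auto
      then show False using that by simp
    qed
    have "b n < b m + e"
    proof (cases "m = n")
      case False
      then have mn: "m < n" using m by simp
      have "(\<Sum>t=Suc m..<n. l t) \<le> (\<Sum>t=Suc m..<n. L / e\<^sup>2 * (\<eta> t * (b t)\<^sup>2))"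
      proof (rule sum_mono)
        fix t assume "t \<in> {Suc m..<n}"
        then have "\<eta> t \<le> \<eta> t * (b t)\<^sup>2 / e\<^sup>2" using \<eta>_le above by auto
        then have "L * \<eta> t \<le> L * (\<eta> t * (b t)\<^sup>2 / e\<^sup>2)" using l(3) by (intro mult_left_mono) auto
        then show "l t \<le> L / e\<^sup>2 * (\<eta> t * (b t)\<^sup>2)" using l(2)[of t] by simp
      qed
      also have "\<dots> = L / e\<^sup>2 * (\<Sum>t=Suc m..<n. \<eta> t * (b t)\<^sup>2)" by (simp add: sum_distrib_left)
      also have "\<dots> < L / e\<^sup>2 * d"
        by (rule mult_strict_left_mono[OF N2]) (use m T l e in auto)
      also have "\<dots> = \<delta> / 2" using l(3) e by (simp add: d_def field_simps)
      \<comment> \<open>At time \<open>m\<close> itself \<open>b\<close> is below \<open>e\<close>,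
        so this one length escapes the tail estimate; \<open>l \<longlonglongrightarrow> 0\<close>
        makes it less than \<open>\<delta> / 2\<close>.\<close>
      finally have "l m + (\<Sum>t=Suc m..<n. l t) < \<delta>" using N1[of m] m T by linarith
      then have "(\<Sum>t=m..<n. l t) < \<delta>" using mn by (simp add: sum.atLeast_Suc_lessThan)
      then have "\<bar>b n - b m\<bar> < e" by (rule \<delta>(2)[OF m(2)])
      then show ?thesis by linarith
    qed (use e in simp)
    then show ?thesis using m(3) nn(2)[of n] by (simp add: e_def)
  qed
  then show "\<exists>N. \<forall>n\<ge>N. norm (b n - 0) < e'" by blast
qed

section \<open>Continuity along retraction paths\<close>

context riemannian_retraction begin

text \<open>A short path that starts near \<open>p\<close> stays in one chart, in a ball on which
  \<open>h\<close> differs from \<open>h p\<close> by less than \<open>e / 2\<close>.\<close>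

lemma local_path_modulus:
  assumes h: "continuous_on UNIV (h :: 'a \<Rightarrow> real)" and e: "0 < e"
  obtains V d where "open V" "p \<in> V" "0 < d"
    "\<forall>x v m n. (\<forall>t. x (Suc t) = R (x t) (v t)) \<longrightarrow> m \<le> n \<longrightarrow> x m \<in> V \<longrightarrow>
      (\<Sum>t=m..<n. tangent_norm g (x t) (v t)) < d \<longrightarrow> \<bar>h (x n) - h (x m)\<bar> < e"
proof -
  let ?c = "chart_at A p"
  define U where "U = {y \<in> chart_image ?c. chart_inv ?c y \<in> {x. \<bar>h x - h p\<bar> < e / 2}}"
  have "open {x. \<bar>h x - h p\<bar> < e / 2}"
    by (intro open_Collect_less continuous_intros h)
  then have "open U" unfolding U_def by (rule open_overlap[OF chart_at(1)])
  moreover have "snd ?c p \<in> U" using e by (simp add: U_def)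
  ultimately obtain \<delta> C r where \<delta>: "0 < \<delta>" "0 < C" "0 < r" "cball (snd ?c p) \<delta> \<subseteq> chart_image ?c \<inter> U"
    and local_step: "\<And>x v. x \<in> fst ?c \<Longrightarrow> snd ?c x \<in> cball (snd ?c p) \<delta> \<Longrightarrow> tangent_norm g x v \<le> r \<Longrightarrow>
       R x v \<in> fst ?c \<and> norm (snd ?c (R x v) - snd ?c x) \<le> C * tangent_norm g x v"
    by (rule local_retraction_bound[OF chart_at]) blast
  have close: "\<bar>h x - h p\<bar> < e / 2" if "x \<in> fst ?c" "snd ?c x \<in> cball (snd ?c p) \<delta>" for x
  proof -
    have "snd ?c x \<in> U" using that(2) \<delta>(4) by blast
    then show ?thesis using that(1) by (simp add: U_def)
  qed
  define V where "V = fst ?c \<inter> snd ?c -` ball (snd ?c p) (\<delta> / 2)"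
  \<comment> \<open>The bound \<open>r\<close> makes each step admissible for
    \<open>local_step\<close>; \<open>\<delta> / (2 * C)\<close> limits the displacement to
    \<open>\<delta> / 2\<close>, which together with a start within \<open>\<delta> / 2\<close>
    stays in the ball.\<close>
  define d where "d = min r (\<delta> / (2 * C))"
  show thesis
  proof (rule that)
    show "open V" unfolding V_def
      by (rule continuous_open_preimage[OF continuous_on_chart open_domain open_ball]) simp_all
    show "p \<in> V" using \<delta> by (simp add: V_def)
    show "0 < d" using \<delta> by (simp add: d_def)
    show "\<forall>x v m n. (\<forall>t. x (Suc t) = R (x t) (v t)) \<longrightarrow> m \<le> n \<longrightarrow> x m \<in> V \<longrightarrow>
      (\<Sum>t=m..<n. tangent_norm g (x t) (v t)) < d \<longrightarrow> \<bar>h (x n) - h (x m)\<bar> < e"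
    proof (intro allI impI)
      fix x v and m n :: nat
      assume x: "\<forall>t. x (Suc t) = R (x t) (v t)" and mn: "m \<le> n" and xm: "x m \<in> V"
        and less: "(\<Sum>t=m..<n. tangent_norm g (x t) (v t)) < d"
      \<comment> \<open>Staying in the ball and the displacement bound go through one induction: the
        next step estimate needs the first, the first needs the second.\<close>
      have path: "x j \<in> fst ?c \<and> snd ?c (x j) \<in> cball (snd ?c p) \<delta> \<and>
          norm (snd ?c (x j) - snd ?c (x m)) \<le> C * (\<Sum>t=m..<j. tangent_norm g (x t) (v t))"
        if "m \<le> j" "j \<le> n" for j
        using that
      proof (induction j rule: dec_induct)
        case base
        then show ?case using xm \<delta>(1) by (auto simp: V_def)
      next
        case (step j)
        let ?s = "\<lambda>k. \<Sum>t=m..<k. tangent_norm g (x t) (v t)"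
        have IH: "x j \<in> fst ?c" "snd ?c (x j) \<in> cball (snd ?c p) \<delta>"
          "norm (snd ?c (x j) - snd ?c (x m)) \<le> C * ?s j"
          using step by auto
        have sSuc: "?s (Suc j) = ?s j + tangent_norm g (x j) (v j)" using step by simp
        have "?s (Suc j) \<le> ?s n" by (rule sum_mono2) (use step in auto)
        then have sd: "?s (Suc j) < d" using less by linarith
        have "0 \<le> ?s j" by (rule sum_nonneg) simp
        then have "tangent_norm g (x j) (v j) \<le> r" using sd sSuc by (simp add: d_def)
        from local_step[OF IH(1,2) this] have 1: "x (Suc j) \<in> fst ?c"
          "norm (snd ?c (x (Suc j)) - snd ?c (x j)) \<le> C * tangent_norm g (x j) (v j)"
          by (simp_all add: x)
        have 2: "norm (snd ?c (x (Suc j)) - snd ?c (x m)) \<le> C * ?s (Suc j)"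
        proof -
          have "norm (snd ?c (x (Suc j)) - snd ?c (x m)) \<le>
              norm (snd ?c (x (Suc j)) - snd ?c (x j)) + norm (snd ?c (x j) - snd ?c (x m))"
            by (rule order_trans[OF _ norm_triangle_ineq]) simp
          also have "\<dots> \<le> C * tangent_norm g (x j) (v j) + C * ?s j" using 1(2) IH(3) by (rule add_mono)
          finally show ?thesis unfolding sSuc by (simp add: algebra_simps)
        qed
        have "C * ?s (Suc j) \<le> C * (\<delta> / (2 * C))"
          by (rule mult_left_mono) (use sd \<delta> in \<open>auto simp: d_def\<close>)
        also have "\<dots> = \<delta> / 2" using \<delta> by simp
        finally have "dist (snd ?c (x m)) (snd ?c (x (Suc j))) \<le> \<delta> / 2"
          using 2 by (simp add: dist_norm norm_minus_commute)
        moreover have "dist (snd ?c p) (snd ?c (x m)) < \<delta> / 2" using xm by (simp add: V_def)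
        ultimately have "dist (snd ?c p) (snd ?c (x (Suc j))) \<le> \<delta>"
          using dist_triangle[of "snd ?c p" "snd ?c (x (Suc j))" "snd ?c (x m)"] by linarith
        then show ?case using 1 2 by simp
      qed
      have "\<bar>h (x m) - h p\<bar> < e / 2" "\<bar>h (x n) - h p\<bar> < e / 2"
        using close path[of m] path[of n] mn by simp_all
      then show "\<bar>h (x n) - h (x m)\<bar> < e" by linarith
    qed
  qed
qed

text \<open>Uniform continuity on \<open>K\<close> with path length in the role of a distance: a
  finite subcover by the neighbourhoods of the local version, selected by the starting point
  \<open>x m\<close>.\<close>

lemma path_modulus:
  assumes K: "compact K" and h: "continuous_on UNIV (h :: 'a \<Rightarrow> real)" and e: "0 < e"
  obtains \<delta> where "0 < \<delta>"
    "\<And>x v m n. (\<And>t. x t \<in> K) \<Longrightarrow> (\<And>t. x (Suc t) = R (x t) (v t)) \<Longrightarrow> m \<le> n \<Longrightarrow>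
      (\<Sum>t=m..<n. tangent_norm g (x t) (v t)) < \<delta> \<Longrightarrow> \<bar>h (x n) - h (x m)\<bar> < e"
proof -
  define good where "good V d \<longleftrightarrow> (\<forall>x v m n. (\<forall>t. x (Suc t) = R (x t) (v t)) \<longrightarrow> m \<le> n \<longrightarrow> x m \<in> V \<longrightarrow>
      (\<Sum>t=m..<n. tangent_norm g (x t) (v t)) < d \<longrightarrow> \<bar>h (x n) - h (x m)\<bar> < e)" for V d
  have "\<exists>V d. open V \<and> p \<in> V \<and> 0 < d \<and> good V d" for p
    by (rule local_path_modulus[OF h e, of p, folded good_def]) blast
  then obtain V d where V: "\<And>p. open (V p)" "\<And>p. p \<in> V p" "\<And>p. 0 < (d p :: real)"
    and good: "\<And>p. good (V p) (d p)"
    by metis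
  obtain D where D: "D \<subseteq> K" "finite D" "K \<subseteq> (\<Union>p\<in>D. V p)"
  proof (rule compactE_image[OF K])
    show "K \<subseteq> (\<Union>p\<in>K. V p)" using V(2) by blast
  qed (rule V(1))
  \<comment> \<open>The element 1 keeps the set nonempty when \<open>K\<close> is empty.\<close>
  define \<delta> where "\<delta> = Min (insert 1 (d ` D))"
  show thesis
  proof (rule that)
    show "0 < \<delta>" using D V(3) by (simp add: \<delta>_def)
    fix x v and m n :: nat
    assume x: "\<And>t. x t \<in> K" "\<And>t. x (Suc t) = R (x t) (v t)" and mn: "m \<le> n"
      and less: "(\<Sum>t=m..<n. tangent_norm g (x t) (v t)) < \<delta>"
    obtain p where p: "p \<in> D" "x m \<in> V p" using D(3) x(1)[of m] by blast
    have "\<delta> \<le> d p" unfolding \<delta>_def by (rule Min_le) (use D p in auto)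
    then show "\<bar>h (x n) - h (x m)\<bar> < e"
      using good[of p] x(2) mn p(2) less unfolding good_def by (meson less_le_trans)
  qed
qed

end

section \<open>Adaptive stochastic iterations\<close>

text \<open>Independence makes the joint law a product, and Fubini integrates out the second
  variable first. This stands in for conditioning on the past.\<close>

lemma (in prob_space) expectation_indep_var:
  fixes h :: "'b \<Rightarrow> 'b \<Rightarrow> real"
  assumes indep: "indep_var S Z T Y"
    and h: "(\<lambda>(z, y). h z y) \<in> borel_measurable (S \<Otimes>\<^sub>M T)" "\<And>z y. \<bar>h z y\<bar> \<le> B"
  shows "expectation (\<lambda>w. h (Z w) (Y w)) = expectation (\<lambda>w. \<integral>y. h (Z w) y \<partial>distr M T Y)"
proof -
  have Z [measurable]: "Z \<in> measurable M S" and Y [measurable]: "Y \<in> measurable M T"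
    using indep_var_rv1[OF indep] indep_var_rv2[OF indep] by auto
  let ?S = "distr M S Z" and ?T = "distr M T Y"
  interpret S: prob_space ?S by (rule prob_space_distr) (rule Z)
  interpret T: prob_space ?T by (rule prob_space_distr) (rule Y)
  interpret ST: pair_prob_space ?S ?T ..
  have eq: "?S \<Otimes>\<^sub>M ?T = distr M (S \<Otimes>\<^sub>M T) (\<lambda>w. (Z w, Y w))"
    using indep unfolding indep_var_distribution_eq by blast
  have meas: "(\<lambda>p. h (fst p) (snd p)) \<in> borel_measurable (?S \<Otimes>\<^sub>M ?T)"
    using h(1) by (simp add: case_prod_unfold cong: measurable_cong_sets)
  have "(\<lambda>z. \<integral>y. h z y \<partial>?T) \<in> borel_measurable ?S"
    using T.borel_measurable_lebesgue_integral[of "\<lambda>z y. h z y" ?S] meas by (simp add: case_prod_unfold)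
  then have measS: "(\<lambda>z. \<integral>y. h z y \<partial>?T) \<in> borel_measurable S" by simp
  have int: "integrable (?S \<Otimes>\<^sub>M ?T) (\<lambda>p. h (fst p) (snd p))"
    by (rule ST.integrable_const_bound[where B=B]) (simp_all add: h(2) meas)
  have "expectation (\<lambda>w. h (Z w) (Y w)) = (\<integral>p. h (fst p) (snd p) \<partial>(?S \<Otimes>\<^sub>M ?T))"
    unfolding eq using h(1) by (subst integral_distr) (simp_all add: case_prod_unfold)
  also have "\<dots> = (\<integral>z. \<integral>y. h z y \<partial>?T \<partial>?S)"
    using ST.integral_fst'[OF int] by simp
  also have "\<dots> = expectation (\<lambda>w. \<integral>y. h (Z w) y \<partial>?T)"
    by (rule integral_distr[OF Z measS])
  finally show ?thesis .
qed

text \<open>Monotone convergence bounds the expectation of the infinite sum, which is therefore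
  finite almost surely.\<close>

lemma summable_AE_of_expectation_bound:
  fixes u :: "nat \<Rightarrow> 's \<Rightarrow> real"
  assumes meas: "\<And>t. u t \<in> borel_measurable P" and nn: "\<And>t w. w \<in> space P \<Longrightarrow> 0 \<le> u t w"
    and int: "\<And>t. integrable P (u t)" and B: "\<And>T. (\<Sum>t<T. \<integral>w. u t w \<partial>P) \<le> B"
  shows "AE w in P. summable (\<lambda>t. u t w)"
proof -
  have "(\<integral>\<^sup>+w. (\<Sum>t. ennreal (u t w)) \<partial>P) = (\<Sum>t. \<integral>\<^sup>+w. ennreal (u t w) \<partial>P)"
    by (rule nn_integral_suminf) (use meas in measurable)
  also have "\<dots> = (\<Sum>t. ennreal (\<integral>w. u t w \<partial>P))"
    by (intro suminf_cong nn_integral_eq_integral int) (simp add: nn)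
  also have "\<dots> \<le> ennreal B"
  proof (rule suminf_le_const)
    fix T
    have "(\<Sum>t<T. ennreal (\<integral>w. u t w \<partial>P)) = ennreal (\<Sum>t<T. \<integral>w. u t w \<partial>P)"
      by (rule sum_ennreal) (auto intro!: Bochner_Integration.integral_nonneg_AE simp: nn)
    also have "\<dots> \<le> ennreal B" by (rule ennreal_leI) (rule B)
    finally show "(\<Sum>t<T. ennreal (\<integral>w. u t w \<partial>P)) \<le> ennreal B" .
  qed (rule summableI)
  finally have "(\<integral>\<^sup>+w. (\<Sum>t. ennreal (u t w)) \<partial>P) \<noteq> \<infinity>"
    by (auto simp: top_unique)
  then have "AE w in P. (\<Sum>t. ennreal (u t w)) \<noteq> \<infinity>"
    by (intro nn_integral_PInf_AE) (use meas in measurable)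
  then show ?thesis
    by (rule AE_mp) (auto intro!: AE_I2 summable_suminf_not_top nn)
qed

text \<open>The probabilistic part without geometry. \<open>n2\<close> is the squared norm of the
  sampled gradient, \<open>ip\<close> its inner product with the gradient of \<open>F\<close>,
  \<open>b\<close> the squared norm of the latter, and \<open>\<phi>\<close> the step size as a
  function of the accumulated \<open>n2\<close>. The last is a deterministic function of the past,
  which the independence argument relies on.\<close>

locale adaptive_iteration = P: prob_space P + sample: prob_space \<mu>
  for P :: "'s measure" and \<mu> :: "'w measure" +
  fixes step :: "'a::topological_space \<Rightarrow> real \<Rightarrow> 'w \<Rightarrow> 'a"
    and n2 ip :: "'a \<Rightarrow> 'w \<Rightarrow> real" and F b :: "'a \<Rightarrow> real"
    and \<phi> :: "real \<Rightarrow> real" and K :: "'a set" and \<kappa> L M C B :: real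
    and \<omega> :: "nat \<Rightarrow> 's \<Rightarrow> 'w" and x0 :: 'a and X :: "nat \<Rightarrow> 's \<Rightarrow> 'a"
  assumes step_meas: "(\<lambda>(x, s, w). step x s w) \<in> borel_measurable (borel \<Otimes>\<^sub>M (borel \<Otimes>\<^sub>M \<mu>))"
    and n2_meas: "(\<lambda>(x, w). n2 x w) \<in> borel_measurable (borel \<Otimes>\<^sub>M \<mu>)"
    and ip_meas: "(\<lambda>(x, w). ip x w) \<in> borel_measurable (borel \<Otimes>\<^sub>M \<mu>)"
    and F_meas: "F \<in> borel_measurable borel" and b_meas: "b \<in> borel_measurable borel"
    and \<phi>_meas: "\<phi> \<in> borel_measurable borel"
    and K_meas: "K \<in> sets borel"
    and \<phi>: "0 \<le> s \<Longrightarrow> 0 \<le> \<phi> s" "0 \<le> s \<Longrightarrow> \<phi> s \<le> \<kappa>"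
    and n2_bound: "x \<in> K \<Longrightarrow> w \<in> space \<mu> \<Longrightarrow> 0 \<le> n2 x w" "x \<in> K \<Longrightarrow> w \<in> space \<mu> \<Longrightarrow> n2 x w \<le> L"
    and ip_bound: "x \<in> K \<Longrightarrow> w \<in> space \<mu> \<Longrightarrow> \<bar>ip x w\<bar> \<le> M"
    and F_bound: "x \<in> K \<Longrightarrow> \<bar>F x\<bar> \<le> M"
    and b: "x \<in> K \<Longrightarrow> 0 \<le> b x" "x \<in> K \<Longrightarrow> (\<integral>w. ip x w \<partial>\<mu>) = b x"
    and step_K: "x \<in> K \<Longrightarrow> 0 \<le> s \<Longrightarrow> s \<le> \<kappa> \<Longrightarrow> w \<in> space \<mu> \<Longrightarrow> step x s w \<in> K"
    and descent: "x \<in> K \<Longrightarrow> 0 \<le> s \<Longrightarrow> s \<le> \<kappa> \<Longrightarrow> w \<in> space \<mu> \<Longrightarrow>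
      F (step x s w) \<le> F x - s * ip x w + C * (s\<^sup>2 * n2 x w)"
    and C: "0 \<le> C"
    and sum_bound: "\<And>(a :: nat \<Rightarrow> real) T. (\<And>t. 0 \<le> a t) \<Longrightarrow> (\<And>t. a t \<le> L) \<Longrightarrow>
      (\<Sum>t<T. (\<phi> (\<Sum>s<t. a s))\<^sup>2 * a t) \<le> B"
    and indep: "P.indep_vars (\<lambda>_. \<mu>) \<omega> UNIV" and distr_\<omega>: "distr P \<mu> (\<omega> t) = \<mu>"
    and x0: "x0 \<in> K"
    and X_0: "u \<in> space P \<Longrightarrow> X 0 u = x0"
    and X_Suc: "u \<in> space P \<Longrightarrow>
      X (Suc t) u = step (X t u) (\<phi> (\<Sum>i<t. n2 (X i u) (\<omega> i u))) (\<omega> t u)"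
begin

lemma \<omega>_meas: "\<omega> t \<in> measurable P \<mu>"
  using indep unfolding P.indep_vars_def by blast

lemma \<omega>_space: "w \<in> space P \<Longrightarrow> \<omega> t w \<in> space \<mu>"
  using measurable_space[OF \<omega>_meas] .

definition S :: "nat \<Rightarrow> 's \<Rightarrow> real" where
  "S t w = (\<Sum>s<t. n2 (X s w) (\<omega> s w))"

text \<open>Proved together: remaining in \<open>K\<close> requires an admissible step size, hence
  \<open>0 \<le> S t w\<close>, and this sign rests on \<open>n2\<close> being nonnegative on
  \<open>K\<close>.\<close>

lemma X_in_K: "w \<in> space P \<Longrightarrow> X t w \<in> K"
  and S_nonneg: "w \<in> space P \<Longrightarrow> 0 \<le> S t w"
proof (induction t)
  case (Suc t)
  case 1
  then show ?case
    using X_Suc[OF 1, of t] Suc by (simp add: S_def[symmetric] step_K \<phi> \<omega>_space)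
  case 2
  then show ?case using Suc n2_bound(1)[OF _ \<omega>_space, of "X t w" w t] by (simp add: S_def)
qed (auto simp: X_0 x0 S_def)

text \<open>
  The state after \<open>t\<close> steps is a measurable function of the first \<open>t\<close> samples, hence
  independent of the next one.
\<close>

primrec state :: "nat \<Rightarrow> (nat \<Rightarrow> 'w) \<Rightarrow> 'a \<times> real" where
  "state 0 z = (x0, 0)"
| "state (Suc t) z =
    (step (fst (state t z)) (\<phi> (snd (state t z))) (z t), snd (state t z) + n2 (fst (state t z)) (z t))"

text \<open>The index set \<open>{..<n}\<close> stays fixed while \<open>t\<close> grows, so the
  induction never changes the product space.\<close>

lemma state_meas: "t \<le> n \<Longrightarrow> state t \<in> measurable (PiM {..<n} (\<lambda>_. \<mu>)) (borel \<Otimes>\<^sub>M borel)"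
proof (induction t)
  case 0
  have "state 0 = (\<lambda>_. (x0, 0))" by (rule ext) simp
  then show ?case by (simp add: space_pair_measure)
next
  case (Suc t)
  then have st: "state t \<in> measurable (PiM {..<n} (\<lambda>_. \<mu>)) (borel \<Otimes>\<^sub>M borel)"
    and z: "(\<lambda>z. z t) \<in> measurable (PiM {..<n} (\<lambda>_. \<mu>)) \<mu>" by simp_all
  note 1 = measurable_compose[OF st measurable_fst] and 2 = measurable_compose[OF st measurable_snd]
  have "(\<lambda>z. step (fst (state t z)) (\<phi> (snd (state t z))) (z t)) \<in> borel_measurable (PiM {..<n} (\<lambda>_. \<mu>))"
    using measurable_compose[OF measurable_Pair[OF 1 measurable_Pair[OF measurable_compose[OF 2 \<phi>_meas] z]] step_meas]
    by simp
  moreover have "(\<lambda>z. snd (state t z) + n2 (fst (state t z)) (z t)) \<in> borel_measurable (PiM {..<n} (\<lambda>_. \<mu>))"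
    using measurable_compose[OF measurable_Pair[OF 1 z] n2_meas] 2 by simp
  ultimately show ?case by simp
qed

lemma state_eq:
  "w \<in> space P \<Longrightarrow> t \<le> n \<Longrightarrow> state t (restrict (\<lambda>i. \<omega> i w) {..<n}) = (X t w, S t w)"
  by (induction t) (simp_all add: X_0 X_Suc S_def)

lemma indep_samples:
  "P.indep_var (PiM {..<t} (\<lambda>_. \<mu>)) (\<lambda>w. restrict (\<lambda>i. \<omega> i w) {..<t})
    (PiM {t} (\<lambda>_. \<mu>)) (\<lambda>w. restrict (\<lambda>i. \<omega> i w) {t})"
  by (rule P.indep_var_restrict[OF indep]) auto

lemma state_fun_meas: "h \<in> measurable (borel \<Otimes>\<^sub>M borel) N \<Longrightarrow> (\<lambda>w. h (X t w, S t w)) \<in> measurable P N"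
proof -
  assume h: "h \<in> measurable (borel \<Otimes>\<^sub>M borel) N"
  have "(\<lambda>w. h (state t (restrict (\<lambda>i. \<omega> i w) {..<t}))) \<in> measurable P N"
    by (rule measurable_compose[OF measurable_compose[OF P.indep_var_rv1[OF indep_samples] state_meas] h]) simp
  then show ?thesis by (rule measurable_cong[THEN iffD1, rotated]) (simp add: state_eq)
qed

lemma X_meas: "X t \<in> borel_measurable P"
  using state_fun_meas[OF measurable_fst] by simp

lemma step_size_meas: "(\<lambda>w. \<phi> (S t w)) \<in> borel_measurable P"
  using state_fun_meas[OF measurable_compose[OF measurable_snd \<phi>_meas]] by simp

lemma step_size_bounds: "w \<in> space P \<Longrightarrow> 0 \<le> \<phi> (S t w)" "w \<in> space P \<Longrightarrow> \<phi> (S t w) \<le> \<kappa>"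
  using \<phi>[OF S_nonneg] by auto

lemma \<kappa>_nonneg: "0 \<le> \<kappa>" using \<phi>[of 0] by linarith

lemma M_nonneg: "0 \<le> M" using F_bound[OF x0] by linarith

lemma b_le: "x \<in> K \<Longrightarrow> b x \<le> M"
proof -
  assume x: "x \<in> K"
  have "(\<lambda>w. ip x w) \<in> borel_measurable \<mu>"
    using measurable_compose[OF measurable_Pair1' ip_meas, of x] by simp
  then have "integrable \<mu> (ip x)"
    by (intro sample.integrable_const_bound[where B=M]) (use ip_bound[OF x] in auto)
  then have "(\<integral>w. ip x w \<partial>\<mu>) \<le> (\<integral>w. M \<partial>\<mu>)"
    by (rule Bochner_Integration.integral_mono) (use ip_bound[OF x] in \<open>auto simp: abs_le_iff\<close>)
  then show ?thesis using b(2)[OF x] by (simp add: sample.prob_space)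
qed

lemma expectation_ip:
  "P.expectation (\<lambda>w. \<phi> (S t w) * ip (X t w) (\<omega> t w)) = P.expectation (\<lambda>w. \<phi> (S t w) * b (X t w))"
proof -
  \<comment> \<open>Cut off to 0, because \<open>expectation_indep_var\<close> wants a bound for all
    arguments while \<open>ip\<close> and \<open>\<phi>\<close> are controlled only on
    \<open>K\<close> and for nonnegative sums. Along the iteration the cut-off is inactive.\<close>
  define h where "h z w = (if fst z \<in> K \<and> 0 \<le> snd z \<and> w \<in> space \<mu> then \<phi> (snd z) * ip (fst z) w else 0)"
    for z :: "'a \<times> real" and w
  let ?r = "\<lambda>J w. restrict (\<lambda>i. \<omega> i w) J" and ?T = "PiM {t} (\<lambda>_. \<mu>)"
  let ?h = "\<lambda>z y. h (state t z) (y t)"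
  have h_meas: "(\<lambda>(z, w). h z w) \<in> borel_measurable ((borel \<Otimes>\<^sub>M borel) \<Otimes>\<^sub>M \<mu>)"
  proof -
    note [measurable] = \<phi>_meas K_meas
    have [measurable]: "(\<lambda>p. ip (fst (fst p)) (snd p)) \<in> borel_measurable ((borel \<Otimes>\<^sub>M borel) \<Otimes>\<^sub>M \<mu>)"
      using measurable_compose[OF measurable_Pair[OF measurable_compose[OF measurable_fst measurable_fst] measurable_snd] ip_meas]
      by simp
    show ?thesis unfolding h_def case_prod_unfold by measurable
  qed
  have comp: "(\<lambda>y. y t) \<in> measurable ?T \<mu>" by simp
  have "P.expectation (\<lambda>w. ?h (?r {..<t} w) (?r {t} w)) =
      P.expectation (\<lambda>w. \<integral>y. ?h (?r {..<t} w) y \<partial>distr P ?T (?r {t}))"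
  proof (rule P.expectation_indep_var[OF indep_samples])
    show "(\<lambda>(z, y). ?h z y) \<in> borel_measurable (PiM {..<t} (\<lambda>_. \<mu>) \<Otimes>\<^sub>M ?T)"
      using measurable_compose[OF measurable_Pair[OF measurable_compose[OF measurable_fst state_meas[OF order_refl]]
          measurable_compose[OF measurable_snd comp]] h_meas]
      by (simp add: case_prod_unfold)
    show "\<bar>?h z y\<bar> \<le> \<kappa> * M" for z y
      using \<phi>[of "snd (state t z)"] ip_bound[of "fst (state t z)" "y t"] \<kappa>_nonneg M_nonneg
      by (auto simp: h_def abs_mult intro!: mult_mono)
  qed
  moreover have "P.expectation (\<lambda>w. ?h (?r {..<t} w) (?r {t} w)) = P.expectation (\<lambda>w. \<phi> (S t w) * ip (X t w) (\<omega> t w))"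
    by (rule Bochner_Integration.integral_cong)
       (simp_all add: state_eq h_def X_in_K S_nonneg \<omega>_space)
  moreover have "P.expectation (\<lambda>w. \<integral>y. ?h (?r {..<t} w) y \<partial>distr P ?T (?r {t})) =
      P.expectation (\<lambda>w. \<phi> (S t w) * b (X t w))"
  proof (rule Bochner_Integration.integral_cong)
    fix w assume w: "w \<in> space P"
    have hw: "(\<lambda>y. h (X t w, S t w) y) \<in> borel_measurable \<mu>"
      using measurable_compose[OF measurable_Pair1' h_meas, of "(X t w, S t w)"]
      by (simp add: space_pair_measure)
    have "(\<integral>y. h (X t w, S t w) (y t) \<partial>distr P ?T (?r {t})) = P.expectation (\<lambda>v. h (X t w, S t w) (\<omega> t v))"
      by (subst integral_distr[OF P.indep_var_rv2[OF indep_samples] measurable_compose[OF comp hw]]) simp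
    also have "\<dots> = (\<integral>y. h (X t w, S t w) y \<partial>distr P \<mu> (\<omega> t))"
      by (rule integral_distr[OF \<omega>_meas hw, symmetric])
    also have "\<dots> = (\<integral>y. \<phi> (S t w) * ip (X t w) y \<partial>\<mu>)"
      unfolding distr_\<omega>
      by (rule Bochner_Integration.integral_cong) (simp_all add: h_def X_in_K S_nonneg w)
    finally show "(\<integral>y. ?h (?r {..<t} w) y \<partial>distr P ?T (?r {t})) = \<phi> (S t w) * b (X t w)"
      by (simp add: state_eq[OF w] b(2)[OF X_in_K[OF w]])
  qed simp
  ultimately show ?thesis by simp
qed

text \<open>After \<open>expectation_ip\<close> has put \<open>ip\<close> in place of
  \<open>b\<close>, the descent inequality can be summed path by path. The differences of
  \<open>F\<close> telescope to at most \<open>2 * M\<close>, and \<open>sum_bound\<close> limits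
  the quadratic terms to \<open>C * B\<close> on every path.\<close>

theorem summable_weighted: "AE w in P. summable (\<lambda>t. \<phi> (S t w) * b (X t w))"
proof (rule summable_AE_of_expectation_bound[where B="2 * M + C * B"])
  fix t
  show meas: "(\<lambda>w. \<phi> (S t w) * b (X t w)) \<in> borel_measurable P"
    by (intro borel_measurable_times step_size_meas measurable_compose[OF X_meas b_meas])
  show "0 \<le> \<phi> (S t w) * b (X t w)" if "w \<in> space P" for w
    using step_size_bounds b X_in_K that by simp
  show "integrable P (\<lambda>w. \<phi> (S t w) * b (X t w))"
  proof (rule P.integrable_const_bound[OF _ meas])
    show "AE w in P. norm (\<phi> (S t w) * b (X t w)) \<le> \<kappa> * M"
      by (rule AE_I2) (use step_size_bounds b b_le X_in_K \<kappa>_nonneg in \<open>auto simp: abs_mult intro!: mult_mono\<close>)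
  qed
next
  fix T
  have int_ip: "integrable P (\<lambda>w. \<phi> (S t w) * ip (X t w) (\<omega> t w))" for t
  proof (rule P.integrable_const_bound)
    show "AE w in P. norm (\<phi> (S t w) * ip (X t w) (\<omega> t w)) \<le> \<kappa> * M"
      by (rule AE_I2) (use step_size_bounds ip_bound X_in_K \<omega>_space \<kappa>_nonneg in \<open>auto simp: abs_mult intro!: mult_mono\<close>)
    have "(\<lambda>w. ip (X t w) (\<omega> t w)) \<in> borel_measurable P"
      using measurable_compose[OF measurable_Pair[OF X_meas \<omega>_meas] ip_meas] by simp
    then show "(\<lambda>w. \<phi> (S t w) * ip (X t w) (\<omega> t w)) \<in> borel_measurable P"
      by (intro borel_measurable_times step_size_meas)
  qed
  have "(\<Sum>t<T. P.expectation (\<lambda>w. \<phi> (S t w) * b (X t w))) =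
      P.expectation (\<lambda>w. \<Sum>t<T. \<phi> (S t w) * ip (X t w) (\<omega> t w))"
    by (simp add: int_ip expectation_ip)
  also have "\<dots> \<le> P.expectation (\<lambda>w. 2 * M + C * B)"
  proof (rule Bochner_Integration.integral_mono)
    fix w assume w: "w \<in> space P"
    have "\<phi> (S t w) * ip (X t w) (\<omega> t w) \<le>
        F (X t w) - F (X (Suc t) w) + C * ((\<phi> (S t w))\<^sup>2 * n2 (X t w) (\<omega> t w))" for t
      using descent[OF X_in_K[OF w] step_size_bounds[OF w] \<omega>_space[OF w], of t t t] X_Suc[OF w, of t]
      by (simp add: S_def)
    then have "(\<Sum>t<T. \<phi> (S t w) * ip (X t w) (\<omega> t w)) \<le>
        (\<Sum>t<T. (F (X t w) - F (X (Suc t) w)) + C * ((\<phi> (S t w))\<^sup>2 * n2 (X t w) (\<omega> t w)))"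
      by (rule sum_mono)
    also have "\<dots> = (F (X 0 w) - F (X T w)) + C * (\<Sum>t<T. (\<phi> (S t w))\<^sup>2 * n2 (X t w) (\<omega> t w))"
      by (simp only: sum.distrib sum_lessThan_telescope'[of "\<lambda>t. F (X t w)"] sum_distrib_left)
    also have "\<dots> \<le> 2 * M + C * B"
    proof (rule add_mono)
      show "F (X 0 w) - F (X T w) \<le> 2 * M"
        using F_bound[OF X_in_K[OF w, of 0]] F_bound[OF X_in_K[OF w, of T]] by linarith
      show "C * (\<Sum>t<T. (\<phi> (S t w))\<^sup>2 * n2 (X t w) (\<omega> t w)) \<le> C * B"
        unfolding S_def
        by (intro mult_left_mono[OF _ C] sum_bound[of "\<lambda>t. n2 (X t w) (\<omega> t w)"] n2_bound X_in_K \<omega>_space w)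
    qed
    finally show "(\<Sum>t<T. \<phi> (S t w) * ip (X t w) (\<omega> t w)) \<le> 2 * M + C * B" .
  qed (simp_all add: int_ip)
  also have "\<dots> = 2 * M + C * B" by (simp add: P.prob_space)
  finally show "(\<Sum>t<T. P.expectation (\<lambda>w. \<phi> (S t w) * b (X t w))) \<le> 2 * M + C * B" .
qed

end

section \<open>Convergence of stochastic gradient descent\<close>

context random_function begin

text \<open>Up to level \<open>\<rho>0\<close> the first confinement condition applies directly;
  between \<open>\<rho>0\<close> and \<open>\<rho>1\<close> the second one makes
  \<open>\<rho>\<close> non-increasing along the step.\<close>

lemma confinement_step:
  assumes "manifold_Ck A 2 \<rho>" "confinement_levels A g R (space \<mu>) f \<kappa> \<rho> \<rho>0 \<rho>1"
    and x: "\<rho> x \<le> \<rho>1" and s: "0 \<le> s" "s \<le> \<kappa>" and w: "w \<in> space \<mu>"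
  shows "\<rho> (R x (- s *\<^sub>R grad w x)) \<le> \<rho>1"
proof (cases "\<rho> x \<le> \<rho>0")
  case True
  then show ?thesis using assms(2) s w unfolding confinement_levels_def by simp
next
  case False
  have "\<rho> (R x (- s *\<^sub>R grad w x)) \<le> \<rho> x"
  proof (rule descent_of_Hessian_bound[OF assms(1) s])
    fix s assume "0 \<le> s" "s \<le> \<kappa>"
    then show "\<kappa> / 2 * \<bar>hessian (\<rho> \<circ> R x) (- s *\<^sub>R grad w x) (grad w x) (grad w x)\<bar>
        \<le> g x (riemannian_gradient A g \<rho> x) (grad w x)"
      using assms(2) False x w unfolding confinement_levels_def Let_def by simp
  qed
  then show ?thesis using x by simp
qed

text \<open>With the gradient of \<open>F\<close> held fixed, the integrand is the differential of
  the sampled function at that vector, and differentials commute with the expectation. Only scalars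
  are integrated.\<close>

lemma expectation_inner_gradient:
  "(\<integral>w. g x (riemannian_gradient A g F x) (grad w x) \<partial>\<mu>) =
    (tangent_norm g x (riemannian_gradient A g F x))\<^sup>2"
proof -
  let ?G = "riemannian_gradient A g F x"
  have "(\<integral>w. g x ?G (grad w x) \<partial>\<mu>) = (\<integral>w. differential A (\<lambda>y. f y w) x ?G \<partial>\<mu>)"
  proof (rule Bochner_Integration.integral_cong)
    fix w assume "w \<in> space \<mu>"
    then show "g x ?G (grad w x) = differential A (\<lambda>y. f y w) x ?G"
      using inner_product_form_sym[OF inner_product_form] riemannian_gradient[OF f_differentiable] by metis
  qed simp
  also have "\<dots> = differential A F x ?G" by (rule differential_F[symmetric])
  also have "\<dots> = (tangent_norm g x ?G)\<^sup>2"
    unfolding tangent_norm_square by (rule riemannian_gradient[OF F_differentiable, symmetric])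
  finally show ?thesis .
qed

lemma expected_descent:
  assumes K: "compact K"
  obtains C where "0 \<le> C" "\<And>x s w. x \<in> K \<Longrightarrow> 0 \<le> s \<Longrightarrow> s \<le> \<kappa> \<Longrightarrow> w \<in> space \<mu> \<Longrightarrow>
    F (R x (- s *\<^sub>R grad w x)) \<le> F x - s * g x (riemannian_gradient A g F x) (grad w x) +
      C * (s\<^sup>2 * (tangent_norm g x (grad w x))\<^sup>2)"
proof -
  obtain L where L: "0 < L" "\<And>x w. x \<in> K \<Longrightarrow> w \<in> space \<mu> \<Longrightarrow> tangent_norm g x (grad w x) \<le> L"
    using gradient_boundE[OF K] by blast
  \<comment> \<open>A positive radius that covers all step vectors; the sign of
    \<open>\<kappa>\<close> is not fixed in this lemma.\<close>
  have "0 < \<bar>\<kappa>\<bar> * L + 1" using L(1) by (simp add: add_nonneg_pos)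
  from Taylor_bound_F[OF K this] obtain C where C: "0 < C"
    "\<And>x v. x \<in> K \<Longrightarrow> tangent_norm g x v \<le> \<bar>\<kappa>\<bar> * L + 1 \<Longrightarrow>
      \<bar>F (R x v) - F x - differential A F x v\<bar> \<le> C * (tangent_norm g x v)\<^sup>2" by blast
  show thesis
  proof (rule that)
    show "0 \<le> C" using C(1) by simp
    fix x s w assume x: "x \<in> K" and s: "0 \<le> s" "s \<le> \<kappa>" and w: "w \<in> space \<mu>"
    let ?v = "- s *\<^sub>R grad w x"
    have nv: "tangent_norm g x ?v = s * tangent_norm g x (grad w x)"
      using s by (simp only: tangent_norm_scaleR abs_minus_cancel abs_of_nonneg)
    also have "\<dots> \<le> \<kappa> * L" using s L x w by (intro mult_mono) auto
    finally have "tangent_norm g x ?v \<le> \<bar>\<kappa>\<bar> * L + 1" using s by simp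
    from C(2)[OF x this]
    have "F (R x ?v) \<le> F x + differential A F x ?v + C * (tangent_norm g x ?v)\<^sup>2" by linarith
    moreover have "differential A F x ?v = - s * g x (riemannian_gradient A g F x) (grad w x)"
      by (simp only: linear_cmul[OF linear_differential[OF F_differentiable]] riemannian_gradient[OF F_differentiable]
          real_scaleR_def)
    ultimately show "F (R x ?v) \<le> F x - s * g x (riemannian_gradient A g F x) (grad w x) +
      C * (s\<^sup>2 * (tangent_norm g x (grad w x))\<^sup>2)"
      by (simp only: nv power_mult_distrib)
  qed
qed

lemma stationary_pointI:
  "riemannian_gradient A g F x = 0 \<Longrightarrow> stationary_point A g F x"
  using F_differentiable unfolding stationary_point_def by blast

end

theorem theorem2p7:
  fixes A :: "('a::{t2_space, second_countable_topology}, 'e::euclidean_space) chart set"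
    and g :: "'a \<Rightarrow> 'e \<Rightarrow> 'e \<Rightarrow> real"
    and R :: "'a \<Rightarrow> 'e \<Rightarrow> 'a"
    and \<mu> :: "'w measure"
    and f :: "'a \<Rightarrow> 'w \<Rightarrow> real"
    and F \<rho> :: "'a \<Rightarrow> real"
    and \<kappa> \<rho>0 \<rho>1 \<epsilon> \<alpha> \<beta> :: real
    and K1 :: "'a set"
    and P :: "'s measure"
    and \<omega> :: "nat \<Rightarrow> 's \<Rightarrow> 'w"
    and x0 :: 'a
    and X :: "nat \<Rightarrow> 's \<Rightarrow> 'a"
    and \<eta> :: "nat \<Rightarrow> 's \<Rightarrow> real"
  assumes manifold: "riemannian_manifold A g"
    and retraction: "Ck_retraction A 2 R"
    and prob_mu: "prob_space \<mu>"
    and random_function: "\<And>x. f x \<in> borel_measurable \<mu>"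
    and differentiable_f:
      "\<And>w x. w \<in> space \<mu> \<Longrightarrow> manifold_differentiable_at A (\<lambda>y. f y w) x"
    and bounded_f: "locally_bounded (space \<mu>) f"
    and bounded_grad_f:
      "locally_bounded (space \<mu>)
         (\<lambda>x w. tangent_norm g x (riemannian_gradient A g (\<lambda>y. f y w) x))"
    and Lipschitz_f: "locally_R_Lipschitz_gradient g R (space \<mu>) f"
    and F: "\<And>x. F x = (\<integral>w. f x w \<partial>\<mu>)"
    and kappa: "\<kappa> > 0"
    and confinement: "confinement A g R (space \<mu>) f \<kappa> \<rho>"
    and levels: "confinement_levels A g R (space \<mu>) f \<kappa> \<rho> \<rho>0 \<rho>1"
    and K1: "K1 = {x. \<rho> x \<le> \<rho>1}"
    and prob_P: "prob_space P"
    and independent: "prob_space.indep_vars P (\<lambda>_. \<mu>) \<omega> UNIV"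
    and identically_distributed: "\<And>t. distr P \<mu> (\<omega> t) = \<mu>"
    and x0: "x0 \<in> K1"
    and constants: "0 < \<epsilon>" "\<epsilon> \<le> 1 / 2" "0 < \<alpha>" "0 < \<beta>" "\<alpha> / \<beta> powr (1 / 2 + \<epsilon>) \<le> \<kappa>"
    and X_0: "\<And>w. w \<in> space P \<Longrightarrow> X 0 w = x0"
    and X_Suc: "\<And>t w. w \<in> space P \<Longrightarrow>
      X (Suc t) w =
        R (X t w) (- \<eta> t w *\<^sub>R riemannian_gradient A g (\<lambda>y. f y (\<omega> t w)) (X t w))"
    and eta: "\<And>t w. w \<in> space P \<Longrightarrow>
      \<eta> t w =
        \<alpha> / (\<beta> + (\<Sum>s<t. (tangent_norm g (X s w)
                 (riemannian_gradient A g (\<lambda>y. f y (\<omega> s w)) (X s w)))\<^sup>2)) powr (1 / 2 + \<epsilon>)"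
  shows "compact K1 \<and>
    (\<forall>w\<in>space P. (\<forall>t. X t w \<in> K1) \<and> (\<exists>l. limit_point_of_seq (\<lambda>t. X t w) l)) \<and>
    (\<forall>x. manifold_differentiable_at A F x) \<and>
    (AE w in P. (\<lambda>t. tangent_norm g (X t w) (riemannian_gradient A g F (X t w)))
       \<longlonglongrightarrow> 0) \<and>
    (AE w in P. \<forall>l. limit_point_of_seq (\<lambda>t. X t w) l \<longrightarrow> stationary_point A g F l)"
proof -
  interpret P: prob_space P by (rule prob_P)
  have atlas: "smooth_atlas A" using manifold unfolding riemannian_manifold_def by blast
  interpret random_function A g R \<mu> f F
    by (intro random_function.intro riemannian_retraction.intro riemannian.intro smooth_manifold.intro
        riemannian_axioms.intro riemannian_retraction_axioms.intro random_function_axioms.intro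
        atlas manifold retraction prob_mu random_function differentiable_f bounded_f bounded_grad_f Lipschitz_f F)
  let ?dF = "riemannian_gradient A g F"
  define b where "b x = tangent_norm g x (?dF x)" for x
  define n2 where "n2 x w = (tangent_norm g x (grad w x))\<^sup>2" for x w
  define q where "q = 1 / 2 + \<epsilon>"
  define \<phi> where "\<phi> S = \<alpha> / (\<beta> + S) powr q" for S
  \<comment> \<open>\<open>1 < 2 * q\<close> serves \<open>sum_normalized_le\<close>,
    \<open>q \<le> 1\<close> serves \<open>not_summable_step_sizes\<close>.\<close>
  have q: "0 < q" "q \<le> 1" "1 < 2 * q" using constants by (simp_all add: q_def)
  have K1_compact: "compact K1" and C2: "manifold_Ck A 2 \<rho>"
    using confinement unfolding K1 confinement_def by blast+
  obtain L where L: "0 < L" "\<And>x w. x \<in> K1 \<Longrightarrow> w \<in> space \<mu> \<Longrightarrow> tangent_norm g x (grad w x) \<le> L"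
    using gradient_boundE[OF K1_compact] by blast
  have n2: "0 \<le> n2 x w" "x \<in> K1 \<Longrightarrow> w \<in> space \<mu> \<Longrightarrow> n2 x w \<le> L\<^sup>2" for x w
    unfolding n2_def using L(2) by (simp_all add: power_mono)
  have \<phi>: "0 < \<phi> S" "\<phi> S \<le> \<kappa>" if "0 \<le> S" for S
  proof -
    show "0 < \<phi> S" using that constants by (simp add: \<phi>_def)
    have "\<beta> powr q \<le> (\<beta> + S) powr q" using that constants q by (intro powr_mono2) auto
    then have "\<phi> S \<le> \<alpha> / \<beta> powr q"
      unfolding \<phi>_def using that constants by (intro divide_left_mono mult_pos_pos) auto
    then show "\<phi> S \<le> \<kappa>" using constants(5) by (simp add: q_def)
  qed
  have \<phi>_eq: "\<eta> t w = \<phi> (\<Sum>s<t. n2 (X s w) (\<omega> s w))" if "w \<in> space P" for t w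
    using eta[OF that] by (simp add: \<phi>_def n2_def q_def)
  have continuous_b: "continuous_on UNIV b"
    unfolding b_def[abs_def] by (rule continuous_on_norm_gradient_F)
  have "bounded (F ` K1)" "bounded (b ` K1)"
    by (intro compact_imp_bounded compact_continuous_image K1_compact
        continuous_on_subset[OF continuous_on_F] continuous_on_subset[OF continuous_b] subset_UNIV)+
  then obtain MF Mb where MF: "\<And>x. x \<in> K1 \<Longrightarrow> \<bar>F x\<bar> \<le> MF" and Mb: "\<And>x. x \<in> K1 \<Longrightarrow> \<bar>b x\<bar> \<le> Mb"
    unfolding bounded_iff real_norm_def by blast
  have Mb_nonneg: "0 \<le> Mb" using Mb[OF x0] by linarith
  obtain C where C: "0 \<le> C" "\<And>x s w. x \<in> K1 \<Longrightarrow> 0 \<le> s \<Longrightarrow> s \<le> \<kappa> \<Longrightarrow> w \<in> space \<mu> \<Longrightarrow>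
    F (R x (- s *\<^sub>R grad w x)) \<le> F x - s * g x (?dF x) (grad w x) + C * (s\<^sup>2 * n2 x w)"
    unfolding n2_def by (rule expected_descent[OF K1_compact, of \<kappa>]) blast
  \<comment> \<open>The bound of \<open>sum_normalized_le\<close> for exponent \<open>2 * q\<close>
    and terms up to \<open>L\<^sup>2\<close>, times the \<open>\<alpha>\<^sup>2\<close> from the
    squared step sizes.\<close>
  define B where "B = \<alpha>\<^sup>2 * ((1 + L\<^sup>2 / \<beta>) powr (2 * q) * \<beta> powr (1 - 2 * q) / (2 * q - 1))"
  have sum_bound: "(\<Sum>t<T. (\<phi> (\<Sum>s<t. a s))\<^sup>2 * a t) \<le> B"
    if a: "\<And>t. 0 \<le> a t" "\<And>t. a t \<le> L\<^sup>2" for a :: "nat \<Rightarrow> real" and T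
  proof -
    have "(\<phi> S)\<^sup>2 * u = \<alpha>\<^sup>2 * (u / (\<beta> + S) powr (2 * q))" for S u
      by (simp add: \<phi>_def power_divide power2_eq_square[of "_ powr _"] powr_add[symmetric])
    then have "(\<Sum>t<T. (\<phi> (\<Sum>s<t. a s))\<^sup>2 * a t) =
        \<alpha>\<^sup>2 * (\<Sum>t<T. a t / (\<beta> + (\<Sum>s<t. a s)) powr (2 * q))"
      by (simp only: sum_distrib_left)
    also have "\<dots> \<le> B" unfolding B_def
      by (intro mult_left_mono sum_normalized_le a constants q) simp
    finally show ?thesis .
  qed
  \<comment> \<open>The \<open>b\<close> of the locale is the square of the \<open>b\<close> defined
    here. One constant has to bound both \<open>F\<close> and the inner products, hence the
    \<open>max\<close>.\<close>
  interpret adaptive_iteration P \<mu> "\<lambda>x s w. R x (- s *\<^sub>R grad w x)" n2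
    "\<lambda>x w. g x (?dF x) (grad w x)" F "\<lambda>x. (b x)\<^sup>2" \<phi> K1 \<kappa> "L\<^sup>2" "max MF (Mb * L)" C B \<omega> x0 X
  proof
    show "(\<lambda>(x, s, w). R x (- s *\<^sub>R grad w x)) \<in> borel_measurable (borel \<Otimes>\<^sub>M (borel \<Otimes>\<^sub>M \<mu>))"
      by (rule step_measurable)
    show "(\<lambda>(x, w). n2 x w) \<in> borel_measurable (borel \<Otimes>\<^sub>M \<mu>)"
      unfolding n2_def by (rule norm_gradient_measurable)
    show "(\<lambda>(x, w). g x (?dF x) (grad w x)) \<in> borel_measurable (borel \<Otimes>\<^sub>M \<mu>)"
      by (rule inner_gradient_measurable)
    show "F \<in> borel_measurable borel"
      by (rule borel_measurable_continuous_onI[OF continuous_on_F])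
    show "(\<lambda>x. (b x)\<^sup>2) \<in> borel_measurable borel"
      by (intro borel_measurable_power borel_measurable_continuous_onI[OF continuous_b])
    show "\<phi> \<in> borel_measurable borel" unfolding \<phi>_def[abs_def] by measurable
    show "K1 \<in> sets borel" by (intro borel_closed compact_imp_closed K1_compact)
    show "\<bar>g x (?dF x) (grad w x)\<bar> \<le> max MF (Mb * L)" if x: "x \<in> K1" and w: "w \<in> space \<mu>" for x w
    proof -
      have "\<bar>g x (?dF x) (grad w x)\<bar> \<le> b x * tangent_norm g x (grad w x)"
        unfolding b_def by (rule Cauchy_Schwarz)
      also have "\<dots> \<le> Mb * L"
      proof (rule mult_mono)
        show "b x \<le> Mb" using Mb[OF x] by linarith
      qed (simp_all add: L x w Mb_nonneg)
      finally show ?thesis by simp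
    qed
    show "\<bar>F x\<bar> \<le> max MF (Mb * L)" if "x \<in> K1" for x using MF[OF that] by simp
    show "(\<integral>w. g x (?dF x) (grad w x) \<partial>\<mu>) = (b x)\<^sup>2" for x
      unfolding b_def by (rule expectation_inner_gradient)
    show "R x (- s *\<^sub>R grad w x) \<in> K1" if "x \<in> K1" "0 \<le> s" "s \<le> \<kappa>" "w \<in> space \<mu>" for x s w
      using confinement_step[OF C2 levels _ that(2,3,4)] that(1) unfolding K1 by simp
    show "X (Suc t) u = R (X t u) (- \<phi> (\<Sum>i<t. n2 (X i u) (\<omega> i u)) *\<^sub>R grad (\<omega> t u) (X t u))"
      if "u \<in> space P" for t u
      using X_Suc[OF that, of t] unfolding \<phi>_eq[OF that] .
  qed (use \<phi> n2 C sum_bound independent identically_distributed x0 X_0 in \<open>simp_all add: less_imp_le\<close>)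
  have conv: "(\<lambda>t. b (X t w)) \<longlonglongrightarrow> 0"
    if w: "w \<in> space P" and sum: "summable (\<lambda>t. \<phi> (S t w) * (b (X t w))\<^sup>2)" for w
  proof (rule tendsto_0_of_crossings)
    let ?v = "\<lambda>t. - \<phi> (S t w) *\<^sub>R grad (\<omega> t w) (X t w)"
    let ?l = "\<lambda>t. tangent_norm g (X t w) (?v t)"
    note XK = X_in_K[OF w] and \<omega> = \<omega>_space[OF w]
    have l_eq: "?l t = \<phi> (S t w) * tangent_norm g (X t w) (grad (\<omega> t w) (X t w))" for t
      using step_size_bounds(1)[OF w, of t] by (simp only: tangent_norm_scaleR abs_minus_cancel abs_of_nonneg)
    show "0 \<le> \<phi> (S t w)" for t by (rule step_size_bounds[OF w])
    show "0 \<le> b (X t w)" for t by (simp add: b_def)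
    show "summable (\<lambda>t. \<phi> (S t w) * (b (X t w))\<^sup>2)" by (rule sum)
    show "\<not> summable (\<lambda>t. \<phi> (S t w))"
    proof (rule not_summable_step_sizes[of \<alpha> \<beta> "L\<^sup>2" q])
      fix t
      have "S t w \<le> (\<Sum>s<t. L\<^sup>2)" unfolding S_def by (intro sum_mono n2 XK \<omega>)
      then have "S t w \<le> t * L\<^sup>2" by simp
      then have "(\<beta> + S t w) powr q \<le> (\<beta> + t * L\<^sup>2) powr q"
        using S_nonneg[OF w, of t] constants q by (intro powr_mono2) auto
      then show "\<alpha> / (\<beta> + t * L\<^sup>2) powr q \<le> \<phi> (S t w)"
        unfolding \<phi>_def using S_nonneg[OF w, of t] constants
        by (intro divide_left_mono mult_pos_pos) (auto simp: add_pos_nonneg)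
    qed (use constants q in auto)
    show "?l t \<le> L * \<phi> (S t w)" for t
      unfolding l_eq mult.commute[of L]
      by (rule mult_left_mono[OF L(2)[OF XK \<omega>] step_size_bounds(1)[OF w]])
    show "0 < L" by (rule L)
    \<comment> \<open>The squared lengths are the terms of \<open>sum_bound\<close>, so the lengths
      tend to 0 on every path.\<close>
    have "summable (\<lambda>t. (?l t)\<^sup>2)"
    proof (rule bounded_imp_summable)
      fix T
      have "(\<Sum>t\<le>T. (?l t)\<^sup>2) = (\<Sum>t<Suc T. (\<phi> (S t w))\<^sup>2 * n2 (X t w) (\<omega> t w))"
        unfolding l_eq n2_def power_mult_distrib lessThan_Suc_atMost ..
      also have "\<dots> \<le> B"
        unfolding S_def by (rule sum_bound[of "\<lambda>t. n2 (X t w) (\<omega> t w)"]) (intro n2 XK \<omega>)+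
      finally show "(\<Sum>t\<le>T. (?l t)\<^sup>2) \<le> B" .
    qed simp
    then have "(\<lambda>t. sqrt ((?l t)\<^sup>2)) \<longlonglongrightarrow> sqrt 0"
      by (intro tendsto_real_sqrt summable_LIMSEQ_zero)
    then show "?l \<longlonglongrightarrow> 0" by simp
    fix e :: real assume e: "0 < e"
    obtain \<delta> where \<delta>: "0 < \<delta>" "\<And>x v m n. (\<And>t. x t \<in> K1) \<Longrightarrow> (\<And>t. x (Suc t) = R (x t) (v t)) \<Longrightarrow> m \<le> n \<Longrightarrow>
      (\<Sum>t=m..<n. tangent_norm g (x t) (v t)) < \<delta> \<Longrightarrow> \<bar>b (x n) - b (x m)\<bar> < e"
      using path_modulus[OF K1_compact continuous_b e] by blast
    have "X (Suc t) w = R (X t w) (?v t)" for t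
      using X_Suc[OF w, of t] unfolding \<phi>_eq[OF w] S_def .
    from \<delta>(2)[of "\<lambda>t. X t w", OF XK this] \<delta>(1)
    show "\<exists>\<delta>>0. \<forall>m n. m \<le> n \<longrightarrow> (\<Sum>t=m..<n. ?l t) < \<delta> \<longrightarrow> \<bar>b (X n w) - b (X m w)\<bar> < e"
      by blast
  qed
  have AE_conv: "AE w in P. (\<lambda>t. b (X t w)) \<longlonglongrightarrow> 0"
    using summable_weighted by (rule AE_mp) (intro AE_I2 impI conv)
  \<comment> \<open>This holds path by path, so one null set serves all limit points
    simultaneously.\<close>
  have stationary: "stationary_point A g F l"
    if conv: "(\<lambda>t. b (X t w)) \<longlonglongrightarrow> 0" and lim: "limit_point_of_seq (\<lambda>t. X t w) l" for w l
  proof -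
    obtain r where r: "strict_mono r" "((\<lambda>t. X t w) \<circ> r) \<longlonglongrightarrow> l"
      using lim unfolding limit_point_of_seq_def by blast
    have "(\<lambda>n. b (X (r n) w)) \<longlonglongrightarrow> b l"
      using continuous_on_tendsto_compose[OF continuous_b r(2)] by (simp add: comp_def)
    moreover have "(\<lambda>n. b (X (r n) w)) \<longlonglongrightarrow> 0"
      using LIMSEQ_subseq_LIMSEQ[OF conv r(1)] by (simp add: comp_def)
    ultimately have "b l = 0" by (rule LIMSEQ_unique)
    then show ?thesis by (intro stationary_pointI) (simp add: b_def tangent_norm_eq_0)
  qed
  have subseq: "\<exists>l. limit_point_of_seq (\<lambda>t. X t w) l" if w: "w \<in> space P" for w
  proof -
    obtain l r where "strict_mono r" "((\<lambda>t. X t w) \<circ> r) \<longlonglongrightarrow> l"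
      using seq_compactE[OF compact_imp_seq_compact[OF K1_compact], of "\<lambda>t. X t w"] X_in_K[OF w] by metis
    then show ?thesis unfolding limit_point_of_seq_def by blast
  qed
  show ?thesis
  proof (intro conjI ballI allI)
    show "AE w in P. \<forall>l. limit_point_of_seq (\<lambda>t. X t w) l \<longrightarrow> stationary_point A g F l"
      using AE_conv by (rule AE_mp) (intro AE_I2 impI allI stationary)
    show "AE w in P. (\<lambda>t. tangent_norm g (X t w) (?dF (X t w))) \<longlonglongrightarrow> 0"
      using AE_conv unfolding b_def .
  qed (use K1_compact X_in_K subseq F_differentiable in blast)+
qed

end
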